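(* Let $H$ be a bipartite graph with no isolated vertices. The following are equivalent: (i) $H$ is complex-seminorming but not complex-norming; (ii) $H$ is real-seminorming but not real-norming; (iii) $H$ is isomorphic to $mK_{1,1}$, $mK_{1,2d}$ or $mK_{2d,1}$ for some positive integers $m,d$.
   Context: $\mathcal{F}_{\mathbb{R}}$, $\mathcal{F}_{\mathbb{C}}$ are the vector spaces of bounded measurable functions $[0,1]^2\to\mathbb{R}$, resp. $\mathbb{C}$. A bipartite graph has a fixed bipartition $A\cup B$, edges $(u,v)$ with $u\in A$, $v\in B$, and isomorphisms must map $A$ to $A$, $B$ to $B$. $K_{a,b}$ has $a$ vertices in $A$ and $b$ in $B$; $mG$ is the disjoint union of $m$ copies of $G$ with the induced bipartition. With variables $x_u$ ($u\in A$), $y_v$ ($v\in B$) in $[0,1]$ and Lebesgue measure, $t_H(f)=\int\prod_{(u,v)\in E(H)}f(x_u,y_v)$ and, for $\alpha:E(H)\to\{0,1\}$, $t_{H,\alpha}(f)=\int\prod_{e=(u,v)}f(x_u,y_v)^{\alpha(e)}\overline{f(x_u,y_v)}^{1-\alpha(e)}$. $H$ is real-seminorming (resp. real-norming) if $|t_H(\cdot)|^{1/|E(H)|}$ is a seminorm on $\mathcal{F}_{\mathbb{R}}$ (resp. a seminorm vanishing only on functions $0$ a.e.). $H$ is complex-seminorming (resp. complex-norming) if for some $\alpha$, $|t_{H,\alpha}(\cdot)|^{1/|E(H)|}$ is a seminorm on $\mathcal{F}_{\mathbb{C}}$ (resp. a seminorm vanishing only on functions $0$ a.e.). *)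

theory Defs
  imports "HOL-Analysis.Analysis" "HOL-Library.FuncSet"
begin

(* The two sides of the fixed bipartition live on two separate vertex types, so they are
   disjoint by construction, and an edge (u, v) has u on the left and v on the right. *)

record ('a, 'b) bigraph =
  lverts :: "'a set"
  rverts :: "'b set"
  edges :: "('a \<times> 'b) set"

definition bipartite_graph :: "('a, 'b) bigraph \<Rightarrow> bool" where
  "bipartite_graph H \<longleftrightarrow>
     finite (lverts H) \<and> finite (rverts H) \<and> edges H \<subseteq> lverts H \<times> rverts H"

definition no_isolated_vertices :: "('a, 'b) bigraph \<Rightarrow> bool" where
  "no_isolated_vertices H \<longleftrightarrow>
     (\<forall>u\<in>lverts H. \<exists>v\<in>rverts H. (u, v) \<in> edges H) \<and>
     (\<forall>v\<in>rverts H. \<exists>u\<in>lverts H. (u, v) \<in> edges H)"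

definition isomorphic :: "('a, 'b) bigraph \<Rightarrow> ('c, 'd) bigraph \<Rightarrow> bool" where
  "isomorphic G H \<longleftrightarrow>
     (\<exists>\<phi> \<psi>. bij_betw \<phi> (lverts G) (lverts H) \<and> bij_betw \<psi> (rverts G) (rverts H) \<and>
        (\<forall>u\<in>lverts G. \<forall>v\<in>rverts G. (u, v) \<in> edges G \<longleftrightarrow> (\<phi> u, \<psi> v) \<in> edges H))"

definition complete_bipartite :: "nat \<Rightarrow> nat \<Rightarrow> (nat, nat) bigraph" where
  "complete_bipartite a b =
     \<lparr>lverts = {..<a}, rverts = {..<b}, edges = {..<a} \<times> {..<b}\<rparr>"

definition copies :: "nat \<Rightarrow> ('a, 'b) bigraph \<Rightarrow> (nat \<times> 'a, nat \<times> 'b) bigraph" where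
  "copies m G =
     \<lparr>lverts = {..<m} \<times> lverts G,
      rverts = {..<m} \<times> rverts G,
      edges = {((i, u), (i, v)) | i u v. i < m \<and> (u, v) \<in> edges G}\<rparr>"

(* Functions on the unit square are total functions on the plane whose values outside the
   square are ignored; measurable means Lebesgue measurable. *)

definition unit_square :: "(real \<times> real) set" where
  "unit_square = {0..1} \<times> {0..1}"

definition bdd_meas :: "(real \<times> real \<Rightarrow> 'k::real_normed_field) set" where
  "bdd_meas = {f. f \<in> borel_measurable (lebesgue_on unit_square) \<and> bounded (f ` unit_square)}"

definition ae_zero :: "(real \<times> real \<Rightarrow> 'k::real_normed_field) \<Rightarrow> bool" where
  "ae_zero f \<longleftrightarrow> (AE z in lebesgue_on unit_square. f z = 0)"

(* Lebesgue measure on the cube of all assignments (x, y) of points of [0,1] to the vertices.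
   The completion makes (x, y) \<mapsto> f (x u, y v) measurable for every Lebesgue measurable f,
   not only for the Borel measurable ones. *)

definition cube_measure :: "('a, 'b) bigraph \<Rightarrow> (('a \<Rightarrow> real) \<times> ('b \<Rightarrow> real)) measure" where
  "cube_measure H = completion
     ((\<Pi>\<^sub>M u\<in>lverts H. restrict_space lborel {0..1}) \<Otimes>\<^sub>M
      (\<Pi>\<^sub>M v\<in>rverts H. restrict_space lborel {0..1}))"

definition t_real :: "('a, 'b) bigraph \<Rightarrow> (real \<times> real \<Rightarrow> real) \<Rightarrow> real" where
  "t_real H f = (LINT (x, y)|cube_measure H. (\<Prod>(u, v)\<in>edges H. f (x u, y v)))"

definition t_complex ::
  "('a, 'b) bigraph \<Rightarrow> ('a \<times> 'b \<Rightarrow> nat) \<Rightarrow> (real \<times> real \<Rightarrow> complex) \<Rightarrow> complex" where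
  "t_complex H \<alpha> f = (LINT (x, y)|cube_measure H.
     (\<Prod>(u, v)\<in>edges H. f (x u, y v) ^ \<alpha> (u, v) * cnj (f (x u, y v)) ^ (1 - \<alpha> (u, v))))"

definition seminorm_on :: "('s \<Rightarrow> 'k::real_normed_field) set \<Rightarrow> (('s \<Rightarrow> 'k) \<Rightarrow> real) \<Rightarrow> bool" where
  "seminorm_on F p \<longleftrightarrow>
     (\<forall>f\<in>F. 0 \<le> p f) \<and>
     (\<forall>c. \<forall>f\<in>F. p (\<lambda>z. c * f z) = norm c * p f) \<and>
     (\<forall>f\<in>F. \<forall>g\<in>F. p (\<lambda>z. f z + g z) \<le> p f + p g)"

definition norm_mod_ae :: "((real \<times> real \<Rightarrow> 'k::real_normed_field) \<Rightarrow> real) \<Rightarrow> bool" where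
  "norm_mod_ae p \<longleftrightarrow> seminorm_on bdd_meas p \<and> (\<forall>f\<in>bdd_meas. p f = 0 \<longrightarrow> ae_zero f)"

(* For an edgeless H the exponent below is 1 / 0 = 0, so the functional is 1 powr 0 = 1,
   which is not a seminorm: an edgeless graph has none of the four properties. *)

definition real_seminorming :: "('a, 'b) bigraph \<Rightarrow> bool" where
  "real_seminorming H \<longleftrightarrow>
     seminorm_on bdd_meas (\<lambda>f. \<bar>t_real H f\<bar> powr (1 / real (card (edges H))))"

definition real_norming :: "('a, 'b) bigraph \<Rightarrow> bool" where
  "real_norming H \<longleftrightarrow>
     norm_mod_ae (\<lambda>f. \<bar>t_real H f\<bar> powr (1 / real (card (edges H))))"

definition complex_seminorming :: "('a, 'b) bigraph \<Rightarrow> bool" where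
  "complex_seminorming H \<longleftrightarrow>
     (\<exists>\<alpha> \<in> edges H \<rightarrow> {0, 1}.
        seminorm_on bdd_meas (\<lambda>f. norm (t_complex H \<alpha> f) powr (1 / real (card (edges H)))))"

definition complex_norming :: "('a, 'b) bigraph \<Rightarrow> bool" where
  "complex_norming H \<longleftrightarrow>
     (\<exists>\<alpha> \<in> edges H \<rightarrow> {0, 1}.
        norm_mod_ae (\<lambda>f. norm (t_complex H \<alpha> f) powr (1 / real (card (edges H)))))"

end

theory Submission
  imports Defs
begin

text \<open>Real and complex functions are treated together: over \<open>\<real>\<close> conjugation is the identity, and only
  additivity, multiplicativity and \<open>x * c x = \<bar>x\<bar>\<^sup>2\<close> of the conjugation \<open>c\<close> are used.

  Suppose the functional of \<open>H\<close> is a seminorm that vanishes at some \<open>f\<close> which is not 0 a.e. For every \<open>g\<close>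
  the polynomial \<open>t\<^sub>H (g + r f)\<close> in the real variable \<open>r\<close> is bounded, so its linear coefficient is 0. Taking
  for \<open>g\<close> the averages of \<open>f\<close> over the cells of a grid, that coefficient is \<open>\<bar>E(H)\<bar> t\<^sub>H (g)\<close>; hence some
  nonzero step function, that is, a nonzero matrix \<open>m\<close>, has density 0. On matrices a Hoelder-type inequality
  holds up to a constant: the density of \<open>\<Sum>\<^sub>e M\<^sub>e \<otimes> c M\<^sub>e\<close> expands into squared moduli of mixed densities.
  So every mixed density involving \<open>m\<close> vanishes. Testing with indicator matrices, this forces each edge
  to have an endpoint of degree 1. Testing with rows of \<open>\<plusminus>1\<close>, an odd degree forces all degrees on that side
  to be 1, and comparing the indicator of one row with constants on an \<open>n \<times> n\<close> grid as \<open>n \<rightarrow> \<infinity>\<close> bounds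
  every degree by the average degree of its side.

  Conversely, for equal stars with \<open>k\<close> leaves the integral factorises over the stars, and the
  functional is the \<open>L\<^sup>k\<close> norm of the average of \<open>f\<close> over the leaf variable if \<open>k\<close> is even, or the modulus of
  the integral of \<open>f\<close> if \<open>k = 1\<close>.\<close>

section \<open>Matrix densities of bipartite graphs\<close>

text \<open>A Hoelder bound up to a constant is enough because each use of it has a free parameter.
  A matrix of functional 0 can be rescaled at will: the bound stays, while a nonzero mixed density
  would grow. In the comparison of degrees, powers of \<open>n\<close> outgrow every constant.

  Matrices enter because in each linear term of the expansion \<open>f\<close> sits on one edge and
  step functions sit on all others, so the integral sees \<open>f\<close> only through its cell
  averages. Choosing these very averages as \<open>g\<close> makes all linear terms equal. Some grid
  has a nonzero average: up to null sets, quadrants with rational corners meet the square in unions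
  of grid cells, and they generate the Borel sets.

  The functions are merely Lebesgue measurable and the cube carries a completed measure, so
  functions are exchanged for Borel ones equal almost everywhere, and Fubini is applied on the
  uncompleted product.

  Complex norming may use another \<open>\<alpha>\<close> than complex seminorming, so the converse
  needs one function that is null for all \<open>\<alpha>\<close>: a sign in the leaf variable. For
  the seminorm property a suitable \<open>\<alpha>\<close> conjugates half of the leaves of each
  star when \<open>k\<close> is even.\<close>

locale modulus_conjugation =
  fixes c :: "'k::{real_normed_field,euclidean_space} \<Rightarrow> 'k"
  assumes c_add: "c (x + y) = c x + c y"
    and c_mult: "c (x * y) = c x * c y"
    and c_norm_square: "x * c x = of_real ((norm x)\<^sup>2)"
begin

lemma c_zero [simp]: "c 0 = 0"
  using c_add[of 0 0] by simp

lemma c_of_real [simp]: "c (of_real r) = of_real r"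
  using c_norm_square[of "of_real r"] by (cases "r = 0") (auto simp: power2_eq_square)

lemma c_one [simp]: "c 1 = 1"
  using c_of_real[of 1] by simp

lemma norm_c [simp]: "norm (c x) = norm x"
proof (cases "x = 0")
  case False
  have "norm x * norm (c x) = norm x * norm x"
    using c_norm_square[of x] by (metis norm_mult norm_of_real abs_of_nonneg zero_le_power2 power2_eq_square)
  then show ?thesis using False by simp
qed simp

lemma bounded_linear_c: "bounded_linear c"
proof (rule bounded_linear_intro[where K=1])
  show "c (scaleR r x) = scaleR r (c x)" for r x
    by (simp add: scaleR_conv_of_real c_mult)
qed (auto simp: c_add)

lemma c_sum: "c (sum f S) = (\<Sum>x\<in>S. c (f x))"
  by (rule linear_sum[OF bounded_linear.linear[OF bounded_linear_c]])

lemma c_prod: "c (prod f S) = (\<Prod>x\<in>S. c (f x))"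
  by (induction S rule: infinite_finite_induct) (auto simp: c_mult)

text \<open>The exponents \<open>\<alpha>\<close> and \<open>1 - \<alpha>\<close> on an edge amount
  to a choice between a value and its conjugate, so one Boolean per edge carries the same
  information; \<open>True\<close> means unconjugated.\<close>

definition twist :: "bool \<Rightarrow> 'k \<Rightarrow> 'k" where
  "twist b z = (if b then z else c z)"

lemma twist_add: "twist b (x + y) = twist b x + twist b y"
  by (simp add: twist_def c_add)

lemma twist_mult: "twist b (x * y) = twist b x * twist b y"
  by (simp add: twist_def c_mult)

lemma twist_of_real [simp]: "twist b (of_real r) = of_real r"
  by (simp add: twist_def)

lemma twist_zero [simp]: "twist b 0 = 0"
  and twist_one [simp]: "twist b 1 = 1"
  by (simp_all add: twist_def)

lemma norm_twist [simp]: "norm (twist b z) = norm z"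
  by (simp add: twist_def)

lemma twist_eq_0_iff [simp]: "twist b z = 0 \<longleftrightarrow> z = 0"
  using norm_twist[of b z] by (metis norm_eq_zero)

lemma bounded_linear_twist: "bounded_linear (twist b)"
  unfolding twist_def[abs_def] using bounded_linear_c bounded_linear_ident by (cases b) auto

lemma twist_sum: "twist b (sum f S) = (\<Sum>x\<in>S. twist b (f x))"
  by (simp add: twist_def c_sum)

lemma twist_c: "twist b (c z) = c (twist b z)"
  by (simp add: twist_def)

end

text \<open>A homomorphism density with a separate matrix on each edge, which makes it multilinear
  in the decorations. The power of \<open>n\<close> makes it equal to the integral of the
  corresponding step functions.\<close>

definition hom_density ::
  "'a set \<Rightarrow> 'b set \<Rightarrow> ('a \<times> 'b) set \<Rightarrow> nat \<Rightarrow> ('a \<times> 'b \<Rightarrow> nat \<Rightarrow> nat \<Rightarrow> 'k::real_normed_field) \<Rightarrow> 'k"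
  where
  "hom_density A B E n M =
     (\<Sum>\<xi>\<in>A \<rightarrow>\<^sub>E {..<n}. \<Sum>\<eta>\<in>B \<rightarrow>\<^sub>E {..<n}. \<Prod>e\<in>E. M e (\<xi> (fst e)) (\<eta> (snd e)))
       / of_nat n ^ (card A + card B)"

text \<open>Applies the bijection of \<open>k\<close> with \<open>(k mod n, k div n)\<close> at
  every vertex. Coding a pair of indices as one number keeps tensor products within the matrices
  indexed by \<open>nat\<close>.\<close>

lemma sum_PiE_div_mod:
  fixes F :: "('a \<Rightarrow> nat) \<Rightarrow> ('a \<Rightarrow> nat) \<Rightarrow> 'k::comm_monoid_add"
  assumes "0 < n"
  shows "(\<Sum>\<xi>\<in>A \<rightarrow>\<^sub>E {..<n * n'}. F (\<lambda>a\<in>A. \<xi> a mod n) (\<lambda>a\<in>A. \<xi> a div n)) =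
         (\<Sum>\<xi>\<in>A \<rightarrow>\<^sub>E {..<n}. \<Sum>\<xi>'\<in>A \<rightarrow>\<^sub>E {..<n'}. F \<xi> \<xi>')"
  unfolding sum.cartesian_product
proof (rule sum.reindex_bij_witness[where
      i = "\<lambda>(\<xi>, \<xi>'). \<lambda>a\<in>A. \<xi>' a * n + \<xi> a" and
      j = "\<lambda>\<xi>. (\<lambda>a\<in>A. \<xi> a mod n, \<lambda>a\<in>A. \<xi> a div n)"])
  fix \<xi> assume \<xi>: "\<xi> \<in> A \<rightarrow>\<^sub>E {..<n * n'}"
  show "(case (\<lambda>a\<in>A. \<xi> a mod n, \<lambda>a\<in>A. \<xi> a div n) of (\<xi>, \<xi>') \<Rightarrow> \<lambda>a\<in>A. \<xi>' a * n + \<xi> a) = \<xi>"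
    using \<xi> by (auto simp: PiE_iff extensional_def fun_eq_iff)
  show "(\<lambda>a\<in>A. \<xi> a mod n, \<lambda>a\<in>A. \<xi> a div n) \<in> (A \<rightarrow>\<^sub>E {..<n}) \<times> (A \<rightarrow>\<^sub>E {..<n'})"
    using \<xi> assms by (auto simp: PiE_iff less_mult_imp_div_less mult.commute)
next
  fix q assume q: "q \<in> (A \<rightarrow>\<^sub>E {..<n}) \<times> (A \<rightarrow>\<^sub>E {..<n'})"
  have bound: "j * n + i < n * n'" if "i < n" "j < n'" for i j
  proof -
    have "j * n + i < Suc j * n" using that by simp
    also have "\<dots> \<le> n' * n" using that by (intro mult_le_mono1) simp
    finally show ?thesis by (simp add: mult.commute)
  qed
  show "(\<lambda>\<xi>. (\<lambda>a\<in>A. \<xi> a mod n, \<lambda>a\<in>A. \<xi> a div n)) (case q of (\<xi>, \<xi>') \<Rightarrow> \<lambda>a\<in>A. \<xi>' a * n + \<xi> a) = q"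
    using q by (force simp: PiE_iff extensional_def fun_eq_iff)
  show "(case q of (\<xi>, \<xi>') \<Rightarrow> \<lambda>a\<in>A. \<xi>' a * n + \<xi> a) \<in> A \<rightarrow>\<^sub>E {..<n * n'}"
    using q bound by (auto simp: PiE_iff)
qed auto

text \<open>A map into the product index set is a pair of maps, and the weight of the pair is the
  product of the two weights, so both sums separate.\<close>

lemma hom_density_tensor:
  assumes "0 < n" and "finite A" "finite B" and E: "E \<subseteq> A \<times> B"
  shows "hom_density A B E (n * n') (\<lambda>e i j. M e (i mod n) (j mod n) * M' e (i div n) (j div n))
         = hom_density A B E n M * hom_density A B E n' M'"
proof -
  define P where "P M \<xi> \<eta> = (\<Prod>e\<in>E. M e (\<xi> (fst e)) (\<eta> (snd e)))"
    for M :: "'a \<times> 'b \<Rightarrow> nat \<Rightarrow> nat \<Rightarrow> 'c" and \<xi> :: "'a \<Rightarrow> nat" and \<eta> :: "'b \<Rightarrow> nat"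
  have "(\<Sum>\<xi>\<in>A \<rightarrow>\<^sub>E {..<n * n'}. \<Sum>\<eta>\<in>B \<rightarrow>\<^sub>E {..<n * n'}.
          \<Prod>e\<in>E. M e (\<xi> (fst e) mod n) (\<eta> (snd e) mod n) * M' e (\<xi> (fst e) div n) (\<eta> (snd e) div n))
     = (\<Sum>\<xi>\<in>A \<rightarrow>\<^sub>E {..<n * n'}. \<Sum>\<eta>\<in>B \<rightarrow>\<^sub>E {..<n * n'}.
          P M (\<lambda>a\<in>A. \<xi> a mod n) (\<lambda>b\<in>B. \<eta> b mod n) * P M' (\<lambda>a\<in>A. \<xi> a div n) (\<lambda>b\<in>B. \<eta> b div n))"
    unfolding P_def prod.distrib[symmetric]
    using E by (intro sum.cong prod.cong refl) (auto simp: subset_iff)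
  also have "\<dots> = (\<Sum>\<xi>\<in>A \<rightarrow>\<^sub>E {..<n * n'}. \<Sum>\<eta>\<in>B \<rightarrow>\<^sub>E {..<n}. \<Sum>\<eta>'\<in>B \<rightarrow>\<^sub>E {..<n'}.
          P M (\<lambda>a\<in>A. \<xi> a mod n) \<eta> * P M' (\<lambda>a\<in>A. \<xi> a div n) \<eta>')"
  proof (rule sum.cong[OF refl])
    fix \<xi>
    show "(\<Sum>\<eta>\<in>B \<rightarrow>\<^sub>E {..<n * n'}.
          P M (\<lambda>a\<in>A. \<xi> a mod n) (\<lambda>b\<in>B. \<eta> b mod n) * P M' (\<lambda>a\<in>A. \<xi> a div n) (\<lambda>b\<in>B. \<eta> b div n))
        = (\<Sum>\<eta>\<in>B \<rightarrow>\<^sub>E {..<n}. \<Sum>\<eta>'\<in>B \<rightarrow>\<^sub>E {..<n'}.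
          P M (\<lambda>a\<in>A. \<xi> a mod n) \<eta> * P M' (\<lambda>a\<in>A. \<xi> a div n) \<eta>')"
      by (rule sum_PiE_div_mod[where
            F = "\<lambda>\<eta> \<eta>'. P M (\<lambda>a\<in>A. \<xi> a mod n) \<eta> * P M' (\<lambda>a\<in>A. \<xi> a div n) \<eta>'"]) fact
  qed
  also have "\<dots> = (\<Sum>\<xi>\<in>A \<rightarrow>\<^sub>E {..<n}. \<Sum>\<xi>'\<in>A \<rightarrow>\<^sub>E {..<n'}. \<Sum>\<eta>\<in>B \<rightarrow>\<^sub>E {..<n}. \<Sum>\<eta>'\<in>B \<rightarrow>\<^sub>E {..<n'}.
          P M \<xi> \<eta> * P M' \<xi>' \<eta>')"
    by (rule sum_PiE_div_mod[where F = "\<lambda>\<xi> \<xi>'. \<Sum>\<eta>\<in>B \<rightarrow>\<^sub>E {..<n}. \<Sum>\<eta>'\<in>B \<rightarrow>\<^sub>E {..<n'}. P M \<xi> \<eta> * P M' \<xi>' \<eta>'"])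
      fact
  also have "\<dots> = (\<Sum>\<xi>\<in>A \<rightarrow>\<^sub>E {..<n}. \<Sum>\<eta>\<in>B \<rightarrow>\<^sub>E {..<n}. P M \<xi> \<eta>) *
                 (\<Sum>\<xi>'\<in>A \<rightarrow>\<^sub>E {..<n'}. \<Sum>\<eta>'\<in>B \<rightarrow>\<^sub>E {..<n'}. P M' \<xi>' \<eta>')"
    unfolding sum_product by (simp only: sum_distrib_left)
  finally show ?thesis
    by (simp add: hom_density_def P_def power_mult_distrib)
qed

text \<open>Multilinearity: \<open>\<sigma>\<close> records which summand each edge contributes when
  the product of sums is multiplied out.\<close>

lemma hom_density_sum:
  assumes "finite D" "finite E"
  shows "hom_density A B E n (\<lambda>e i j. \<Sum>d\<in>D. N d e i j)
         = (\<Sum>\<sigma>\<in>E \<rightarrow>\<^sub>E D. hom_density A B E n (\<lambda>e. N (\<sigma> e) e))"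
proof -
  have "(\<Sum>\<xi>\<in>A \<rightarrow>\<^sub>E {..<n}. \<Sum>\<eta>\<in>B \<rightarrow>\<^sub>E {..<n}. \<Prod>e\<in>E. \<Sum>d\<in>D. N d e (\<xi> (fst e)) (\<eta> (snd e)))
      = (\<Sum>\<xi>\<in>A \<rightarrow>\<^sub>E {..<n}. \<Sum>\<sigma>\<in>E \<rightarrow>\<^sub>E D. \<Sum>\<eta>\<in>B \<rightarrow>\<^sub>E {..<n}. \<Prod>e\<in>E. N (\<sigma> e) e (\<xi> (fst e)) (\<eta> (snd e)))"
    using assms by (subst sum.swap[of _ "B \<rightarrow>\<^sub>E {..<n}"]) (simp add: prod_sum_PiE)
  also have "\<dots> = (\<Sum>\<sigma>\<in>E \<rightarrow>\<^sub>E D. \<Sum>\<xi>\<in>A \<rightarrow>\<^sub>E {..<n}. \<Sum>\<eta>\<in>B \<rightarrow>\<^sub>E {..<n}. \<Prod>e\<in>E. N (\<sigma> e) e (\<xi> (fst e)) (\<eta> (snd e)))"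
    by (rule sum.swap)
  finally show ?thesis
    by (simp add: hom_density_def sum_divide_distrib)
qed

lemma hom_density_scale:
  assumes "finite E"
  shows "hom_density A B E n (\<lambda>e i j. a e * M e i j) = (\<Prod>e\<in>E. a e) * hom_density A B E n M"
  by (simp add: hom_density_def prod.distrib sum_distrib_left)

lemma hom_density_cong:
  assumes "\<And>e i j. e \<in> E \<Longrightarrow> i < n \<Longrightarrow> j < n \<Longrightarrow> M e i j = M' e i j" "E \<subseteq> A \<times> B"
  shows "hom_density A B E n M = hom_density A B E n M'"
proof -
  have "(\<Prod>e\<in>E. M e (\<xi> (fst e)) (\<eta> (snd e))) = (\<Prod>e\<in>E. M' e (\<xi> (fst e)) (\<eta> (snd e)))"
    if "\<xi> \<in> A \<rightarrow>\<^sub>E {..<n}" "\<eta> \<in> B \<rightarrow>\<^sub>E {..<n}" for \<xi> \<eta>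
    using that assms by (intro prod.cong) (auto simp: PiE_iff)
  then show ?thesis by (simp add: hom_density_def)
qed

lemma hom_density_converse:
  "hom_density B A (E\<inverse>) n (\<lambda>e i j. M (prod.swap e) j i) = hom_density A B E n M"
proof -
  have "E\<inverse> = prod.swap ` E" by auto
  then have "(\<Prod>e\<in>E\<inverse>. M (prod.swap e) (\<eta> (snd e)) (\<xi> (fst e))) = (\<Prod>e\<in>E. M e (\<eta> (fst e)) (\<xi> (snd e)))" for \<xi> \<eta>
    by (simp add: prod.reindex)
  then show ?thesis
    unfolding hom_density_def
    by (subst sum.swap) (simp add: add.commute)
qed

section \<open>Seminorms on matrices\<close>

context modulus_conjugation
begin

definition twisted_density ::
  "'a set \<Rightarrow> 'b set \<Rightarrow> ('a \<times> 'b) set \<Rightarrow> ('a \<times> 'b \<Rightarrow> bool) \<Rightarrow> nat \<Rightarrow> ('a \<times> 'b \<Rightarrow> nat \<Rightarrow> nat \<Rightarrow> 'k) \<Rightarrow> 'k"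
  where
  "twisted_density A B E s n M = hom_density A B E n (\<lambda>e i j. twist (s e) (M e i j))"

definition matrix_functional ::
  "'a set \<Rightarrow> 'b set \<Rightarrow> ('a \<times> 'b) set \<Rightarrow> ('a \<times> 'b \<Rightarrow> bool) \<Rightarrow> nat \<Rightarrow> (nat \<Rightarrow> nat \<Rightarrow> 'k) \<Rightarrow> real"
  where
  "matrix_functional A B E s n m = norm (twisted_density A B E s n (\<lambda>_. m)) powr (1 / real (card E))"

lemma twisted_density_converse:
  "twisted_density B A (E\<inverse>) (s \<circ> prod.swap) n (\<lambda>e i j. M (prod.swap e) j i)
   = twisted_density A B E s n M"
  unfolding twisted_density_def
  using hom_density_converse[of B A E n "\<lambda>e i j. twist (s e) (M e i j)"] by simp

end

text \<open>Homogeneity is automatic for a root of a density, so the triangle inequality is the only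
  analytic assumption. It is required for all sizes because the arguments pass from \<open>n\<close>
  to \<open>n * n\<close> and let \<open>n\<close> grow.\<close>

locale matrix_seminorm = modulus_conjugation +
  fixes A :: "'b set" and B :: "'c set" and E :: "('b \<times> 'c) set" and s :: "'b \<times> 'c \<Rightarrow> bool"
  assumes fin_A: "finite A" and fin_B: "finite B" and E_sub: "E \<subseteq> A \<times> B" and E_ne: "E \<noteq> {}"
    and no_iso_A: "\<And>u. u \<in> A \<Longrightarrow> E `` {u} \<noteq> {}"
    and no_iso_B: "\<And>v. v \<in> B \<Longrightarrow> E\<inverse> `` {v} \<noteq> {}"
    and triangle: "\<And>n m m'. 0 < n \<Longrightarrow> matrix_functional A B E s n (\<lambda>i j. m i j + m' i j)
      \<le> matrix_functional A B E s n m + matrix_functional A B E s n m'"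
begin

abbreviation "P \<equiv> matrix_functional A B E s"
abbreviation "S \<equiv> twisted_density A B E s"

lemma fin_E: "finite E"
  using finite_subset[OF E_sub] fin_A fin_B by auto

lemma card_E_pos: "0 < card E"
  using fin_E E_ne by (simp add: card_gt_0_iff)

text \<open>Transposing all matrices exchanges the two sides, so each statement on degrees of left
  vertices transfers to right vertices.\<close>

lemma matrix_seminorm_converse: "matrix_seminorm c B A (E\<inverse>) (s \<circ> prod.swap)"
proof -
  have *: "matrix_functional B A (E\<inverse>) (s \<circ> prod.swap) n m = P n (\<lambda>i j. m j i)" for n m
    using twisted_density_converse[of B A E s n "\<lambda>_ i j. m j i"] by (simp add: matrix_functional_def)
  show ?thesis
    by unfold_locales (use fin_A fin_B E_sub E_ne no_iso_A no_iso_B triangle in \<open>auto simp: *\<close>)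
qed

lemma P_nonneg [simp]: "0 \<le> P n m"
  by (simp add: matrix_functional_def)

lemma P_power: "P n m ^ card E = norm (S n (\<lambda>_. m))"
  unfolding matrix_functional_def using card_E_pos
  by (cases "S n (\<lambda>_. m) = 0") (auto simp: powr_power)

lemma P_eqI: "\<lbrakk>0 \<le> r; norm (S n (\<lambda>_. m)) = r ^ card E\<rbrakk> \<Longrightarrow> P n m = r"
  using P_power[of n m] card_E_pos by (metis P_nonneg power_eq_iff_eq_base)

lemma S_scale: "S n (\<lambda>e i j. a e * M e i j) = (\<Prod>e\<in>E. twist (s e) (a e)) * S n M"
  unfolding twisted_density_def twist_mult by (rule hom_density_scale[OF fin_E])

lemma P_scale: "P n (\<lambda>i j. a * m i j) = norm a * P n m"
  by (rule P_eqI) (simp_all add: S_scale norm_mult power_mult_distrib P_power prod_norm[symmetric])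

lemma P_zero: "P n (\<lambda>i j. 0) = 0"
  using P_scale[of n 0] by simp

lemma P_sum:
  assumes "0 < n" "finite D"
  shows "P n (\<lambda>i j. \<Sum>d\<in>D. m d i j) \<le> (\<Sum>d\<in>D. P n (m d))"
  using assms(2)
proof induction
  case (insert d D)
  then show ?case
    using triangle[OF assms(1), of "m d" "\<lambda>i j. \<Sum>d\<in>D. m d i j"] by simp
qed (simp add: P_zero)

lemma S_conjugate: "S n (\<lambda>e i j. c (M e i j)) = c (S n M)"
proof -
  have "c (of_nat n ^ k) = of_nat n ^ k" for k
    using c_of_real[of "real n ^ k"] by simp
  moreover have "c (x / y) = c x / c y" for x y
  proof (cases "y = 0")
    case False
    have "c (x / y) * c y = c x" using False by (simp add: c_mult[symmetric])
    moreover have "c y \<noteq> 0" using False by (metis norm_c norm_eq_zero)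
    ultimately show ?thesis by (simp add: field_simps)
  qed simp
  ultimately show ?thesis
    by (simp add: twisted_density_def hom_density_def c_sum c_prod twist_c)
qed

text \<open>By multiplicativity the density is \<open>S n M\<close> times its conjugate: an
  arbitrary scalar becomes a nonnegative real that still determines its modulus.\<close>

lemma S_tensor:
  assumes "0 < n"
  shows "S (n * n) (\<lambda>e i j. M e (i mod n) (j mod n) * c (M e (i div n) (j div n)))
         = of_real ((norm (S n M))\<^sup>2)"
proof -
  have "S (n * n) (\<lambda>e i j. M e (i mod n) (j mod n) * c (M e (i div n) (j div n)))
      = S n M * S n (\<lambda>e i j. c (M e i j))"
    unfolding twisted_density_def twist_mult
    by (rule hom_density_tensor[OF assms fin_A fin_B E_sub])
  then show ?thesis by (simp add: S_conjugate c_norm_square)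
qed

lemma P_tensor:
  assumes "0 < n"
  shows "P (n * n) (\<lambda>i j. m (i mod n) (j mod n) * c (m (i div n) (j div n))) = (P n m)\<^sup>2"
proof (rule P_eqI)
  show "norm (S (n * n) (\<lambda>_ i j. m (i mod n) (j mod n) * c (m (i div n) (j div n)))) = ((P n m)\<^sup>2) ^ card E"
    using S_tensor[OF assms, of "\<lambda>_. m"]
    by (simp add: norm_power power_mult[symmetric] mult.commute[of 2] del: of_real_power) (simp add: power_mult P_power)
qed simp

text \<open>Tensoring each matrix with its conjugate makes all terms in the expansion of the density of
  the sum nonnegative, so a single term is bounded by the whole.\<close>

lemma hoelder_up_to_constant:
  assumes n: "0 < n"
  shows "(norm (S n M))\<^sup>2 \<le> (\<Sum>e\<in>E. (P n (M e))\<^sup>2) ^ card E"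
proof -
  define T where "T m i j = m (i mod n) (j mod n) * c (m (i div n) (j div n))" for m :: "nat \<Rightarrow> nat \<Rightarrow> 'a" and i j
  have "S (n * n) (\<lambda>_ i j. \<Sum>d\<in>E. T (M d) i j)
      = (\<Sum>\<sigma>\<in>E \<rightarrow>\<^sub>E E. S (n * n) (\<lambda>e. T (M (\<sigma> e))))"
    unfolding twisted_density_def twist_sum
    using hom_density_sum[OF fin_E fin_E, of A B "n * n" "\<lambda>d e i j. twist (s e) (T (M d) i j)"] .
  also have "\<dots> = (\<Sum>\<sigma>\<in>E \<rightarrow>\<^sub>E E. of_real ((norm (S n (\<lambda>e. M (\<sigma> e))))\<^sup>2))"
    unfolding T_def by (intro sum.cong refl S_tensor n)
  finally have eq: "S (n * n) (\<lambda>_ i j. \<Sum>d\<in>E. T (M d) i j)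
      = of_real (\<Sum>\<sigma>\<in>E \<rightarrow>\<^sub>E E. (norm (S n (\<lambda>e. M (\<sigma> e))))\<^sup>2)" by simp
  \<comment> \<open>The term to be isolated belongs to the identity decoration, restricted to
    \<open>E\<close> because members of \<open>PiE\<close> are extensional.\<close>
  have "S n M = S n (\<lambda>e. M (restrict (\<lambda>e. e) E e))"
    unfolding twisted_density_def by (rule hom_density_cong[OF _ E_sub]) simp
  then have "(norm (S n M))\<^sup>2 \<le> (\<Sum>\<sigma>\<in>E \<rightarrow>\<^sub>E E. (norm (S n (\<lambda>e. M (\<sigma> e))))\<^sup>2)"
    by (simp only:) (rule member_le_sum, auto intro!: finite_PiE fin_E)
  also have "\<dots> = norm (S (n * n) (\<lambda>_ i j. \<Sum>d\<in>E. T (M d) i j))"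
    unfolding eq norm_of_real by (simp add: sum_nonneg)
  also have "\<dots> = P (n * n) (\<lambda>i j. \<Sum>d\<in>E. T (M d) i j) ^ card E"
    by (simp add: P_power)
  also have "\<dots> \<le> (\<Sum>d\<in>E. P (n * n) (T (M d))) ^ card E"
    by (intro power_mono P_sum) (use n fin_E in auto)
  also have "(\<Sum>d\<in>E. P (n * n) (T (M d))) = (\<Sum>e\<in>E. (P n (M e))\<^sup>2)"
    unfolding T_def[abs_def] using n by (simp add: P_tensor)
  finally show ?thesis .
qed

text \<open>Scaling the matrix on \<open>e\<close> by \<open>r\<close> multiplies
  \<open>S n M\<close> by \<open>r\<close> but leaves the Hoelder bound \<open>C\<close> unchanged,
  since this matrix contributes 0 to the sum. For large \<open>r\<close> this is a contradiction
  unless \<open>S n M\<close> vanishes.\<close>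

lemma null_decoration:
  assumes n: "0 < n" and null: "S n (\<lambda>_. M e) = 0" and e: "e \<in> E"
  shows "S n M = 0"
proof (rule ccontr)
  assume ne: "S n M \<noteq> 0"
  have P0: "P n (M e) = 0"
    using P_power[of n "M e"] null card_E_pos by simp
  define C where "C = (\<Sum>e\<in>E. (P n (M e))\<^sup>2) ^ card E"
  have bound: "(r * norm (S n M))\<^sup>2 \<le> C" if r: "0 \<le> r" for r :: real
  proof -
    define M' where "M' = (\<lambda>d i j. (if d = e then of_real r else 1) * M d i j)"
    have "S n M' = of_real r * S n M"
      unfolding M'_def S_scale using fin_E e
      by (simp add: if_distrib[of "twist _"] prod.delta cong: if_cong)
    moreover have "(\<Sum>e\<in>E. (P n (M' e))\<^sup>2) = (\<Sum>e\<in>E. (P n (M e))\<^sup>2)"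
    proof (rule sum.cong[OF refl])
      fix d
      have "P n (M' d) = norm (if d = e then of_real r else 1 :: 'a) * P n (M d)"
        unfolding M'_def by (rule P_scale)
      then show "(P n (M' d))\<^sup>2 = (P n (M d))\<^sup>2" using P0 by auto
    qed
    ultimately show ?thesis
      using hoelder_up_to_constant[OF n, of M'] r by (simp add: norm_mult C_def)
  qed
  \<comment> \<open>With this \<open>r\<close> the bound reads
    \<open>(C + 1)\<^sup>2 \<le> C\<close>, which no nonnegative \<open>C\<close> satisfies.\<close>
  define r where "r = (C + 1) / norm (S n M)"
  have C: "0 \<le> C" unfolding C_def by (simp add: sum_nonneg)
  have "(C + 1)\<^sup>2 \<le> C"
    using bound[of r] C ne by (simp add: r_def)
  then show False using C by (simp add: power2_eq_square algebra_simps) (smt (verit) mult_nonneg_nonneg)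
qed

end

section \<open>Constraints on the vertex degrees\<close>

lemma sum_PiE_coordinate:
  fixes f :: "nat \<Rightarrow> 'k::comm_semiring_1"
  assumes "finite B" "v \<in> B"
  shows "(\<Sum>\<eta>\<in>B \<rightarrow>\<^sub>E {..<n}. f (\<eta> v)) = of_nat n ^ (card B - 1) * (\<Sum>j<n. f j)"
proof -
  have "(\<Sum>\<eta>\<in>B \<rightarrow>\<^sub>E {..<n}. f (\<eta> v)) = (\<Sum>\<eta>\<in>B \<rightarrow>\<^sub>E {..<n}. \<Prod>w\<in>B. if w = v then f (\<eta> w) else 1)"
    using assms by (simp add: prod.delta)
  also have "\<dots> = (\<Prod>w\<in>B. \<Sum>j<n. if w = v then f j else 1)"
    using assms by (subst prod_sum_PiE) auto
  also have "\<dots> = (\<Sum>j<n. f j) * (\<Prod>w\<in>B - {v}. of_nat n)"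
    using assms by (subst prod.remove[of _ v]) (auto intro!: prod.cong)
  finally show ?thesis using assms by (simp add: mult.commute)
qed

context matrix_seminorm
begin

text \<open>With \<open>m\<close> on \<open>(u, v)\<close>, a row indicator on
  \<open>(u, v')\<close> pins the image of \<open>u\<close> to \<open>i\<close>, a column indicator
  on \<open>(u', v)\<close> pins the image of \<open>v\<close> to \<open>j\<close>, and all other
  edges carry 1. The mixed density is then a nonzero multiple of the twisted entry, and
  \<open>null_decoration\<close> makes it vanish.\<close>

lemma null_entry:
  assumes n: "0 < n" and null: "S n (\<lambda>_. m) = 0"
    and e: "(u, v) \<in> E" "(u, v') \<in> E" "(u', v) \<in> E" and ne: "v' \<noteq> v" "u' \<noteq> u"
    and i: "i < n" and j: "j < n"
  shows "m i j = 0"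
proof -
  define M :: "'b \<times> 'c \<Rightarrow> nat \<Rightarrow> nat \<Rightarrow> 'a" where
    "M e k l = (if e = (u, v) then m k l else if e = (u, v') then of_bool (k = i)
                else if e = (u', v) then of_bool (l = j) else 1)" for e k l
  define K where "K = {\<xi> \<in> A \<rightarrow>\<^sub>E {..<n}. \<xi> u = i}"
  define L where "L = {\<eta> \<in> B \<rightarrow>\<^sub>E {..<n}. \<eta> v = j}"
  have uv: "u \<in> A" "v \<in> B" using e E_sub by auto
  have "S n M = 0"
    by (rule null_decoration[OF n _ e(1)]) (use null in \<open>simp add: M_def[abs_def]\<close>)
  moreover have "(\<Prod>e\<in>E. twist (s e) (M e (\<xi> (fst e)) (\<eta> (snd e))))
      = of_bool (\<xi> u = i) * of_bool (\<eta> v = j) * twist (s (u, v)) (m i j)" for \<xi> \<eta>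
  proof -
    define f where "f e = twist (s e) (M e (\<xi> (fst e)) (\<eta> (snd e)))" for e
    have "prod f E = f (u, v) * (f (u, v') * (f (u', v) * prod f (E - {(u, v)} - {(u, v')} - {(u', v)})))"
      using e ne fin_E prod.remove[of E "(u, v)" f] prod.remove[of "E - {(u, v)}" "(u, v')" f]
        prod.remove[of "E - {(u, v)} - {(u, v')}" "(u', v)" f] by auto
    also have "prod f (E - {(u, v)} - {(u, v')} - {(u', v)}) = 1"
      by (rule prod.neutral) (auto simp: f_def M_def)
    finally show ?thesis using ne by (auto simp: f_def M_def)
  qed
  ultimately have "(\<Sum>\<xi>\<in>A \<rightarrow>\<^sub>E {..<n}. \<Sum>\<eta>\<in>B \<rightarrow>\<^sub>E {..<n}.
      of_bool (\<xi> u = i) * of_bool (\<eta> v = j) * twist (s (u, v)) (m i j)) = 0"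
    using n by (simp add: twisted_density_def hom_density_def)
  moreover have "(\<Sum>\<xi>\<in>A \<rightarrow>\<^sub>E {..<n}. \<Sum>\<eta>\<in>B \<rightarrow>\<^sub>E {..<n}.
      of_bool (\<xi> u = i) * of_bool (\<eta> v = j) * twist (s (u, v)) (m i j))
    = (\<Sum>\<xi>\<in>A \<rightarrow>\<^sub>E {..<n}. of_bool (\<xi> u = i)) * (\<Sum>\<eta>\<in>B \<rightarrow>\<^sub>E {..<n}. of_bool (\<eta> v = j))
        * twist (s (u, v)) (m i j)"
    unfolding sum_product by (simp only: sum_distrib_right)
  moreover have "(\<Sum>\<xi>\<in>A \<rightarrow>\<^sub>E {..<n}. of_bool (\<xi> u = i)) \<noteq> (0::'a)"
    using sum_PiE_coordinate[OF fin_A uv(1), of "\<lambda>k. of_bool (k = i) :: 'a" n] n i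
    by (simp add: of_bool_def sum.delta)
  moreover have "(\<Sum>\<eta>\<in>B \<rightarrow>\<^sub>E {..<n}. of_bool (\<eta> v = j)) \<noteq> (0::'a)"
    using sum_PiE_coordinate[OF fin_B uv(2), of "\<lambda>k. of_bool (k = j) :: 'a" n] n j
    by (simp add: of_bool_def sum.delta)
  ultimately show ?thesis by auto
qed

text \<open>Here only \<open>u\<close> is known to have a second neighbour: the row can be pinned as
  in \<open>null_entry\<close>, but the column stays free, so what is forced to vanish is a row
  sum.\<close>

lemma null_row_sum:
  assumes n: "0 < n" and null: "S n (\<lambda>_. m) = 0"
    and e: "(u, v) \<in> E" "(u, v') \<in> E" and ne: "v' \<noteq> v" and i: "i < n"
  shows "(\<Sum>j<n. m i j) = 0"
proof -
  define M :: "'b \<times> 'c \<Rightarrow> nat \<Rightarrow> nat \<Rightarrow> 'a" where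
    "M e k l = (if e = (u, v) then m k l else if e = (u, v') then of_bool (k = i) else 1)" for e k l
  have uv: "u \<in> A" "v \<in> B" using e E_sub by auto
  have "S n M = 0"
    by (rule null_decoration[OF n _ e(1)]) (use null in \<open>simp add: M_def[abs_def]\<close>)
  moreover have "(\<Prod>e\<in>E. twist (s e) (M e (\<xi> (fst e)) (\<eta> (snd e))))
      = of_bool (\<xi> u = i) * twist (s (u, v)) (m i (\<eta> v))" for \<xi> \<eta>
  proof -
    define f where "f e = twist (s e) (M e (\<xi> (fst e)) (\<eta> (snd e)))" for e
    have "prod f E = f (u, v) * (f (u, v') * prod f (E - {(u, v)} - {(u, v')}))"
      using e ne fin_E prod.remove[of E "(u, v)" f] prod.remove[of "E - {(u, v)}" "(u, v')" f] by auto
    also have "prod f (E - {(u, v)} - {(u, v')}) = 1"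
      by (rule prod.neutral) (auto simp: f_def M_def)
    finally show ?thesis using ne by (auto simp: f_def M_def)
  qed
  ultimately have "(\<Sum>\<xi>\<in>A \<rightarrow>\<^sub>E {..<n}. \<Sum>\<eta>\<in>B \<rightarrow>\<^sub>E {..<n}.
      of_bool (\<xi> u = i) * twist (s (u, v)) (m i (\<eta> v))) = 0"
    using n by (simp add: twisted_density_def hom_density_def)
  moreover have "(\<Sum>\<xi>\<in>A \<rightarrow>\<^sub>E {..<n}. \<Sum>\<eta>\<in>B \<rightarrow>\<^sub>E {..<n}.
      of_bool (\<xi> u = i) * twist (s (u, v)) (m i (\<eta> v)))
    = (\<Sum>\<xi>\<in>A \<rightarrow>\<^sub>E {..<n}. of_bool (\<xi> u = i)) * (\<Sum>\<eta>\<in>B \<rightarrow>\<^sub>E {..<n}. twist (s (u, v)) (m i (\<eta> v)))"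
    unfolding sum_product ..
  moreover have "(\<Sum>\<xi>\<in>A \<rightarrow>\<^sub>E {..<n}. of_bool (\<xi> u = i)) \<noteq> (0::'a)"
    using sum_PiE_coordinate[OF fin_A uv(1), of "\<lambda>k. of_bool (k = i) :: 'a" n] n i
    by (simp add: of_bool_def sum.delta)
  ultimately have "(\<Sum>j<n. twist (s (u, v)) (m i j)) = 0"
    using sum_PiE_coordinate[OF fin_B uv(2), of "\<lambda>j. twist (s (u, v)) (m i j)" n] n by simp
  then show ?thesis by (simp add: twist_sum[symmetric])
qed

text \<open>Matrices constant along rows give an integrand of this shape. Grouping the edges by left
  endpoint turns degrees into exponents, and the density factors over the left vertices.\<close>

lemma prod_edges_fibres:
  fixes g :: "'b \<Rightarrow> 'd::comm_monoid_mult"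
  shows "(\<Prod>e\<in>E. g (fst e)) = (\<Prod>u\<in>A. g u ^ card (E `` {u}))"
proof -
  have "E = (SIGMA u:A. E `` {u})" using E_sub by auto
  moreover have "finite (E `` {u})" for u using fin_E by auto
  ultimately show ?thesis
    using fin_A prod.Sigma[of A "\<lambda>u. E `` {u}" "\<lambda>u v. g u"] by (simp add: split_beta)
qed

lemma sum_degrees: "(\<Sum>u\<in>A. card (E `` {u})) = card E"
proof -
  have "E = (SIGMA u:A. E `` {u})" using E_sub by auto
  moreover have "finite (E `` {u})" for u using fin_E by auto
  ultimately show ?thesis
    using fin_A card_SigmaI[of A "\<lambda>u. E `` {u}"] by simp
qed

lemma degree_pos: "u \<in> A \<Longrightarrow> 0 < card (E `` {u})"
  using no_iso_A[of u] fin_E by (simp add: card_gt_0_iff finite_Image)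

lemma other_neighbour:
  assumes "(u, v) \<in> E" "card (E `` {u}) \<noteq> 1"
  obtains v' where "(u, v') \<in> E" "v' \<noteq> v"
proof -
  have "E `` {u} \<noteq> {v}" using assms(2) by auto
  then show ?thesis using assms(1) that by blast
qed

text \<open>The odd degree makes the factor of \<open>u\<close> equal to \<open>1 + (-1)\<close>, so
  the sign matrix is null. A vertex \<open>w\<close> with two neighbours would force its row sums to
  vanish, but row 0 sums to 2.\<close>

lemma odd_degree:
  assumes u: "u \<in> A" "odd (card (E `` {u}))" and w: "w \<in> A"
  shows "card (E `` {w}) = 1"
proof (rule ccontr)
  assume w1: "card (E `` {w}) \<noteq> 1"
  obtain v where v: "(w, v) \<in> E" using no_iso_A[OF w] by auto
  obtain v' where v': "(w, v') \<in> E" "v' \<noteq> v" using other_neighbour[OF v w1] .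
  \<comment> \<open>The signs are real, so every \<open>twist\<close> fixes them.\<close>
  define g :: "nat \<Rightarrow> 'a" where "g i = of_real (if i = 0 then 1 else -1)" for i
  have "(\<Sum>\<xi>\<in>A \<rightarrow>\<^sub>E {..<2}. \<Prod>e\<in>E. g (\<xi> (fst e))) = (\<Prod>u\<in>A. \<Sum>i<2. g i ^ card (E `` {u}))"
    using fin_A by (simp add: prod_edges_fibres[of "\<lambda>u. g (\<xi> u)" for \<xi>] prod_sum_PiE)
  also have "\<dots> = 0"
  proof (rule prod_zero[OF fin_A], rule bexI[OF _ u(1)])
    show "(\<Sum>i<2. g i ^ card (E `` {u})) = 0"
      using u(2) by (simp add: g_def numeral_2_eq_2 lessThan_Suc)
  qed
  finally have "S 2 (\<lambda>_ i j. g i) = 0"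
    by (simp add: twisted_density_def hom_density_def g_def)
      (simp add: sum_distrib_left[symmetric])
  from null_row_sum[OF _ this v v', of 0] show False
    by (simp add: g_def)
qed

text \<open>The row indicator \<open>I\<close> has density \<open>1 / n ^ card A\<close>, since it
  confines all left vertices to row 0; hence \<open>l * I\<close> has functional 1. Placed only on
  the \<open>d\<close> edges at \<open>u\<close>, it confines a single vertex and gives the mixed
  density \<open>l ^ d / n\<close>. Boundedness in \<open>n\<close> forces
  \<open>d * card A / card E\<close> to be at most 1.\<close>

lemma degree_le_average:
  assumes u: "u \<in> A"
  shows "card A * card (E `` {u}) \<le> card E"
proof (rule ccontr)
  assume "\<not> ?thesis"
  then have gt: "Suc (card E) \<le> card A * card (E `` {u})" by simp
  define I :: "nat \<Rightarrow> nat \<Rightarrow> 'a" where "I i j = of_bool (i = 0)" for i j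
  \<comment> \<open>The inner power is the Hoelder bound for \<open>card E\<close> matrices of
    functional 1; the outer power arises when the root in \<open>l\<close> is cleared.\<close>
  have bound: "real n \<le> (real (card E) ^ card E) ^ card E" if n: "0 < n" for n :: nat
  proof -
    define l where "l = real n powr (real (card A) / real (card E))"
    have l: "0 < l" "l ^ card E = real n ^ card A"
      using n card_E_pos by (simp_all add: l_def powr_power powr_realpow)
    have nz: "(of_nat n :: 'a) \<noteq> 0" using n by simp
    have single: "(\<Sum>\<xi>\<in>A \<rightarrow>\<^sub>E {..<n}. \<Prod>u\<in>A. of_bool (\<xi> u = 0)) = (1::'a)"
      using n fin_A prod_sum_PiE[of A "\<lambda>_. {..<n}" "\<lambda>_ k. of_bool (k = 0) :: 'a"]
      by (simp add: of_bool_def sum.delta)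
    \<comment> \<open>Every left vertex has an edge, so row 0 on all edges means row 0 at all left
      vertices.\<close>
    have "(\<Prod>e\<in>E. of_bool (\<xi> (fst e) = 0)) = (\<Prod>u\<in>A. of_bool (\<xi> u = 0) :: 'a)" for \<xi> :: "'b \<Rightarrow> nat"
      unfolding prod_edges_fibres[of "\<lambda>u. of_bool (\<xi> u = 0) :: 'a"]
      using degree_pos by (intro prod.cong) (auto simp: of_bool_def)
    then have "S n (\<lambda>_. I) = 1 / of_nat n ^ card A"
      using single nz fin_B
      by (simp add: twisted_density_def hom_density_def I_def[abs_def] of_bool_def if_distrib[of "twist _"] sum_distrib_left[symmetric]
          card_PiE power_add cong: if_cong)
    then have "norm (S n (\<lambda>_. I)) = (1 / l) ^ card E"
      using l by (simp add: norm_divide norm_power power_divide)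
    then have PI: "P n I = 1 / l" using l by (intro P_eqI) auto
    have "S n (\<lambda>_ i j. 1) = 1"
      using nz fin_A fin_B by (simp add: twisted_density_def hom_density_def card_PiE power_add)
    then have P1: "P n (\<lambda>i j. 1) = 1" by (intro P_eqI) auto
    define M where "M e = (if fst e = u then (\<lambda>i j. of_real l * I i j) else (\<lambda>i j. 1))" for e :: "'b \<times> 'c"
    have PM: "P n (M e) = 1" for e
      using l P1 PI by (simp add: M_def P_scale)
    define d where "d = card (E `` {u})"
    have d: "0 < d" using degree_pos[OF u] by (simp add: d_def)
    have "(\<Prod>e\<in>E. twist (s e) (M e (\<xi> (fst e)) (\<eta> (snd e)))) = (of_real l ^ d) * of_bool (\<xi> u = 0)" for \<xi> :: "'b \<Rightarrow> nat" and \<eta>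
    proof -
      have "(\<Prod>e\<in>E. twist (s e) (M e (\<xi> (fst e)) (\<eta> (snd e))))
         = (\<Prod>e\<in>E. (\<lambda>w. if w = u then of_real l * of_bool (\<xi> u = 0) else 1) (fst e))"
        by (rule prod.cong) (auto simp: M_def I_def of_bool_def)
      also have "\<dots> = (\<Prod>w\<in>A. (if w = u then of_real l * of_bool (\<xi> u = 0) else 1) ^ card (E `` {w}))"
        by (rule prod_edges_fibres)
      also have "\<dots> = (\<Prod>w\<in>A. if w = u then (of_real l * of_bool (\<xi> u = 0)) ^ d else 1)"
        by (rule prod.cong) (auto simp: d_def)
      also have "\<dots> = (of_real l * of_bool (\<xi> u = 0)) ^ d"
        using fin_A u by (simp add: prod.delta)
      finally show ?thesis using d by (simp add: of_bool_def)
    qed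
    then have "S n M = (of_real l ^ d) * (\<Sum>\<xi>\<in>A \<rightarrow>\<^sub>E {..<n}. of_bool (\<xi> u = 0)) / of_nat n ^ card A"
      using nz fin_B
      by (simp add: twisted_density_def hom_density_def sum_distrib_left[symmetric] card_PiE power_add)
    also have "(\<Sum>\<xi>\<in>A \<rightarrow>\<^sub>E {..<n}. of_bool (\<xi> u = 0)) = (of_nat n ^ (card A - 1) :: 'a)"
      using sum_PiE_coordinate[OF fin_A u, of "\<lambda>k. of_bool (k = 0) :: 'a" n] n
      by (simp add: of_bool_def sum.delta)
    also have "card A = Suc (card A - 1)" using u fin_A by (metis card_Suc_Diff1 card_Diff_singleton)
    finally have "S n M = of_real l ^ d / of_nat n" using nz by simp
    then have "norm (S n M) = l ^ d / n" using l by (simp add: norm_divide norm_power)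
    with hoelder_up_to_constant[OF n, of M] have "(l ^ d / n)\<^sup>2 \<le> real (card E) ^ card E"
      by (simp add: PM)
    then have "((l ^ d / n)\<^sup>2) ^ card E \<le> (real (card E) ^ card E) ^ card E"
      by (rule power_mono) simp
    moreover have "((l ^ d / n)\<^sup>2) ^ card E = ((real n ^ card A) ^ d / n ^ card E)\<^sup>2"
      unfolding l(2)[symmetric] by (simp add: power_divide power_mult[symmetric] mult_ac)
    ultimately have le: "((real n ^ card A) ^ d / n ^ card E)\<^sup>2 \<le> (real (card E) ^ card E) ^ card E" by simp
    \<comment> \<open>The exponent is at least 1 by the assumption to be refuted.\<close>
    have "real n \<le> real n ^ (card A * d - card E)"
      using n gt d_def by (intro self_le_power) auto
    also have "\<dots> = (real n ^ card A) ^ d / n ^ card E"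
      using n gt d_def by (simp add: power_diff power_mult)
    finally have "(real n)\<^sup>2 \<le> ((real n ^ card A) ^ d / n ^ card E)\<^sup>2"
      by (rule power_mono) simp
    then have sq: "real n ^ 2 \<le> (real (card E) ^ card E) ^ card E" using le by (rule order_trans)
    have "real n \<le> real n ^ 2" using n by (intro self_le_power) auto
    then show ?thesis using sq by (rule order_trans)
  qed
  obtain n :: nat where "(real (card E) ^ card E) ^ card E < real n"
    using reals_Archimedean2 by blast
  moreover from this have "0 < n"
    by (intro gr0I) (auto simp: not_less[symmetric])
  ultimately show False using bound[of n] by simp
qed

text \<open>Degrees that never exceed their average are all equal to it.\<close>

lemma regular:
  assumes u: "u \<in> A"
  shows "card A * card (E `` {u}) = card E"
proof (rule ccontr)
  assume ne: "\<not> ?thesis"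
  then have "card A * card (E `` {u}) < card E" using degree_le_average[OF u] by simp
  then have "(\<Sum>w\<in>A. card A * card (E `` {w})) < (\<Sum>w\<in>A. card E)"
    using u fin_A degree_le_average by (intro sum_strict_mono_ex1) auto
  then show False by (simp add: sum_distrib_left[symmetric] sum_degrees)
qed

lemma degree_one_or_even:
  obtains k where "k = 1 \<or> even k" "0 < k" "\<And>u. u \<in> A \<Longrightarrow> card (E `` {u}) = k"
proof -
  obtain u where u: "u \<in> A" using E_ne E_sub by auto
  have "card (E `` {w}) = card (E `` {u})" if "w \<in> A" for w
    using regular[OF u] regular[OF that] u fin_A by (metis card_gt_0_iff empty_iff mult_left_cancel neq0_conv)
  then show ?thesis
    using that[of "card (E `` {u})"] odd_degree[OF u _ u] degree_pos[OF u] by blast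
qed

end

definition star_forest :: "nat \<Rightarrow> 'a set \<Rightarrow> 'b set \<Rightarrow> ('a \<times> 'b) set \<Rightarrow> bool" where
  "star_forest k A B E \<longleftrightarrow>
     (\<forall>u\<in>A. card (E `` {u}) = k) \<and> (\<forall>v\<in>B. card (E\<inverse> `` {v}) = 1)"

text \<open>Both sides are regular, so a single edge decides: if neither common degree is 1, the
  edge has further neighbours at both ends and \<open>null_entry\<close> kills the nonzero entry of
  \<open>m\<close>. If the left degree is 1, the centres of the stars lie on the right.\<close>

lemma (in matrix_seminorm) star_forest_if_null:
  assumes n: "0 < n" and null: "S n (\<lambda>_. m) = 0" and ij: "i < n" "j < n" "m i j \<noteq> 0"
  shows "\<exists>k. (k = 1 \<or> even k) \<and> 0 < k \<and> (star_forest k A B E \<or> star_forest k B A (E\<inverse>))"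
proof -
  interpret conv: matrix_seminorm c B A "E\<inverse>" "s \<circ> prod.swap"
    by (rule matrix_seminorm_converse)
  obtain k where k: "k = 1 \<or> even k" "0 < k" "\<And>u. u \<in> A \<Longrightarrow> card (E `` {u}) = k"
    using degree_one_or_even by metis
  obtain l where l: "l = 1 \<or> even l" "0 < l" "\<And>v. v \<in> B \<Longrightarrow> card (E\<inverse> `` {v}) = l"
    using conv.degree_one_or_even by metis
  obtain u v where uv: "(u, v) \<in> E" using E_ne by auto
  have "k = 1 \<or> l = 1"
  proof (rule ccontr)
    assume "\<not> ?thesis"
    then have "card (E `` {u}) \<noteq> 1" "card (E\<inverse> `` {v}) \<noteq> 1" using k(3) l(3) uv E_sub by auto
    then obtain v' u' where "(u, v') \<in> E" "v' \<noteq> v" "(v, u') \<in> E\<inverse>" "u' \<noteq> u"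
      using other_neighbour[OF uv] conv.other_neighbour[of v u] uv by (metis converse_iff)
    then show False
      using null_entry[where m = m, OF n null uv _ _ _ _ ij(1,2)] ij(3) by auto
  qed
  then show ?thesis
    using k l unfolding star_forest_def by (metis converse_converse)
qed

section \<open>Integrals over the cube of vertex assignments\<close>

abbreviation unit_interval :: "real measure" where
  "unit_interval \<equiv> restrict_space lborel {0..1}"

abbreviation cube :: "'a set \<Rightarrow> ('a \<Rightarrow> real) measure" where
  "cube A \<equiv> (\<Pi>\<^sub>M u\<in>A. unit_interval)"

text \<open>The bound holds everywhere, not just almost everywhere or on the unit square, so it
  survives products, sections and compositions without exceptional sets.\<close>

definition bounded_measurable :: "'s measure \<Rightarrow> ('s \<Rightarrow> 'k::real_normed_vector) \<Rightarrow> bool" where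
  "bounded_measurable M f \<longleftrightarrow> f \<in> borel_measurable M \<and> (\<exists>K. \<forall>z. norm (f z) \<le> K)"

lemma bounded_measurableD: "bounded_measurable M f \<Longrightarrow> f \<in> borel_measurable M"
  by (simp add: bounded_measurable_def)

abbreviation bounded_borel :: "('s::topological_space \<Rightarrow> 'k::real_normed_vector) \<Rightarrow> bool" where
  "bounded_borel \<equiv> bounded_measurable borel"

lemma space_unit_interval: "space unit_interval = {0..1}"
  by (simp add: space_restrict_space)

lemma emeasure_unit_interval: "emeasure unit_interval {0..1} = 1"
  by (simp add: emeasure_restrict_space)

lemma finite_measure_unit_interval: "finite_measure unit_interval"
  by (rule finite_measureI) (simp add: space_unit_interval emeasure_unit_interval)

lemma measure_unit_interval [simp]: "Sigma_Algebra.measure unit_interval {0..1} = 1"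
  by (simp add: Sigma_Algebra.measure_def emeasure_unit_interval)

lemma integral_unit_interval_const [simp]:
  "(LINT x|unit_interval. k) = (k :: 'k::{banach, second_countable_topology})"
  by (simp add: space_unit_interval)

interpretation unit_interval: finite_measure unit_interval
  by (rule finite_measure_unit_interval)

interpretation unit_intervals: product_sigma_finite "\<lambda>_ :: 'i. unit_interval"
  by unfold_locales

lemma borel_measurable_unit_interval:
  "f \<in> borel_measurable borel \<Longrightarrow> f \<in> borel_measurable unit_interval"
  by (simp add: measurable_restrict_space1)

lemma finite_measure_cube:
  assumes "finite A" shows "finite_measure (cube A)"
proof (rule finite_measureI)
  have "emeasure (cube A) (\<Pi>\<^sub>E i\<in>A. {0..1}) = (\<Prod>i\<in>A. emeasure unit_interval {0..1})"
    by (rule unit_intervals.emeasure_PiM[OF assms]) (metis sets.top space_unit_interval)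
  then show "emeasure (cube A) (space (cube A)) \<noteq> \<infinity>"
    by (simp add: space_PiM space_unit_interval emeasure_unit_interval)
qed

lemma finite_measure_cube_pair:
  assumes "finite A" "finite B" shows "finite_measure (cube A \<Otimes>\<^sub>M cube B)"
  using assms by (intro finite_measure_pair_measure finite_measure_cube)

lemma pair_sigma_finite_cube:
  assumes "finite A" "finite B" shows "pair_sigma_finite (cube A) (cube B)"
proof -
  interpret FA: finite_measure "cube A" by (rule finite_measure_cube) fact
  interpret FB: finite_measure "cube B" by (rule finite_measure_cube) fact
  show ?thesis by unfold_locales
qed

lemma cube_component_measurable:
  assumes "u \<in> A" shows "(\<lambda>x. x u) \<in> borel_measurable (cube A)"
proof (rule measurable_compose[where N = unit_interval])
  show "(\<lambda>x. x u) \<in> cube A \<rightarrow>\<^sub>M unit_interval"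
    using measurable_component_singleton[OF assms, of "\<lambda>_. unit_interval"] .
qed (rule borel_measurable_unit_interval, simp)

lemma cube_pair_component:
  assumes "u \<in> A" "v \<in> B"
  shows "(\<lambda>p. (fst p u, snd p v)) \<in> borel_measurable (cube A \<Otimes>\<^sub>M cube B)"
proof -
  have "(\<lambda>p. (fst p u, snd p v)) \<in> cube A \<Otimes>\<^sub>M cube B \<rightarrow>\<^sub>M borel \<Otimes>\<^sub>M borel"
    by (intro measurable_Pair measurable_compose[OF measurable_fst cube_component_measurable]
        measurable_compose[OF measurable_snd cube_component_measurable] assms)
  then show ?thesis by (simp add: borel_prod)
qed

lemma bounded_measurable_add:
  assumes "bounded_measurable M f" "bounded_measurable M g"
  shows "bounded_measurable M (\<lambda>z. f z + g z :: 'k::euclidean_space)"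
proof -
  obtain K L where "\<forall>z. norm (f z) \<le> K" "\<forall>z. norm (g z) \<le> L"
    using assms unfolding bounded_measurable_def by auto
  then have "norm (f z + g z) \<le> K + L" for z
    by (intro order_trans[OF norm_triangle_ineq] add_mono) auto
  then show ?thesis using assms unfolding bounded_measurable_def by auto
qed

lemma bounded_measurable_mult:
  assumes "bounded_measurable M f" "bounded_measurable M g"
  shows "bounded_measurable M (\<lambda>z. f z * g z :: 'k::{real_normed_field,euclidean_space})"
proof -
  obtain K L where "\<forall>z. norm (f z) \<le> K" "\<forall>z. norm (g z) \<le> L"
    using assms unfolding bounded_measurable_def by auto
  then have "norm (f z * g z) \<le> K * L" for z
    unfolding norm_mult by (intro mult_mono) (auto intro: order_trans[OF norm_ge_zero])
  then show ?thesis using assms unfolding bounded_measurable_def by auto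
qed

lemma bounded_measurable_const: "bounded_measurable M (\<lambda>z. k)"
  by (auto simp: bounded_measurable_def)

lemma bounded_measurable_prod:
  assumes "\<And>i. i \<in> I \<Longrightarrow> bounded_measurable M (f i)"
  shows "bounded_measurable M (\<lambda>z. \<Prod>i\<in>I. f i z :: 'k::{real_normed_field,euclidean_space})"
  using assms by (induction I rule: infinite_finite_induct)
    (auto intro: bounded_measurable_const bounded_measurable_mult)

lemma bounded_measurable_compose:
  "\<lbrakk>bounded_measurable N f; g \<in> M \<rightarrow>\<^sub>M N\<rbrakk> \<Longrightarrow> bounded_measurable M (\<lambda>x. f (g x))"
  by (auto simp: bounded_measurable_def)

lemma bounded_measurable_linear:
  assumes "bounded_linear T" "bounded_measurable M f"
  shows "bounded_measurable M (\<lambda>x. T (f x) :: 'k::euclidean_space)"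
proof -
  obtain K where K: "\<forall>z. norm (f z) \<le> K"
    using assms unfolding bounded_measurable_def by auto
  obtain L where L: "0 \<le> L" "\<forall>x. norm (T x) \<le> norm x * L"
    using bounded_linear.nonneg_bounded[OF assms(1)] by auto
  have "norm (T (f z)) \<le> K * L" for z
    using K L by (meson mult_right_mono order_trans)
  moreover have "T \<in> borel_measurable borel"
    by (intro borel_measurable_continuous_onI linear_continuous_on assms(1))
  then have "(\<lambda>x. T (f x)) \<in> borel_measurable M"
    using assms(2) by (auto simp: bounded_measurable_def intro: measurable_compose[of f M borel T borel])
  ultimately show ?thesis by (auto simp: bounded_measurable_def)
qed

lemma bounded_borel_section:
  fixes f :: "real \<times> real \<Rightarrow> 'k::euclidean_space"
  assumes "bounded_borel f"
  shows "bounded_borel (\<lambda>x. f (x, y))" "bounded_borel (\<lambda>y. f (x, y))"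
  by (rule bounded_measurable_compose[OF assms], intro borel_measurable_continuous_onI continuous_intros)+

lemma integrable_bounded_measurable:
  fixes f :: "'s \<Rightarrow> 'k::euclidean_space"
  assumes "finite_measure M" "bounded_measurable M f"
  shows "integrable M f"
proof -
  obtain K where K: "\<forall>z. norm (f z) \<le> K" and f: "f \<in> borel_measurable M"
    using assms(2) unfolding bounded_measurable_def by blast
  show ?thesis
    by (rule finite_measure.integrable_const_bound[OF assms(1) AE_I2 f]) (rule K[rule_format])
qed

lemma bounded_measurable_unit_interval: "bounded_borel f \<Longrightarrow> bounded_measurable unit_interval f"
  by (auto simp: bounded_measurable_def borel_measurable_unit_interval)

lemma integrable_bounded_borel:
  fixes f :: "real \<Rightarrow> 'k::euclidean_space"
  assumes "bounded_borel f" shows "integrable unit_interval f"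
  by (rule integrable_bounded_measurable[OF finite_measure_unit_interval bounded_measurable_unit_interval[OF assms]])

lemma bounded_borel_integral:
  fixes f :: "real \<times> real \<Rightarrow> 'k::euclidean_space"
  assumes f: "bounded_borel f"
  shows "bounded_borel (\<lambda>x. LINT y|unit_interval. f (x, y))"
proof -
  obtain K where K: "\<And>z. norm (f z) \<le> K" using f unfolding bounded_measurable_def by auto
  have m: "f \<in> borel_measurable (borel \<Otimes>\<^sub>M borel)" using f by (simp add: bounded_measurable_def borel_prod)
  have "(\<lambda>x. LINT y|unit_interval. f (x, y)) \<in> borel_measurable borel"
  proof (rule unit_interval.borel_measurable_lebesgue_integral)
    show "case_prod (\<lambda>x y. f (x, y)) \<in> borel_measurable (borel \<Otimes>\<^sub>M unit_interval)"
      unfolding split_beta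
      by (rule measurable_compose[OF _ m])
        (intro measurable_Pair measurable_fst measurable_compose[OF measurable_snd] borel_measurable_unit_interval, simp)
  qed
  moreover have "norm (LINT y|unit_interval. f (x, y)) \<le> K" for x
  proof -
    have "norm (LINT y|unit_interval. f (x, y)) \<le> (LINT y|unit_interval. norm (f (x, y)))"
      by (rule integral_norm_bound)
    also have "\<dots> \<le> (LINT y|unit_interval. K)"
      using bounded_borel_section(2)[OF f] K
      by (intro integral_mono integrable_norm integrable_bounded_borel) (auto intro: bounded_measurable_const)
    finally show ?thesis by (simp add: space_unit_interval)
  qed
  ultimately show ?thesis by (auto simp: bounded_measurable_def)
qed

text \<open>The product measure is left uncompleted so that Fubini applies directly; the completion
  in \<open>cube_measure\<close> is dealt with in \<open>cube_measure_integral\<close>.\<close>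

definition edge_integral ::
  "'a set \<Rightarrow> 'b set \<Rightarrow> ('a \<times> 'b) set \<Rightarrow> ('a \<times> 'b \<Rightarrow> real \<times> real \<Rightarrow> 'k::{real_normed_field,euclidean_space}) \<Rightarrow> 'k"
  where
  "edge_integral A B E \<Phi> = (LINT p|(cube A \<Otimes>\<^sub>M cube B). (\<Prod>e\<in>E. \<Phi> e (fst p (fst e), snd p (snd e))))"

lemma edge_product_bounded_measurable:
  assumes "E \<subseteq> A \<times> B" "\<And>e. e \<in> E \<Longrightarrow> bounded_borel (\<Phi> e :: _ \<Rightarrow> 'k::{real_normed_field,euclidean_space})"
  shows "bounded_measurable (cube A \<Otimes>\<^sub>M cube B) (\<lambda>p. \<Prod>e\<in>E. \<Phi> e (fst p (fst e), snd p (snd e)))"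
proof (rule bounded_measurable_prod)
  fix e assume e: "e \<in> E"
  show "bounded_measurable (cube A \<Otimes>\<^sub>M cube B) (\<lambda>p. \<Phi> e (fst p (fst e), snd p (snd e)))"
    by (rule bounded_measurable_compose[OF assms(2)[OF e] cube_pair_component]) (use e assms(1) in auto)
qed

lemma edge_product_integrable:
  assumes "finite A" "finite B" "E \<subseteq> A \<times> B"
    "\<And>e. e \<in> E \<Longrightarrow> bounded_borel (\<Phi> e :: _ \<Rightarrow> 'k::{real_normed_field,euclidean_space})"
  shows "integrable (cube A \<Otimes>\<^sub>M cube B) (\<lambda>p. \<Prod>e\<in>E. \<Phi> e (fst p (fst e), snd p (snd e)))"
  by (rule integrable_bounded_measurable[OF finite_measure_cube_pair[OF assms(1,2)]
        edge_product_bounded_measurable[where \<Phi> = \<Phi>, OF assms(3,4)]])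

lemma edge_integral_converse:
  assumes "finite A" "finite B" "E \<subseteq> A \<times> B"
    "\<And>e. e \<in> E \<Longrightarrow> bounded_borel (\<Phi> e :: _ \<Rightarrow> 'k::{real_normed_field,euclidean_space})"
  shows "edge_integral B A (E\<inverse>) (\<lambda>e z. \<Phi> (prod.swap e) (prod.swap z)) = edge_integral A B E \<Phi>"
proof -
  interpret pair_sigma_finite "cube A" "cube B" by (rule pair_sigma_finite_cube) fact+
  have "E\<inverse> = prod.swap ` E" by auto
  then have "(\<Prod>e\<in>E\<inverse>. \<Phi> (prod.swap e) (prod.swap (fst p (fst e), snd p (snd e))))
      = (\<Prod>e\<in>E. \<Phi> e (snd p (fst e), fst p (snd e)))" for p
    by (simp add: prod.reindex)
  then show ?thesis
    unfolding edge_integral_def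
    using integral_product_swap[OF bounded_measurableD[OF edge_product_bounded_measurable[of E A B \<Phi>]]] assms by (simp add: case_prod_unfold)
qed

section \<open>Lebesgue measurable integrands and their Borel versions\<close>

lemma AE_cube_component:
  assumes "finite A" "u \<in> A" and P: "AE t in unit_interval. P t"
  shows "AE x in cube A. P (x u)"
proof -
  obtain N where N: "N \<in> null_sets unit_interval" "{t \<in> space unit_interval. \<not> P t} \<subseteq> N"
    using P by (auto elim: AE_E simp: null_sets_def)
  \<comment> \<open>The cylinder over the null set \<open>N\<close>: a box with one side of measure
    0.\<close>
  define Q where "Q = (\<Pi>\<^sub>E i\<in>A. if i = u then N else {0..1})"
  have "emeasure (cube A) Q = (\<Prod>i\<in>A. emeasure unit_interval (if i = u then N else {0..1}))"
    unfolding Q_def using N by (intro unit_intervals.emeasure_PiM[OF assms(1)]) (auto simp: sets_restrict_space)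
  also have "\<dots> = 0"
    using assms(1,2) N(1) by (auto intro!: prod_zero bexI[of _ u])
  finally have "emeasure (cube A) Q = 0" .
  moreover have "Q \<in> sets (cube A)"
    using N(1) assms(1) unfolding Q_def
    by (intro sets_PiM_I_finite) (auto simp: null_sets_def sets.top[of unit_interval, unfolded space_unit_interval] simp del: sets_restrict_space)
  ultimately have "Q \<in> null_sets (cube A)"
    by (simp add: null_sets_def)
  moreover have "{x \<in> space (cube A). \<not> P (x u)} \<subseteq> Q"
    using N(2) assms(2) by (auto simp: Q_def space_PiM space_unit_interval PiE_iff extensional_def)
  ultimately show ?thesis by (rule AE_I')
qed

text \<open>The projection to the coordinates of \<open>u\<close> and \<open>v\<close> pulls null
  sets back to null sets. The exceptional set need not be Borel, so Fubini is applied to a Borel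
  null set \<open>N\<close> that covers it.\<close>

lemma AE_cube_pair_component:
  assumes fin: "finite A" "finite B" and uv: "u \<in> A" "v \<in> B"
    and P: "AE z in lebesgue_on unit_square. P z"
  shows "AE p in cube A \<Otimes>\<^sub>M cube B. P (fst p u, snd p v)"
proof -
  interpret AB: pair_sigma_finite "cube A" "cube B" by (rule pair_sigma_finite_cube) fact+
  have us: "unit_square \<in> sets lborel"
    unfolding unit_square_def by (simp add: borel_Times)
  then have "AE z in lborel. z \<in> unit_square \<longrightarrow> P z"
    using P by (subst (asm) AE_restrict_space_iff) (auto simp: AE_completion_iff)
  then obtain N where N: "N \<in> null_sets lborel" "{z. \<not> (z \<in> unit_square \<longrightarrow> P z)} \<subseteq> N"
    by (auto elim: AE_E simp: null_sets_def)
  have "AE z in lborel \<Otimes>\<^sub>M lborel. z \<notin> N"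
    using N(1) by (simp add: lborel_prod AE_not_in)
  then have "AE x in lborel. AE y in lborel. (x, y) \<notin> N"
    by (rule lborel_pair.AE_pair)
  then have "AE x in unit_interval. AE y in unit_interval. (x, y) \<notin> N"
    by (simp add: AE_restrict_space_iff) (auto elim!: eventually_mono)
  then have "AE x in cube A. AE y in unit_interval. (x u, y) \<notin> N"
    by (rule AE_cube_component[OF fin(1) uv(1)])
  then have "AE x in cube A. AE y in cube B. (x u, y v) \<notin> N"
    by (rule eventually_mono) (rule AE_cube_component[OF fin(2) uv(2)])
  then have "AE p in cube A \<Otimes>\<^sub>M cube B. (fst p u, snd p v) \<notin> N"
  proof (intro AB.AE_pair_measure)
    have "(\<lambda>p. indicat_real N (fst p u, snd p v)) \<in> borel_measurable (cube A \<Otimes>\<^sub>M cube B)"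
      using N(1) uv by (intro measurable_compose[OF cube_pair_component] borel_measurable_indicator) (auto simp: null_sets_def)
    then have "{p \<in> space (cube A \<Otimes>\<^sub>M cube B). indicat_real N (fst p u, snd p v) = 0} \<in> sets (cube A \<Otimes>\<^sub>M cube B)"
      by measurable
    then show "{p \<in> space (cube A \<Otimes>\<^sub>M cube B). (fst p u, snd p v) \<notin> N} \<in> sets (cube A \<Otimes>\<^sub>M cube B)"
      by (simp add: indicator_eq_0_iff)
  qed simp
  moreover have "AE p in cube A \<Otimes>\<^sub>M cube B. (fst p u, snd p v) \<in> unit_square"
    using uv by (intro AE_I2) (auto simp: space_pair_measure space_PiM PiE_iff space_unit_interval unit_square_def)
  ultimately show ?thesis
    by eventually_elim (use N(2) in auto)
qed

lemma completion_measurable_AE_eq: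
  fixes f g :: "'s \<Rightarrow> 'k::{banach, second_countable_topology}"
  assumes g: "g \<in> borel_measurable M" and ae: "AE x in M. f x = g x"
  shows "f \<in> borel_measurable (completion M)"
proof (rule measurableI)
  fix S :: "'k set" assume S: "S \<in> sets borel"
  have "AE x in completion M. x \<in> g -` S \<inter> space M \<longleftrightarrow> x \<in> f -` S \<inter> space M"
    using AE_completion[OF ae] by eventually_elim auto
  then have "f -` S \<inter> space M \<in> sets (completion M)"
    by (rule completion.in_sets_AE) (use S g in auto)
  then show "f -` S \<inter> space (completion M) \<in> sets (completion M)" by simp
qed simp

lemma integral_completion_AE_eq:
  fixes f g :: "'s \<Rightarrow> 'k::{banach, second_countable_topology}"
  assumes g: "g \<in> borel_measurable M" and ae: "AE x in M. f x = g x"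
  shows "integral\<^sup>L (completion M) f = integral\<^sup>L M g"
proof -
  have "integral\<^sup>L (completion M) f = integral\<^sup>L (completion M) g"
    using assms by (intro integral_cong_AE completion_measurable_AE_eq[OF g ae] measurable_completion AE_completion)
  then show ?thesis using integral_completion[OF g] by simp
qed

text \<open>Equality almost everywhere on the square lifts to each of the finitely many edge
  factors, and an integrand almost everywhere equal to a measurable one has the same integral over
  the completion.\<close>

lemma cube_measure_integral:
  fixes \<Phi> \<Phi>' :: "'a \<times> 'b \<Rightarrow> real \<times> real \<Rightarrow> 'k::{real_normed_field,euclidean_space}"
  assumes H: "bipartite_graph H"
    and ae: "\<And>e. e \<in> edges H \<Longrightarrow> AE z in lebesgue_on unit_square. \<Phi> e z = \<Phi>' e z"
    and bb: "\<And>e. e \<in> edges H \<Longrightarrow> bounded_borel (\<Phi>' e)"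
  shows "(LINT p|cube_measure H. (\<Prod>e\<in>edges H. \<Phi> e (fst p (fst e), snd p (snd e))))
    = edge_integral (lverts H) (rverts H) (edges H) \<Phi>'"
  unfolding edge_integral_def cube_measure_def
proof (rule integral_completion_AE_eq)
  have fin: "finite (lverts H)" "finite (rverts H)" "edges H \<subseteq> lverts H \<times> rverts H" "finite (edges H)"
    using H finite_subset unfolding bipartite_graph_def by blast+
  show "(\<lambda>p. \<Prod>e\<in>edges H. \<Phi>' e (fst p (fst e), snd p (snd e)))
      \<in> borel_measurable (cube (lverts H) \<Otimes>\<^sub>M cube (rverts H))"
    using edge_product_bounded_measurable[of "edges H" _ _ \<Phi>'] fin bb by (auto simp: bounded_measurable_def)
  have "AE p in cube (lverts H) \<Otimes>\<^sub>M cube (rverts H).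
      \<forall>e\<in>edges H. \<Phi> e (fst p (fst e), snd p (snd e)) = \<Phi>' e (fst p (fst e), snd p (snd e))"
    using fin ae by (intro AE_finite_allI AE_cube_pair_component) auto
  then show "AE p in cube (lverts H) \<Otimes>\<^sub>M cube (rverts H).
      (\<Prod>e\<in>edges H. \<Phi> e (fst p (fst e), snd p (snd e)))
      = (\<Prod>e\<in>edges H. \<Phi>' e (fst p (fst e), snd p (snd e)))"
    by eventually_elim simp
qed

lemma bdd_meas_borel_version:
  fixes f :: "real \<times> real \<Rightarrow> 'k::{real_normed_field,euclidean_space}"
  assumes "f \<in> bdd_meas"
  obtains f' where "bounded_borel f'" "AE z in lebesgue_on unit_square. f z = f' z"
proof -
  have us: "unit_square \<in> sets lborel" "unit_square \<in> sets lebesgue"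
    unfolding unit_square_def by (auto simp: borel_Times)
  obtain K where K: "\<And>z. z \<in> unit_square \<Longrightarrow> norm (f z) \<le> K"
    using assms unfolding bdd_meas_def bounded_iff by auto
  \<comment> \<open>Borel versions are taken of the real coordinates and then reassembled over
    \<open>Basis\<close>.\<close>
  have "\<exists>g\<in>borel_measurable lborel. AE z in lborel. indicator unit_square z *\<^sub>R f z \<bullet> b = g z" for b
  proof (rule completion_ex_borel_measurable_real)
    have "(\<lambda>z. indicator unit_square z *\<^sub>R f z) \<in> borel_measurable lebesgue"
      using assms us(2) by (simp add: bdd_meas_def borel_measurable_restrict_space_iff)
    then show "(\<lambda>z. indicator unit_square z *\<^sub>R f z \<bullet> b) \<in> borel_measurable lebesgue" by measurable
  qed
  then obtain g where g: "\<And>b. g b \<in> borel_measurable borel"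
    "\<And>b. AE z in lborel. indicator unit_square z *\<^sub>R f z \<bullet> b = g b z"
    by (metis measurable_lborel2)
  define h where "h z = (\<Sum>b\<in>Basis. g b z *\<^sub>R b)" for z
  have h: "h \<in> borel_measurable borel" unfolding h_def using g(1) by measurable
  have "AE z in lborel. \<forall>b\<in>Basis. indicator unit_square z *\<^sub>R f z \<bullet> b = g b z"
    using g(2) by (intro AE_finite_allI) auto
  then have fh: "AE z in lborel. z \<in> unit_square \<longrightarrow> f z = h z"
  proof eventually_elim
    case (elim z)
    have "h z = (\<Sum>b\<in>Basis. (indicator unit_square z *\<^sub>R f z \<bullet> b) *\<^sub>R b)"
      unfolding h_def using elim by (intro sum.cong) auto
    then have "h z = indicator unit_square z *\<^sub>R f z"
      by (simp only: euclidean_representation)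
    then show ?case by simp
  qed
  \<comment> \<open>The Borel version may exceed \<open>K\<close> on a null subset of the square,
    and nothing bounds it outside; cutting it off gives a bound valid everywhere.\<close>
  define f' where "f' z = (if norm (h z) \<le> K then h z else 0)" for z
  have "bounded_borel f'"
  proof -
    have "f' \<in> borel_measurable borel" unfolding f'_def using h by measurable
    moreover have "norm (f' z) \<le> max K 0" for z by (simp add: f'_def le_max_iff_disj)
    ultimately show ?thesis by (auto simp: bounded_measurable_def)
  qed
  moreover have "AE z in lborel. z \<in> unit_square \<longrightarrow> f z = f' z"
    using fh by eventually_elim (metis K f'_def)
  then have "AE z in lebesgue_on unit_square. f z = f' z"
    using us by (simp add: AE_restrict_space_iff AE_completion_iff)
  ultimately show ?thesis using that by blast
qed

lemma bounded_borel_bdd_meas: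
  fixes f :: "real \<times> real \<Rightarrow> 'k::{real_normed_field,euclidean_space}"
  assumes "bounded_borel f" shows "f \<in> bdd_meas"
proof -
  obtain K where "\<forall>z. norm (f z) \<le> K" using assms unfolding bounded_measurable_def by auto
  then have "bounded (f ` unit_square)" unfolding bounded_iff by blast
  then show ?thesis
    using assms unfolding bounded_measurable_def bdd_meas_def
    by (auto intro!: measurable_restrict_space1 measurable_completion)
qed

section \<open>Step functions\<close>

lemma cube_integral_single:
  fixes a :: "'a \<Rightarrow> real \<Rightarrow> 'k::{real_normed_field,euclidean_space}"
  assumes A: "finite A" "u \<in> A" and g: "bounded_borel g" and a: "\<And>w. bounded_borel (a w)"
  shows "(LINT x|cube A. g (x u) * (\<Prod>w\<in>A. a w (x w)))
    = (LINT t|unit_interval. g t * a u t) * (\<Prod>w\<in>A - {u}. LINT t|unit_interval. a w t)"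
proof -
  define F where "F w t = (if w = u then g t else 1) * a w t" for w t
  have F: "integrable unit_interval (F w)" for w
    unfolding F_def by (cases "w = u")
      (auto intro!: integrable_bounded_borel bounded_measurable_mult g a)
  have "(\<Prod>w\<in>A. F w (x w)) = g (x u) * (\<Prod>w\<in>A. a w (x w))" for x
    using A by (simp add: F_def prod.distrib prod.delta)
  then have "(LINT x|cube A. g (x u) * (\<Prod>w\<in>A. a w (x w))) = (\<Prod>w\<in>A. LINT t|unit_interval. F w t)"
    using unit_intervals.product_integral_prod[OF A(1), of F] F by simp
  also have "\<dots> = (LINT t|unit_interval. F u t) * (\<Prod>w\<in>A - {u}. LINT t|unit_interval. F w t)"
    using A by (rule prod.remove)
  finally show ?thesis by (simp add: F_def)
qed

lemma bounded_measurable_cube_prod: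
  fixes a :: "'a \<Rightarrow> real \<Rightarrow> 'k::{real_normed_field,euclidean_space}"
  assumes "\<And>w. bounded_borel (a w)"
  shows "bounded_measurable (cube A) (\<lambda>x. \<Prod>w\<in>A. a w (x w))"
proof (rule bounded_measurable_prod)
  fix w assume w: "w \<in> A"
  show "bounded_measurable (cube A) (\<lambda>x. a w (x w))"
    by (rule bounded_measurable_compose[OF assms cube_component_measurable[OF w]])
qed

lemma cube_pair_integrand_bounded_measurable:
  fixes h :: "real \<times> real \<Rightarrow> 'k::{real_normed_field,euclidean_space}"
  assumes uv: "u \<in> A" "v \<in> B" and h: "bounded_borel h"
    and ab: "\<And>w. bounded_borel (a w)" "\<And>w. bounded_borel (b w)"
  shows "bounded_measurable (cube A \<Otimes>\<^sub>M cube B)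
    (\<lambda>p. h (fst p u, snd p v) * ((\<Prod>w\<in>A. a w (fst p w)) * (\<Prod>w\<in>B. b w (snd p w))))"
  by (rule bounded_measurable_mult[OF bounded_measurable_compose[OF h cube_pair_component[OF uv]]
        bounded_measurable_mult[OF bounded_measurable_compose[OF bounded_measurable_cube_prod measurable_fst]
          bounded_measurable_compose[OF bounded_measurable_cube_prod measurable_snd]]])
    (fact ab)+

text \<open>\<open>h\<close> involves one left and one right variable, so by Fubini every other
  variable integrates out on its own.\<close>

lemma cube_pair_integral_single:
  fixes h :: "real \<times> real \<Rightarrow> 'k::{real_normed_field,euclidean_space}"
  assumes fin: "finite A" "finite B" and uv: "u \<in> A" "v \<in> B" and h: "bounded_borel h"
    and ab: "\<And>w. bounded_borel (a w)" "\<And>w. bounded_borel (b w)"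
  shows "(LINT p|(cube A \<Otimes>\<^sub>M cube B).
            h (fst p u, snd p v) * ((\<Prod>w\<in>A. a w (fst p w)) * (\<Prod>w\<in>B. b w (snd p w))))
    = (LINT s|unit_interval. (LINT t|unit_interval. h (s, t) * b v t) * a u s)
      * (\<Prod>w\<in>A - {u}. LINT t|unit_interval. a w t) * (\<Prod>w\<in>B - {v}. LINT t|unit_interval. b w t)"
proof -
  interpret AB: pair_sigma_finite "cube A" "cube B" by (rule pair_sigma_finite_cube) fact+
  define G where "G s = (LINT t|unit_interval. h (s, t) * b v t)" for s
  have "bounded_borel (\<lambda>z. h z * b v (snd z))"
    by (intro bounded_measurable_mult h bounded_measurable_compose[OF ab(2)] borel_measurable_continuous_onI continuous_intros)
  then have G: "bounded_borel G"
    unfolding G_def using bounded_borel_integral by fastforce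
  define \<beta> where "\<beta> = (\<Prod>w\<in>B - {v}. LINT t|unit_interval. b w t)"
  have inner: "(LINT y|cube B. h (x u, y v) * ((\<Prod>w\<in>A. a w (x w)) * (\<Prod>w\<in>B. b w (y w))))
      = (G (x u) * (\<Prod>w\<in>A. a w (x w))) * \<beta>" for x
  proof -
    have "(LINT y|cube B. h (x u, y v) * ((\<Prod>w\<in>A. a w (x w)) * (\<Prod>w\<in>B. b w (y w))))
        = (\<Prod>w\<in>A. a w (x w)) * (LINT y|cube B. h (x u, y v) * (\<Prod>w\<in>B. b w (y w)))"
      by (simp add: mult.left_commute[of "h _"])
    also have "(LINT y|cube B. h (x u, y v) * (\<Prod>w\<in>B. b w (y w))) = G (x u) * \<beta>"
      unfolding G_def \<beta>_def
      by (rule cube_integral_single[where g = "\<lambda>t. h (x u, t)"])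
        (use fin uv ab bounded_borel_section(2)[OF h] in auto)
    finally show ?thesis by (simp add: mult_ac)
  qed
  have "(LINT p|(cube A \<Otimes>\<^sub>M cube B).
            h (fst p u, snd p v) * ((\<Prod>w\<in>A. a w (fst p w)) * (\<Prod>w\<in>B. b w (snd p w))))
    = (LINT x|cube A. (LINT y|cube B. h (x u, y v) * ((\<Prod>w\<in>A. a w (x w)) * (\<Prod>w\<in>B. b w (y w)))))"
    using AB.integral_fst'[OF integrable_bounded_measurable[OF finite_measure_cube_pair[OF fin]
          cube_pair_integrand_bounded_measurable[where h = h and a = a and b = b, OF uv h ab]]]
    by simp
  also have "\<dots> = (LINT x|cube A. G (x u) * (\<Prod>w\<in>A. a w (x w))) * \<beta>"
    unfolding inner by simp
  also have "(LINT x|cube A. G (x u) * (\<Prod>w\<in>A. a w (x w)))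
      = (LINT s|unit_interval. G s * a u s) * (\<Prod>w\<in>A - {u}. LINT t|unit_interval. a w t)"
    by (rule cube_integral_single[OF fin(1) uv(1) G ab(1)])
  finally show ?thesis by (simp add: G_def \<beta>_def)
qed

text \<open>The minimum puts the endpoint 1 into the last cell and \<open>nat\<close> sends negative
  numbers to cell 0, so for positive \<open>n\<close> the index is below \<open>n\<close> on the
  whole line.\<close>

definition cell :: "nat \<Rightarrow> real \<Rightarrow> nat" where
  "cell n x = min (n - 1) (nat \<lfloor>real n * x\<rfloor>)"

lemma cell_less: "0 < n \<Longrightarrow> cell n x < n"
  unfolding cell_def by linarith

lemma cell_measurable [measurable]: "cell n \<in> borel \<rightarrow>\<^sub>M count_space UNIV"
  unfolding cell_def[abs_def] by measurable

lemma bounded_borel_cell: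
  "bounded_borel (\<lambda>x. of_bool (cell n x = i) :: 'k::{real_normed_field,euclidean_space})"
proof -
  have "(\<lambda>x. of_bool (cell n x = i) :: 'k) \<in> borel_measurable borel"
    by (rule measurable_compose[OF cell_measurable]) simp
  then show ?thesis by (auto simp: bounded_measurable_def intro!: exI[of _ 1])
qed

lemma cell_eq_iff:
  assumes "i < n" "0 \<le> x" "x < 1"
  shows "cell n x = i \<longleftrightarrow> real i / real n \<le> x \<and> x < real (Suc i) / real n"
proof -
  have n: "0 < real n" using assms by simp
  have "real n * x < real n" using assms n by simp
  then have "\<lfloor>real n * x\<rfloor> < int n" by linarith
  then have "cell n x = nat \<lfloor>real n * x\<rfloor>" using assms unfolding cell_def by linarith
  also have "\<dots> = i \<longleftrightarrow> \<lfloor>real n * x\<rfloor> = int i" using assms by (auto simp: nat_eq_iff)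
  also have "\<dots> \<longleftrightarrow> real i \<le> real n * x \<and> real n * x < real i + 1"
    by (simp add: floor_eq_iff)
  also have "\<dots> \<longleftrightarrow> real i / real n \<le> x \<and> x < real (Suc i) / real n"
    using n by (simp add: field_simps)
  finally show ?thesis .
qed

lemma integral_cell:
  assumes "i < n"
  shows "(LINT x|unit_interval. of_bool (cell n x = i)) = (1 / of_nat n :: 'k::{real_normed_field,euclidean_space})"
proof -
  have n: "0 < real n" using assms by simp
  have sub: "0 \<le> x \<and> x < 1" if "real i / real n \<le> x" "x < real (Suc i) / real n" for x
  proof -
    have "real (Suc i) / real n \<le> 1" using assms n by simp
    moreover have "0 \<le> real i / real n" by simp
    ultimately show ?thesis using that by linarith
  qed
  have "(LINT x|unit_interval. of_bool (cell n x = i))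
      = (LINT x|lborel. indicator {0..1} x *\<^sub>R (of_bool (cell n x = i) :: real))"
    by (rule integral_restrict_space) simp
  also have "\<dots> = (LINT x|lborel. indicator {real i / real n..<real (Suc i) / real n} x)"
  proof (rule integral_cong_AE)
    \<comment> \<open>Apart from the point 1, which belongs to the last cell, the cells of the unit
      interval are half-open intervals.\<close>
    have "AE x in lborel. x \<noteq> (1::real)" by (rule AE_lborel_singleton)
    then show "AE x in lborel. indicat_real {0..1} x *\<^sub>R (of_bool (cell n x = i) :: real)
        = indicator {real i / real n..<real (Suc i) / real n} x"
    proof eventually_elim
      case (elim x)
      show ?case
      proof (cases "0 \<le> x \<and> x < 1")
        case True
        then show ?thesis
          using cell_eq_iff[OF assms, of x] by (auto simp: indicator_def simp del: of_nat_Suc)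
      next
        case False
        then have "x \<notin> {0..1}" "x \<notin> {real i / real n..<real (Suc i) / real n}"
          using elim sub[of x] by auto
        then show ?thesis by (simp only: indicator_simps scaleR_zero_left not_False_eq_True)
      qed
    qed
    have "(\<lambda>x. of_bool (cell n x = i) :: real) \<in> borel_measurable borel"
      using bounded_borel_cell by (rule bounded_measurableD)
    then show "(\<lambda>x. indicat_real {0..1} x *\<^sub>R (of_bool (cell n x = i) :: real)) \<in> borel_measurable lborel"
      by simp
  qed simp
  also have "\<dots> = 1 / real n"
    using measure_lborel_Ico[of "real i / real n" "real (Suc i) / real n"]
    by (simp add: divide_right_mono diff_divide_distrib[symmetric] del: of_nat_Suc)
  finally have real: "(LINT x|unit_interval. of_bool (cell n x = i) :: real) = 1 / real n" .
  have "(LINT x|unit_interval. of_bool (cell n x = i) :: 'k)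
      = (LINT x|unit_interval. of_real (of_bool (cell n x = i)))"
    by (simp add: of_bool_def if_distrib cong: if_cong)
  also have "\<dots> = of_real (1 / real n)"
    using integral_bounded_linear[OF bounded_linear_of_real, OF integrable_bounded_borel[OF bounded_borel_cell[of n i]]]
    by (simp only: real)
  finally show ?thesis by simp
qed

text \<open>A partition of unity: exactly one \<open>\<xi>\<close> in the sum agrees with
  \<open>\<zeta>\<close> on \<open>A\<close>.\<close>

lemma sum_PiE_of_bool:
  fixes F :: "('a \<Rightarrow> 'c) \<Rightarrow> 'k::comm_semiring_1"
  assumes "finite A" "finite S" "\<And>w. w \<in> A \<Longrightarrow> \<zeta> w \<in> S"
  shows "(\<Sum>\<xi>\<in>A \<rightarrow>\<^sub>E S. F \<xi> * (\<Prod>w\<in>A. of_bool (\<zeta> w = \<xi> w))) = F (restrict \<zeta> A)"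
proof -
  have "F \<xi> * (\<Prod>w\<in>A. of_bool (\<zeta> w = \<xi> w)) = (if \<xi> = restrict \<zeta> A then F \<xi> else 0)"
    if "\<xi> \<in> A \<rightarrow>\<^sub>E S" for \<xi>
  proof (cases "\<xi> = restrict \<zeta> A")
    case False
    have "\<xi> = restrict \<zeta> A" if "\<forall>w\<in>A. \<zeta> w = \<xi> w"
      using that \<open>\<xi> \<in> A \<rightarrow>\<^sub>E S\<close> by (intro ext) (auto simp: PiE_iff extensional_def restrict_def)
    then obtain w where "w \<in> A" "\<zeta> w \<noteq> \<xi> w" using False by blast
    then have "(\<Prod>w\<in>A. of_bool (\<zeta> w = \<xi> w)) = (0::'k)"
      using assms(1) by (intro prod_zero) auto
    then show ?thesis using False by simp
  qed simp
  then have "(\<Sum>\<xi>\<in>A \<rightarrow>\<^sub>E S. F \<xi> * (\<Prod>w\<in>A. of_bool (\<zeta> w = \<xi> w)))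
      = (\<Sum>\<xi>\<in>A \<rightarrow>\<^sub>E S. if \<xi> = restrict \<zeta> A then F \<xi> else 0)"
    by (rule sum.cong[OF refl])
  also have "\<dots> = F (restrict \<zeta> A)"
    using assms by (simp add: finite_PiE)
  finally show ?thesis .
qed

text \<open>A cell has area \<open>1 / n\<^sup>2\<close>, so this is the mean of \<open>h\<close>
  over the cell \<open>(i, j)\<close>.\<close>

definition cell_average :: "nat \<Rightarrow> (real \<times> real \<Rightarrow> 'k::{real_normed_field,euclidean_space}) \<Rightarrow> nat \<Rightarrow> nat \<Rightarrow> 'k"
  where
  "cell_average n h i j = of_nat n ^ 2 *
     (LINT s|unit_interval. (LINT t|unit_interval. h (s, t) * of_bool (cell n t = j)) * of_bool (cell n s = i))"

lemma cell_average_const: "i < n \<Longrightarrow> j < n \<Longrightarrow> cell_average n (\<lambda>_. k) i j = k"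
  by (simp add: cell_average_def integral_cell power2_eq_square)

text \<open>\<open>W\<close> sees the variables only through their cells. Given the cells, the
  variables are still independent and uniform, so \<open>h\<close> may be replaced by its mean over
  the cell that contains its argument.\<close>

lemma cell_grid_integral:
  fixes h :: "real \<times> real \<Rightarrow> 'k::{real_normed_field,euclidean_space}"
  assumes n: "0 < n" and fin: "finite A" "finite B" and uv: "u \<in> A" "v \<in> B" and h: "bounded_borel h"
  shows "(LINT p|(cube A \<Otimes>\<^sub>M cube B).
            h (fst p u, snd p v) * W (\<lambda>w\<in>A. cell n (fst p w)) (\<lambda>w\<in>B. cell n (snd p w)))
    = (\<Sum>\<xi>\<in>A \<rightarrow>\<^sub>E {..<n}. \<Sum>\<eta>\<in>B \<rightarrow>\<^sub>E {..<n}. W \<xi> \<eta> * cell_average n h (\<xi> u) (\<eta> v))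
        / of_nat n ^ (card A + card B)"
proof -
  define I :: "('a \<Rightarrow> nat) \<Rightarrow> ('b \<Rightarrow> nat) \<Rightarrow> ('a \<Rightarrow> real) \<times> ('b \<Rightarrow> real) \<Rightarrow> 'k" where
    "I \<xi> \<eta> p = h (fst p u, snd p v) * ((\<Prod>w\<in>A. of_bool (cell n (fst p w) = \<xi> w)) *
                                   (\<Prod>w\<in>B. of_bool (cell n (snd p w) = \<eta> w)))" for \<xi> \<eta> p
  have W: "W (\<lambda>w\<in>A. cell n (x w)) (\<lambda>w\<in>B. cell n (y w))
    = (\<Sum>\<xi>\<in>A \<rightarrow>\<^sub>E {..<n}. \<Sum>\<eta>\<in>B \<rightarrow>\<^sub>E {..<n}. W \<xi> \<eta> * (\<Prod>w\<in>B. of_bool (cell n (y w) = \<eta> w))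
        * (\<Prod>w\<in>A. of_bool (cell n (x w) = \<xi> w)))" for x y
    using sum_PiE_of_bool[of A "{..<n}" "\<lambda>w. cell n (x w)" "\<lambda>\<xi>. W \<xi> (\<lambda>w\<in>B. cell n (y w))"]
      sum_PiE_of_bool[of B "{..<n}" "\<lambda>w. cell n (y w)" "W \<xi>" for \<xi>] fin cell_less[OF n]
    by (simp add: sum_distrib_right[symmetric])
  have int: "integrable (cube A \<Otimes>\<^sub>M cube B) (I \<xi> \<eta>)" for \<xi> \<eta>
    unfolding I_def[abs_def]
    by (rule integrable_bounded_measurable[OF finite_measure_cube_pair[OF fin]
          cube_pair_integrand_bounded_measurable[where a = "\<lambda>w x. of_bool (cell n x = \<xi> w)" and
            b = "\<lambda>w x. of_bool (cell n x = \<eta> w)", OF uv h bounded_borel_cell bounded_borel_cell]])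
  have I: "integral\<^sup>L (cube A \<Otimes>\<^sub>M cube B) (I \<xi> \<eta>)
      = cell_average n h (\<xi> u) (\<eta> v) / of_nat n ^ (card A + card B)"
    if "\<xi> \<in> A \<rightarrow>\<^sub>E {..<n}" "\<eta> \<in> B \<rightarrow>\<^sub>E {..<n}" for \<xi> \<eta>
  proof -
    have prods: "(\<Prod>w\<in>A - {u}. LINT t|unit_interval. of_bool (cell n t = \<xi> w)) = (1 / of_nat n ^ (card A - 1) :: 'k)"
      "(\<Prod>w\<in>B - {v}. LINT t|unit_interval. of_bool (cell n t = \<eta> w)) = (1 / of_nat n ^ (card B - 1) :: 'k)"
      using that fin uv by (auto simp: integral_cell PiE_iff power_one_over)
    obtain a where a: "card A = Suc a" using uv fin by (metis card_Suc_Diff1)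
    obtain b where b: "card B = Suc b" using uv fin by (metis card_Suc_Diff1)
    show ?thesis
      unfolding I_def[abs_def]
      apply (subst cube_pair_integral_single[where a = "\<lambda>w x. of_bool (cell n x = \<xi> w)" and
            b = "\<lambda>w x. of_bool (cell n x = \<eta> w)", OF fin uv h bounded_borel_cell bounded_borel_cell])
      unfolding prods using n by (simp add: cell_average_def a b power2_eq_square power_add field_simps)
  qed
  have "(LINT p|(cube A \<Otimes>\<^sub>M cube B).
            h (fst p u, snd p v) * W (\<lambda>w\<in>A. cell n (fst p w)) (\<lambda>w\<in>B. cell n (snd p w)))
      = (LINT p|(cube A \<Otimes>\<^sub>M cube B). (\<Sum>\<xi>\<in>A \<rightarrow>\<^sub>E {..<n}. \<Sum>\<eta>\<in>B \<rightarrow>\<^sub>E {..<n}. W \<xi> \<eta> * I \<xi> \<eta> p))"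
    unfolding W I_def by (simp add: sum_distrib_left mult_ac)
  also have "\<dots> = (\<Sum>\<xi>\<in>A \<rightarrow>\<^sub>E {..<n}. \<Sum>\<eta>\<in>B \<rightarrow>\<^sub>E {..<n}. W \<xi> \<eta> * integral\<^sup>L (cube A \<Otimes>\<^sub>M cube B) (I \<xi> \<eta>))"
    using int by (simp add: Bochner_Integration.integral_sum integrable_sum)
  also have "\<dots> = (\<Sum>\<xi>\<in>A \<rightarrow>\<^sub>E {..<n}. \<Sum>\<eta>\<in>B \<rightarrow>\<^sub>E {..<n}.
        W \<xi> \<eta> * (cell_average n h (\<xi> u) (\<eta> v) / of_nat n ^ (card A + card B)))"
    by (intro sum.cong refl) (simp add: I)
  finally show ?thesis by (simp add: sum_divide_distrib)
qed

definition step_function :: "nat \<Rightarrow> (nat \<Rightarrow> nat \<Rightarrow> 'k) \<Rightarrow> real \<times> real \<Rightarrow> 'k" where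
  "step_function n m z = m (cell n (fst z)) (cell n (snd z))"

lemma bounded_borel_step_function:
  fixes m :: "nat \<Rightarrow> nat \<Rightarrow> 'k::euclidean_space"
  assumes n: "0 < n" shows "bounded_borel (step_function n m)"
proof -
  have "step_function n m \<in> borel_measurable borel"
    unfolding step_function_def[abs_def]
    by (rule measurable_compose_countable[where g = "\<lambda>z. cell n (fst z)" and f = "\<lambda>i z. m i (cell n (snd z))"],
        rule measurable_compose_countable[where g = "\<lambda>z. cell n (snd z)" and f = "\<lambda>j z. m i j" for i])
      (auto intro!: measurable_compose[OF _ cell_measurable] borel_measurable_continuous_onI continuous_intros)
  moreover have "range (step_function n m) \<subseteq> (\<lambda>(i, j). m i j) ` ({..<n} \<times> {..<n})"
    using cell_less[OF n] by (auto simp: step_function_def)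
  then have "bounded (range (step_function n m))"
    by (meson bounded_subset finite_SigmaI finite_imageI finite_imp_bounded finite_lessThan)
  ultimately show ?thesis
    by (auto simp: bounded_measurable_def bounded_iff)
qed

text \<open>All factors except the one at \<open>d\<close> are constant on cells, so only the cell
  averages of \<open>h\<close> matter. This evaluates the linear terms in
  \<open>null_cell_average\<close>.\<close>

lemma edge_integral_step_except:
  fixes h :: "real \<times> real \<Rightarrow> 'k::{real_normed_field,euclidean_space}"
  assumes n: "0 < n" and fin: "finite A" "finite B" and E: "E \<subseteq> A \<times> B" "d \<in> E" and h: "bounded_borel h"
  shows "edge_integral A B E (\<lambda>e. if e = d then h else step_function n (M e))
    = hom_density A B E n (\<lambda>e. if e = d then cell_average n h else M e)"
proof -
  have fE: "finite E" using fin E(1) finite_subset by blast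
  obtain u v where d: "d = (u, v)" by (cases d)
  have uv: "u \<in> A" "v \<in> B" using E d by auto
  define W where "W \<xi> \<eta> = (\<Prod>e\<in>E - {d}. M e (\<xi> (fst e)) (\<eta> (snd e)))" for \<xi> \<eta>
  have "(\<Prod>e\<in>E. (if e = d then h else step_function n (M e)) (fst p (fst e), snd p (snd e)))
      = h (fst p u, snd p v) * W (\<lambda>w\<in>A. cell n (fst p w)) (\<lambda>w\<in>B. cell n (snd p w))" for p
  proof -
    have "(\<Prod>e\<in>E - {d}. (if e = d then h else step_function n (M e)) (fst p (fst e), snd p (snd e)))
      = W (\<lambda>w\<in>A. cell n (fst p w)) (\<lambda>w\<in>B. cell n (snd p w))"
      unfolding W_def using E by (intro prod.cong) (auto simp: step_function_def)
    then show ?thesis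
      by (subst prod.remove[OF fE E(2)]) (simp add: d)
  qed
  then have "edge_integral A B E (\<lambda>e. if e = d then h else step_function n (M e))
    = (\<Sum>\<xi>\<in>A \<rightarrow>\<^sub>E {..<n}. \<Sum>\<eta>\<in>B \<rightarrow>\<^sub>E {..<n}. W \<xi> \<eta> * cell_average n h (\<xi> u) (\<eta> v))
        / of_nat n ^ (card A + card B)"
    unfolding edge_integral_def by (simp only: cell_grid_integral[OF n fin uv h])
  moreover have "(\<Prod>e\<in>E. (if e = d then cell_average n h else M e) (\<xi> (fst e)) (\<eta> (snd e)))
      = W \<xi> \<eta> * cell_average n h (\<xi> u) (\<eta> v)" for \<xi> \<eta>
  proof -
    have "(\<Prod>e\<in>E - {d}. (if e = d then cell_average n h else M e) (\<xi> (fst e)) (\<eta> (snd e))) = W \<xi> \<eta>"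
      unfolding W_def by (intro prod.cong) auto
    then show ?thesis
      by (subst prod.remove[OF fE E(2)]) (simp add: d mult.commute)
  qed
  ultimately show ?thesis by (simp add: hom_density_def)
qed

lemma edge_integral_step:
  fixes M :: "'a \<times> 'b \<Rightarrow> nat \<Rightarrow> nat \<Rightarrow> 'k::{real_normed_field,euclidean_space}"
  assumes n: "0 < n" and fin: "finite A" "finite B" and E: "E \<subseteq> A \<times> B" "E \<noteq> {}"
  shows "edge_integral A B E (\<lambda>e. step_function n (M e)) = hom_density A B E n M"
proof -
  obtain u v where uv: "u \<in> A" "v \<in> B" using E by auto
  define W where "W \<xi> \<eta> = (\<Prod>e\<in>E. M e (\<xi> (fst e)) (\<eta> (snd e)))" for \<xi> \<eta>
  \<comment> \<open>The constant 1 is put in the place of \<open>h\<close> in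
    \<open>cell_grid_integral\<close>; its cell averages are 1.\<close>
  have "(\<Prod>e\<in>E. step_function n (M e) (fst p (fst e), snd p (snd e)))
      = 1 * W (\<lambda>w\<in>A. cell n (fst p w)) (\<lambda>w\<in>B. cell n (snd p w))" for p
    unfolding W_def using E by (simp, intro prod.cong) (auto simp: step_function_def)
  then have "edge_integral A B E (\<lambda>e. step_function n (M e))
    = (\<Sum>\<xi>\<in>A \<rightarrow>\<^sub>E {..<n}. \<Sum>\<eta>\<in>B \<rightarrow>\<^sub>E {..<n}. W \<xi> \<eta> * cell_average n (\<lambda>_. 1) (\<xi> u) (\<eta> v))
        / of_nat n ^ (card A + card B)"
    unfolding edge_integral_def
    by (simp only: cell_grid_integral[OF n fin uv bounded_measurable_const])
  also have "\<dots> = (\<Sum>\<xi>\<in>A \<rightarrow>\<^sub>E {..<n}. \<Sum>\<eta>\<in>B \<rightarrow>\<^sub>E {..<n}. W \<xi> \<eta>) / of_nat n ^ (card A + card B)"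
    using uv by (intro arg_cong2[where f = "(/)"] sum.cong refl) (auto simp: cell_average_const PiE_iff)
  finally show ?thesis by (simp add: hom_density_def W_def)
qed

section \<open>From functions to matrices\<close>

text \<open>The sets over which \<open>f\<close> integrates to 0 form a Dynkin system: complements
  use the vanishing total integral, disjoint unions countable additivity. As \<open>G\<close> is
  stable under intersection, the system contains all measurable sets.\<close>

lemma AE_zero_if_integral_zero_on_generator:
  fixes f :: "'s \<Rightarrow> 'k::{banach, second_countable_topology}"
  assumes M: "sigma_finite_measure M" and f: "integrable M f" and G: "Int_stable G" "G \<subseteq> Pow (space M)" "sets M = sigma_sets (space M) G"
    and zero: "\<And>X. X \<in> G \<Longrightarrow> (LINT x:X|M. f x) = 0" and total: "integral\<^sup>L M f = 0"
  shows "AE x in M. f x = 0"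
proof (rule sigma_finite_measure.density_zero[OF M f])
  fix X assume X: "X \<in> sets M"
  have int: "set_integrable M Y f" if "Y \<in> sets M" for Y
    unfolding set_integrable_def using f that by (rule integrable_mult_indicator[rotated])
  from X have "X \<in> sigma_sets (space M) G" using G(3) by simp
  with G(1,2) show "(LINT x:X|M. f x) = 0"
  proof (induction rule: sigma_sets_induct_disjoint)
    case (basic A) then show ?case by (rule zero)
  next
    case empty then show ?case by (simp add: set_lebesgue_integral_def)
  next
    case (compl A)
    then have A: "A \<in> sets M" using G(3) by simp
    have "(LINT x:A \<union> (space M - A)|M. f x) = (LINT x:A|M. f x) + (LINT x:space M - A|M. f x)"
      using A by (intro set_integral_Un int) auto
    moreover have "A \<union> (space M - A) = space M" using sets.sets_into_space[OF A] by auto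
    moreover have "(LINT x:space M|M. f x) = integral\<^sup>L M f"
      using f by (rule set_integral_space)
    ultimately show ?case using compl.IH total by simp
  next
    case (union A)
    then have A: "A i \<in> sets M" for i using G(3) by auto
    have "(LINT x:(\<Union>i. A i)|M. f x) = (\<Sum>i. (LINT x:A i|M. f x))"
      using union(1) A by (intro lebesgue_integral_countable_add int) (auto simp: disjoint_family_on_def)
    then show ?case using union.IH by simp
  qed
qed

text \<open>Rational endpoints are singled out because each of them is a point of some uniform
  grid.\<close>

lemma borel_eq_rational_rays: "borel = sigma UNIV ((\<lambda>q::real. {..<q}) ` \<rat>)"
proof (rule borel_eq_sigmaI1[OF borel_Iio])
  fix X :: "real set" assume "X \<in> range lessThan"
  then obtain a where "X = {..<a}" by auto
  also have "\<dots> = (\<Union>q\<in>{q\<in>\<rat>. q < a}. {..<q})"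
    using Rats_dense_in_real by fastforce
  also have "\<dots> \<in> sets (sigma UNIV ((\<lambda>q::real. {..<q}) ` \<rat>))"
    by (intro sets.countable_UN' countable_subset[OF _ countable_rat]) auto
  finally show "X \<in> sets (sigma UNIV ((\<lambda>q::real. {..<q}) ` \<rat>))" .
qed simp

lemma borel_plane_generator:
  "sets (borel :: (real \<times> real) measure) = sigma_sets UNIV {{..<p} \<times> {..<q} | p q. p \<in> \<rat> \<and> q \<in> \<rat>}"
proof -
  let ?G = "(\<lambda>q::real. {..<q}) ` \<rat>"
  \<comment> \<open>\<open>sigma_prod\<close> asks for a countable cover of each factor by
    generators.\<close>
  have cover: "\<exists>C\<subseteq>?G. countable C \<and> UNIV = \<Union>C"
  proof (intro exI[of _ ?G] conjI)
    show "UNIV = \<Union>?G"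
    proof (intro equalityI subsetI)
      fix x :: real
      obtain q where "q \<in> \<rat>" "x + 1 \<le> q" using Rats_no_top_le by blast
      then show "x \<in> \<Union>?G" by (auto intro!: bexI[of _ q])
    qed simp
  qed (auto intro: countable_rat)
  have "(borel :: (real \<times> real) measure) = sigma UNIV ?G \<Otimes>\<^sub>M sigma UNIV ?G"
    by (simp only: borel_prod[symmetric] borel_eq_rational_rays[symmetric])
  also have "\<dots> = sigma (UNIV \<times> UNIV) {a \<times> b | a b. a \<in> ?G \<and> b \<in> ?G}"
    by (rule sigma_prod[OF cover _ cover]) auto
  also have "{a \<times> b | a b. a \<in> ?G \<and> b \<in> ?G} = {{..<p} \<times> {..<q} | p q. p \<in> \<rat> \<and> q \<in> \<rat>}"
    by blast
  finally have eq: "borel = sigma UNIV {{..<p::real} \<times> {..<q::real} | p q. p \<in> \<rat> \<and> q \<in> \<rat>}" by simp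
  show ?thesis by (subst eq) (simp add: sets_measure_of)
qed

lemma unit_square_measurable: "unit_square \<in> sets borel"
  unfolding unit_square_def by (simp add: borel_Times)

lemma integral_unit_square:
  fixes f :: "real \<times> real \<Rightarrow> 'k::{real_normed_field,euclidean_space}"
  assumes f: "bounded_borel f"
  shows "integrable lborel (\<lambda>z. indicator unit_square z *\<^sub>R f z)"
    and "(LINT z|lborel. indicator unit_square z *\<^sub>R f z)
      = (LINT s|unit_interval. (LINT t|unit_interval. f (s, t)))"
proof -
  obtain K where K: "\<forall>z. norm (f z) \<le> K" and m: "f \<in> borel_measurable borel"
    using f unfolding bounded_measurable_def by blast
  have "emeasure lborel unit_square < \<infinity>"
    unfolding unit_square_def
    by (metis bounded_Times bounded_closed_interval emeasure_bounded_finite)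
  then have "integrable lborel (\<lambda>z. indicator unit_square z *\<^sub>R K)"
    using unit_square_measurable by (intro integrable_scaleR_left integrable_real_indicator) auto
  then show int: "integrable lborel (\<lambda>z. indicator unit_square z *\<^sub>R f z)"
    by (rule Bochner_Integration.integrable_bound)
      (use K m unit_square_measurable in \<open>auto simp: indicator_def intro!: AE_I2 order_trans[OF _ abs_ge_self]\<close>)
  have "(LINT z|lborel. indicator unit_square z *\<^sub>R f z)
      = (LINT s|lborel. (LINT t|lborel. indicator unit_square (s, t) *\<^sub>R f (s, t)))"
    using lborel_pair.integral_fst'[of "\<lambda>z. indicator unit_square z *\<^sub>R f z"] int by (simp add: lborel_prod)
  also have "\<dots> = (LINT s|lborel. indicator {0..1} s *\<^sub>R (LINT t|lborel. indicator {0..1} t *\<^sub>R f (s, t)))"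
    by (intro Bochner_Integration.integral_cong refl)
      (auto simp: unit_square_def indicator_def integral_scaleR_right[symmetric] simp del: integral_scaleR_right)
  also have "\<dots> = (LINT s|unit_interval. (LINT t|unit_interval. f (s, t)))"
    by (subst integral_restrict_space, simp, subst integral_restrict_space) simp_all
  finally show "(LINT z|lborel. indicator unit_square z *\<^sub>R f z)
      = (LINT s|unit_interval. (LINT t|unit_interval. f (s, t)))" .
qed

text \<open>\<open>a\<close> may be any integer, so rational bounds outside the unit interval are
  covered as well.\<close>

lemma less_grid_point_iff:
  assumes "0 < n" "0 \<le> x" "x < 1"
  shows "x < of_int a / real n \<longleftrightarrow> int (cell n x) < a"
proof -
  have n: "0 < real n" using assms by simp
  have "real n * x < real n" using assms n by simp
  then have "\<lfloor>real n * x\<rfloor> < int n" by linarith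
  moreover have "0 \<le> \<lfloor>real n * x\<rfloor>" using assms by simp
  ultimately have "int (cell n x) = \<lfloor>real n * x\<rfloor>" unfolding cell_def by linarith
  moreover have "x < of_int a / real n \<longleftrightarrow> real n * x < of_int a" using n by (simp add: field_simps)
  ultimately show ?thesis by (simp add: floor_less_iff)
qed

lemma rat_common_denominator:
  assumes "p \<in> \<rat>" "q \<in> \<rat>"
  obtains n :: nat and a b :: int where "0 < n" "p = of_int a / real n" "q = of_int b / real n"
proof -
  obtain a m where p: "p = of_int a / real m" "m \<noteq> 0" using assms(1) unfolding Rats_eq_int_div_nat by auto
  obtain b k where q: "q = of_int b / real k" "k \<noteq> 0" using assms(2) unfolding Rats_eq_int_div_nat by auto
  show ?thesis
    by (rule that[of "m * k" "a * int k" "b * int m"]) (use p q in auto)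
qed

text \<open>On a grid whose size is a common denominator of the corner, a rational quadrant meets
  the square in a union of cells, up to a null set. Hence \<open>f\<close> integrates to 0 over all
  of these quadrants, which generate the Borel sets.\<close>

lemma AE_zero_if_cell_averages_zero:
  fixes f :: "real \<times> real \<Rightarrow> 'k::{real_normed_field,euclidean_space}"
  assumes f: "bounded_borel f" and zero: "\<And>n i j. 0 < n \<Longrightarrow> i < n \<Longrightarrow> j < n \<Longrightarrow> cell_average n f i j = 0"
  shows "AE z in lebesgue_on unit_square. f z = 0"
proof -
  let ?g = "\<lambda>z. indicator unit_square z *\<^sub>R f z"
  have int: "integrable lborel ?g" by (rule integral_unit_square(1)[OF f])
  have cells: "(LINT z|lborel. ?g z * (of_bool (cell n (snd z) = j) * of_bool (cell n (fst z) = i))) = 0"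
    and cells_int: "integrable lborel (\<lambda>z. ?g z * (of_bool (cell n (snd z) = j) * of_bool (cell n (fst z) = i)))"
    if "0 < n" "i < n" "j < n" for n i j
  proof -
    let ?h = "\<lambda>z. f z * (of_bool (cell n (snd z) = j) * of_bool (cell n (fst z) = i))"
    have h: "bounded_borel ?h"
      by (intro bounded_measurable_mult f bounded_measurable_compose[OF bounded_borel_cell]
          borel_measurable_continuous_onI continuous_intros)
    have "(LINT s|unit_interval. (LINT t|unit_interval. ?h (s, t)))
       = (LINT s|unit_interval. (LINT t|unit_interval. f (s, t) * of_bool (cell n t = j)) * of_bool (cell n s = i))"
      by (simp add: mult.assoc[symmetric])
    also have "\<dots> = 0" using zero[OF that] that by (simp add: cell_average_def)
    finally show "(LINT z|lborel. ?g z * (of_bool (cell n (snd z) = j) * of_bool (cell n (fst z) = i))) = 0"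
      using integral_unit_square(2)[OF h] by simp
    show "integrable lborel (\<lambda>z. ?g z * (of_bool (cell n (snd z) = j) * of_bool (cell n (fst z) = i)))"
      using integral_unit_square(1)[OF h] by simp
  qed
  \<comment> \<open>A coordinate equal to 1 is counted in the last cell although it is not below the
    right end of that cell; such points form a null set.\<close>
  have not1: "AE z in lborel. fst z \<noteq> (1::real) \<and> snd z \<noteq> (1::real)"
  proof -
    have "{z :: real \<times> real. fst z = 1 \<or> snd z = 1} = {1} \<times> UNIV \<union> UNIV \<times> {1}" by auto
    also have "\<dots> \<in> null_sets lborel"
      by (intro null_sets.Un; simp add: null_sets_def lborel_prod[symmetric] lborel.emeasure_pair_measure_Times)
    finally show ?thesis by (intro AE_I'[of "{z. fst z = 1 \<or> snd z = 1}"]) auto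
  qed
  have rect: "(LINT z:{..<p} \<times> {..<q}|lborel. ?g z) = 0" if pq: "p \<in> \<rat>" "q \<in> \<rat>" for p q
  proof -
    obtain n :: nat and a b :: int where n: "0 < n" and p: "p = of_int a / real n" and q: "q = of_int b / real n"
      using rat_common_denominator[OF pq] by metis
    define I where "I = {i. i < n \<and> int i < a}"
    define J where "J = {j. j < n \<and> int j < b}"
    have IJ: "finite I" "finite J" by (auto simp: I_def J_def)
    have sum_I: "(\<Sum>i\<in>I. of_bool (cell n x = i)) = (of_bool (int (cell n x) < a) :: 'k)"
      and sum_J: "(\<Sum>i\<in>J. of_bool (cell n x = i)) = (of_bool (int (cell n x) < b) :: 'k)" for x
      using IJ cell_less[OF n, of x] by (auto simp: of_bool_def sum.delta I_def J_def)
    have "(LINT z:{..<p} \<times> {..<q}|lborel. ?g z)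
       = (LINT z|lborel. (\<Sum>i\<in>I. \<Sum>j\<in>J. ?g z * (of_bool (cell n (snd z) = j) * of_bool (cell n (fst z) = i))))"
      unfolding set_lebesgue_integral_def
    proof (rule integral_cong_AE)
      show "AE z in lborel. indicat_real ({..<p} \<times> {..<q}) z *\<^sub>R ?g z
        = (\<Sum>i\<in>I. \<Sum>j\<in>J. ?g z * (of_bool (cell n (snd z) = j) * of_bool (cell n (fst z) = i)))"
        using not1
      proof eventually_elim
        case (elim z)
        have "(\<Sum>i\<in>I. \<Sum>j\<in>J. ?g z * (of_bool (cell n (snd z) = j) * of_bool (cell n (fst z) = i)))
          = ?g z * (of_bool (int (cell n (fst z)) < a) * of_bool (int (cell n (snd z)) < b))"
          unfolding sum_I[symmetric] sum_J[symmetric] sum_product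
          by (simp only: sum_distrib_left mult.commute[of "of_bool (cell n (snd z) = _)"])
        moreover have "fst z < p \<longleftrightarrow> int (cell n (fst z)) < a" "snd z < q \<longleftrightarrow> int (cell n (snd z)) < b"
          if "z \<in> unit_square"
          using that elim n less_grid_point_iff[of n "fst z" a] less_grid_point_iff[of n "snd z" b]
          by (auto simp: p q unit_square_def)
        ultimately show ?case
          by (cases "z \<in> unit_square") (auto simp: indicator_def mem_Times_iff)
      qed
      show "(\<lambda>z. indicat_real ({..<p} \<times> {..<q}) z *\<^sub>R ?g z) \<in> borel_measurable lborel"
        using int by (intro borel_measurable_scaleR borel_measurable_indicator borel_measurable_integrable)
          (auto simp: borel_Times)
      show "(\<lambda>z. \<Sum>i\<in>I. \<Sum>j\<in>J. ?g z * (of_bool (cell n (snd z) = j) * of_bool (cell n (fst z) = i)))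
          \<in> borel_measurable lborel"
        using cells_int[OF n] by (intro borel_measurable_sum borel_measurable_integrable) (auto simp: I_def J_def)
    qed
    also have "\<dots> = (\<Sum>i\<in>I. LINT z|lborel. (\<Sum>j\<in>J. ?g z * (of_bool (cell n (snd z) = j) * of_bool (cell n (fst z) = i))))"
      by (rule Bochner_Integration.integral_sum, rule Bochner_Integration.integrable_sum, rule cells_int)
        (auto simp: n I_def J_def)
    also have "\<dots> = 0"
    proof (rule sum.neutral, rule ballI)
      fix i assume i: "i \<in> I"
      have "(LINT z|lborel. (\<Sum>j\<in>J. ?g z * (of_bool (cell n (snd z) = j) * of_bool (cell n (fst z) = i))))
        = (\<Sum>j\<in>J. LINT z|lborel. ?g z * (of_bool (cell n (snd z) = j) * of_bool (cell n (fst z) = i)))"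
        by (rule Bochner_Integration.integral_sum, rule cells_int) (use i in \<open>auto simp: n I_def J_def\<close>)
      also have "\<dots> = 0"
        by (rule sum.neutral, rule ballI, rule cells) (use i in \<open>auto simp: n I_def J_def\<close>)
      finally show "(LINT z|lborel. (\<Sum>j\<in>J. ?g z * (of_bool (cell n (snd z) = j) * of_bool (cell n (fst z) = i)))) = 0" .
    qed
    finally show ?thesis .
  qed
  have "AE z in lborel. ?g z = 0"
  proof (rule AE_zero_if_integral_zero_on_generator[OF lborel.sigma_finite_measure_axioms int])
    show "Int_stable {{..<p::real} \<times> {..<q::real} | p q. p \<in> \<rat> \<and> q \<in> \<rat>}"
    proof (rule Int_stableI)
      fix a b assume "a \<in> {{..<p::real} \<times> {..<q::real} | p q. p \<in> \<rat> \<and> q \<in> \<rat>}"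
        "b \<in> {{..<p::real} \<times> {..<q::real} | p q. p \<in> \<rat> \<and> q \<in> \<rat>}"
      then obtain p q p' q' where "a = {..<p} \<times> {..<q}" "b = {..<p'} \<times> {..<q'}"
        "p \<in> \<rat>" "q \<in> \<rat>" "p' \<in> \<rat>" "q' \<in> \<rat>" by blast
      moreover from this have "a \<inter> b = {..<min p p'} \<times> {..<min q q'}" by auto
      moreover have "min p p' \<in> \<rat>" "min q q' \<in> \<rat>" using calculation by (auto simp: min_def)
      ultimately show "a \<inter> b \<in> {{..<p::real} \<times> {..<q::real} | p q. p \<in> \<rat> \<and> q \<in> \<rat>}" by blast
    qed
    show "sets lborel = sigma_sets (space lborel) {{..<p::real} \<times> {..<q::real} | p q. p \<in> \<rat> \<and> q \<in> \<rat>}"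
      using borel_plane_generator by simp
    \<comment> \<open>This quadrant contains the unit square, so \<open>rect\<close> also gives the
      total integral.\<close>
    have "(LINT z:{..<2} \<times> {..<2}|lborel. ?g z) = integral\<^sup>L lborel ?g"
      unfolding set_lebesgue_integral_def
      by (intro Bochner_Integration.integral_cong refl) (auto simp: indicator_def unit_square_def)
    then show "integral\<^sup>L lborel ?g = 0" using rect[of 2 2] by simp
  qed (use rect in auto)
  then have "AE z in lborel. z \<in> unit_square \<longrightarrow> f z = 0"
    by eventually_elim auto
  then show ?thesis
    using unit_square_measurable by (simp add: AE_restrict_space_iff AE_completion_iff)
qed

section \<open>The linear coefficient of a perturbed integral\<close>

context modulus_conjugation
begin

definition twisted_integral ::
  "'a set \<Rightarrow> 'b set \<Rightarrow> ('a \<times> 'b) set \<Rightarrow> ('a \<times> 'b \<Rightarrow> bool) \<Rightarrow> (real \<times> real \<Rightarrow> 'k) \<Rightarrow> 'k"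
  where
  "twisted_integral A B E s f = edge_integral A B E (\<lambda>e z. twist (s e) (f z))"

definition graph_functional ::
  "'a set \<Rightarrow> 'b set \<Rightarrow> ('a \<times> 'b) set \<Rightarrow> ('a \<times> 'b \<Rightarrow> bool) \<Rightarrow> (real \<times> real \<Rightarrow> 'k) \<Rightarrow> real"
  where
  "graph_functional A B E s f = norm (twisted_integral A B E s f) powr (1 / real (card E))"

lemma bounded_borel_twist: "bounded_borel f \<Longrightarrow> bounded_borel (\<lambda>z. twist b (f z))"
  by (rule bounded_measurable_linear[OF bounded_linear_twist])

text \<open>\<open>twist\<close> is bounded and real-linear, hence passes through integrals, and it
  fixes indicators and the normalising factor.\<close>

lemma cell_average_twist:
  assumes f: "bounded_borel (f :: real \<times> real \<Rightarrow> 'k)"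
  shows "cell_average n (\<lambda>z. twist b (f z)) i j = twist b (cell_average n f i j)"
proof -
  have bool: "twist b (of_bool P) = of_bool P" for P by simp
  have pow: "twist b (of_nat n ^ 2) = of_nat n ^ 2"
    using twist_of_real[of b "real n ^ 2"] by simp
  let ?h = "\<lambda>z. f z * of_bool (cell n (snd z) = j)"
  have h: "bounded_borel ?h"
    by (intro bounded_measurable_mult f bounded_measurable_compose[OF bounded_borel_cell]
        borel_measurable_continuous_onI continuous_intros)
  have inner: "(LINT t|unit_interval. twist b (f (s, t)) * of_bool (cell n t = j))
      = twist b (LINT t|unit_interval. f (s, t) * of_bool (cell n t = j))" for s
    using integral_bounded_linear[OF bounded_linear_twist
        integrable_bounded_borel[OF bounded_borel_section(2)[OF h]], of b s]
    by (simp add: twist_mult bool)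
  have G: "bounded_borel (\<lambda>s. (LINT t|unit_interval. f (s, t) * of_bool (cell n t = j)) * of_bool (cell n s = i))"
    using bounded_borel_integral[OF h] by (intro bounded_measurable_mult bounded_borel_cell) simp
  show ?thesis
    unfolding cell_average_def inner twist_mult pow
    using integral_bounded_linear[OF bounded_linear_twist integrable_bounded_borel[OF G], of b]
    by (simp add: twist_mult bool)
qed

end

text \<open>\<open>K\<close> is the set of edges that take the perturbation, so the coefficient of
  \<open>x ^ k\<close> collects the sets of \<open>k\<close> edges.\<close>

lemma edge_integral_sum_subsets:
  fixes \<Phi> \<Psi> :: "'a \<times> 'b \<Rightarrow> real \<times> real \<Rightarrow> 'k::{real_normed_field,euclidean_space}"
  assumes fin: "finite A" "finite B" and E: "E \<subseteq> A \<times> B"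
    and \<Phi>: "\<And>e. bounded_borel (\<Phi> e)" and \<Psi>: "\<And>e. bounded_borel (\<Psi> e)"
  shows "edge_integral A B E (\<lambda>e z. \<Psi> e z + x * \<Phi> e z)
    = (\<Sum>K\<in>Pow E. x ^ card K * edge_integral A B E (\<lambda>e. if e \<in> K then \<Phi> e else \<Psi> e))"
proof -
  have fE: "finite E" using fin E finite_subset by blast
  have prod: "(\<Prod>e\<in>E. \<Psi> e (q e) + x * \<Phi> e (q e))
      = (\<Sum>K\<in>Pow E. x ^ card K * (\<Prod>e\<in>E. (if e \<in> K then \<Phi> e else \<Psi> e) (q e)))" for q
  proof -
    have "(\<Prod>e\<in>E. \<Psi> e (q e) + x * \<Phi> e (q e)) = (\<Prod>e\<in>E. x * \<Phi> e (q e) + \<Psi> e (q e))"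
      by (simp add: add.commute)
    also have "\<dots> = (\<Sum>K\<in>Pow E. (\<Prod>e\<in>K. x * \<Phi> e (q e)) * (\<Prod>e\<in>E - K. \<Psi> e (q e)))"
      by (rule prod_add[OF fE])
    also have "\<dots> = (\<Sum>K\<in>Pow E. x ^ card K * (\<Prod>e\<in>E. (if e \<in> K then \<Phi> e else \<Psi> e) (q e)))"
    proof (rule sum.cong[OF refl])
      fix K assume "K \<in> Pow E"
      then have "(\<Prod>e\<in>E. (if e \<in> K then \<Phi> e else \<Psi> e) (q e)) = (\<Prod>e\<in>K. \<Phi> e (q e)) * (\<Prod>e\<in>E - K. \<Psi> e (q e))"
        using fE by (subst prod.subset_diff[of K E]) (auto simp: mult.commute intro!: arg_cong2[where f = "(*)"] prod.cong)
      then show "(\<Prod>e\<in>K. x * \<Phi> e (q e)) * (\<Prod>e\<in>E - K. \<Psi> e (q e))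
        = x ^ card K * (\<Prod>e\<in>E. (if e \<in> K then \<Phi> e else \<Psi> e) (q e))"
        by (simp add: prod.distrib mult.assoc)
    qed
    finally show ?thesis .
  qed
  have int: "integrable (cube A \<Otimes>\<^sub>M cube B)
      (\<lambda>p. x ^ card K * (\<Prod>e\<in>E. (if e \<in> K then \<Phi> e else \<Psi> e) (fst p (fst e), snd p (snd e))))" for K
    using edge_product_integrable[of A B E "\<lambda>e. if e \<in> K then \<Phi> e else \<Psi> e"] fin E \<Phi> \<Psi>
    by (intro integrable_mult_right) simp
  show ?thesis
    unfolding edge_integral_def prod
    by (subst Bochner_Integration.integral_sum[OF int]) simp
qed

text \<open>A polynomial of one real variable that stays bounded is constant.\<close>

lemma bounded_subset_sum_linear_coefficient:
  fixes t :: "'e set \<Rightarrow> 'k::{real_normed_field}"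
  assumes E: "finite E" and bound: "\<And>r::real. norm (\<Sum>K\<in>Pow E. of_real r ^ card K * t K) \<le> C"
  shows "(\<Sum>e\<in>E. t {e}) = 0"
proof (cases "E = {}")
  case False
  define b where "b k = (\<Sum>K\<in>{K \<in> Pow E. card K = k}. t K)" for k
  have poly: "(\<Sum>K\<in>Pow E. x ^ card K * t K) = (\<Sum>k\<le>card E. b k * x ^ k)" for x
  proof -
    have "(\<Sum>k\<le>card E. b k * x ^ k) = (\<Sum>k\<le>card E. \<Sum>K\<in>{K \<in> Pow E. card K = k}. x ^ card K * t K)"
      unfolding b_def sum_distrib_right by (intro sum.cong refl) (auto simp: mult.commute)
    also have "\<dots> = (\<Sum>K\<in>Pow E. x ^ card K * t K)"
      using E by (intro sum.group) (auto intro: card_mono)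
    finally show ?thesis by simp
  qed
  have "b 1 = 0"
  proof (rule ccontr)
    assume "b 1 \<noteq> 0"
    then have "eventually (\<lambda>z. C + 1 \<le> norm (\<Sum>i\<le>card E. b i * z ^ i)) at_infinity"
      using E False by (intro polyfun_extremal exI[of _ 1]) (auto simp: Suc_le_eq card_gt_0_iff)
    then obtain R where R: "\<And>z. R \<le> norm z \<Longrightarrow> C + 1 \<le> norm (\<Sum>i\<le>card E. b i * z ^ i)"
      unfolding eventually_at_infinity by auto
    \<comment> \<open>Growth is known for all large scalars, the upper bound only for real ones;
      \<open>\<bar>R\<bar>\<close> meets both conditions.\<close>
    have "C + 1 \<le> norm (\<Sum>i\<le>card E. b i * of_real \<bar>R\<bar> ^ i)" by (rule R) simp
    then show False using bound[of "\<bar>R\<bar>"] unfolding poly by simp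
  qed
  moreover have "b 1 = (\<Sum>e\<in>E. t {e})"
  proof -
    have "{K \<in> Pow E. card K = 1} = (\<lambda>e. {e}) ` E" by (auto simp: card_1_singleton_iff)
    then show ?thesis unfolding b_def by (simp add: sum.reindex)
  qed
  ultimately show ?thesis by simp
qed simp

text \<open>The analogue of \<open>matrix_seminorm\<close> for bounded Borel functions; step
  functions carry its triangle inequality over to matrices.\<close>

locale graph_seminorm = modulus_conjugation +
  fixes A :: "'b set" and B :: "'c set" and E :: "('b \<times> 'c) set" and s :: "'b \<times> 'c \<Rightarrow> bool"
  assumes fin_A: "finite A" and fin_B: "finite B" and E_sub: "E \<subseteq> A \<times> B" and E_ne: "E \<noteq> {}"
    and no_iso_A: "\<And>u. u \<in> A \<Longrightarrow> E `` {u} \<noteq> {}"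
    and no_iso_B: "\<And>v. v \<in> B \<Longrightarrow> E\<inverse> `` {v} \<noteq> {}"
    and functional_triangle: "\<And>f g. bounded_borel f \<Longrightarrow> bounded_borel g \<Longrightarrow>
      graph_functional A B E s (\<lambda>z. f z + g z) \<le> graph_functional A B E s f + graph_functional A B E s g"
begin

lemma twisted_integral_step:
  assumes "0 < n" shows "twisted_integral A B E s (step_function n m) = twisted_density A B E s n (\<lambda>_. m)"
  unfolding twisted_integral_def twisted_density_def
  using edge_integral_step[OF assms fin_A fin_B E_sub E_ne, of "\<lambda>e i j. twist (s e) (m i j)"]
  by (simp add: step_function_def[abs_def])

sublocale matrix_seminorm c A B E s
proof
  fix n :: nat and m m' :: "nat \<Rightarrow> nat \<Rightarrow> 'a" assume n: "0 < n"
  show "matrix_functional A B E s n (\<lambda>i j. m i j + m' i j)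
      \<le> matrix_functional A B E s n m + matrix_functional A B E s n m'"
    using functional_triangle[OF bounded_borel_step_function[OF n] bounded_borel_step_function[OF n], of m m']
      twisted_integral_step[OF n, of "\<lambda>i j. m i j + m' i j"]
    by (simp add: graph_functional_def matrix_functional_def twisted_integral_step[OF n, symmetric] step_function_def[abs_def])
qed (fact fin_A fin_B E_sub E_ne no_iso_A no_iso_B)+

text \<open>All multiples \<open>r f\<close> have functional 0, so the triangle inequality bounds
  the integral of \<open>g + r f\<close> by that of \<open>g\<close>, uniformly in \<open>r\<close>.
  In each linear term averaging turns \<open>f\<close> into \<open>m\<close>, the matrix already on
  the other edges, so the linear coefficient is \<open>card E\<close> times the density of
  \<open>m\<close>.\<close>

lemma null_cell_average:
  assumes f: "bounded_borel f" and null: "twisted_integral A B E s f = 0" and n: "0 < n"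
  shows "twisted_density A B E s n (\<lambda>_. cell_average n f) = 0"
proof -
  define m where "m = cell_average n f"
  define g where "g = step_function n m"
  have g: "bounded_borel g" unfolding g_def by (rule bounded_borel_step_function[OF n])
  define t where "t K = edge_integral A B E (\<lambda>e. if e \<in> K then (\<lambda>z. twist (s e) (f z)) else (\<lambda>z. twist (s e) (g z)))" for K
  have expand: "twisted_integral A B E s (\<lambda>z. g z + of_real r * f z) = (\<Sum>K\<in>Pow E. of_real r ^ card K * t K)" for r
    unfolding twisted_integral_def t_def twist_add twist_mult twist_of_real
    by (rule edge_integral_sum_subsets[OF fin_A fin_B E_sub bounded_borel_twist[OF f] bounded_borel_twist[OF g]])
  have "norm (\<Sum>K\<in>Pow E. of_real r ^ card K * t K) \<le> norm (twisted_integral A B E s g)" for r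
  proof -
    have rf: "bounded_borel (\<lambda>z. of_real r * f z)"
      by (intro bounded_measurable_mult bounded_measurable_const f)
    have "twisted_integral A B E s (\<lambda>z. of_real r * f z) = of_real r ^ card E * twisted_integral A B E s f"
      unfolding twisted_integral_def edge_integral_def twist_mult twist_of_real prod.distrib by simp
    then have "graph_functional A B E s (\<lambda>z. of_real r * f z) = 0"
      using null by (simp add: graph_functional_def)
    then have "graph_functional A B E s (\<lambda>z. g z + of_real r * f z) \<le> graph_functional A B E s g"
      using functional_triangle[OF g rf] by simp
    \<comment> \<open>A positive power is strictly increasing, so the bound on the roots is a bound
      on the moduli.\<close>
    then show ?thesis
      using card_E_pos unfolding graph_functional_def expand
      by (intro leI notI) (metis norm_ge_zero not_less of_nat_0_less_iff powr_less_mono2 zero_less_divide_1_iff)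
  qed
  then have "(\<Sum>e\<in>E. t {e}) = 0"
    by (rule bounded_subset_sum_linear_coefficient[OF fin_E])
  moreover have "t {d} = twisted_density A B E s n (\<lambda>_. m)" if d: "d \<in> E" for d
  proof -
    have "t {d} = edge_integral A B E (\<lambda>e. if e = d then (\<lambda>z. twist (s d) (f z)) else step_function n (\<lambda>i j. twist (s e) (m i j)))"
      unfolding t_def g_def step_function_def[abs_def] by (intro arg_cong[where f = "edge_integral A B E"] ext) auto
    also have "\<dots> = hom_density A B E n (\<lambda>e. if e = d then cell_average n (\<lambda>z. twist (s d) (f z)) else (\<lambda>i j. twist (s e) (m i j)))"
      by (rule edge_integral_step_except[OF n fin_A fin_B E_sub d bounded_borel_twist[OF f]])
    also have "(\<lambda>e. if e = d then cell_average n (\<lambda>z. twist (s d) (f z)) else (\<lambda>i j. twist (s e) (m i j)))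
        = (\<lambda>e i j. twist (s e) (m i j))"
      by (intro ext) (auto simp: m_def cell_average_twist[OF f])
    finally show ?thesis by (simp add: twisted_density_def)
  qed
  ultimately have "of_nat (card E) * twisted_density A B E s n (\<lambda>_. m) = 0" by simp
  then show ?thesis using card_E_pos by (simp add: m_def)
qed

lemma star_forest_if_not_norm:
  assumes f: "bounded_borel f" and null: "twisted_integral A B E s f = 0"
    and nz: "\<not> (AE z in lebesgue_on unit_square. f z = 0)"
  shows "\<exists>k. (k = 1 \<or> even k) \<and> 0 < k \<and> (star_forest k A B E \<or> star_forest k B A (E\<inverse>))"
proof -
  obtain n i j where "0 < n" "i < n" "j < n" "cell_average n f i j \<noteq> 0"
    using AE_zero_if_cell_averages_zero[OF f] nz by blast
  then show ?thesis
    using star_forest_if_null[OF _ null_cell_average[OF f null]] by blast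
qed

end

section \<open>Forests of equal stars\<close>

text \<open>Each right vertex \<open>v\<close> has a single neighbour \<open>p v\<close>, so edges
  correspond to leaves and products over \<open>E\<close> become products over
  \<open>B\<close>.\<close>

lemma star_forest_parent:
  assumes "star_forest k A B E" "E \<subseteq> A \<times> B"
  obtains p where "\<And>v. v \<in> B \<Longrightarrow> p v \<in> A" "E = (\<lambda>v. (p v, v)) ` B"
proof -
  have "\<exists>!u. (u, v) \<in> E" if v: "v \<in> B" for v
  proof -
    have "card (E\<inverse> `` {v}) = 1" using assms(1) v by (simp add: star_forest_def)
    then obtain u where "E\<inverse> `` {v} = {u}" by (auto simp: card_1_singleton_iff)
    then show ?thesis by (auto simp: set_eq_iff)
  qed
  then obtain p where p: "\<And>v u. v \<in> B \<Longrightarrow> (u, v) \<in> E \<longleftrightarrow> u = p v" by metis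
  show ?thesis by (rule that[of p]) (use p assms(2) in auto)
qed

lemma star_forest_card:
  assumes "star_forest k A B E" "E \<subseteq> A \<times> B" "finite A" "finite B"
  shows "card E = card A * k"
proof -
  have "E = (SIGMA u:A. E `` {u})" using assms(2) by auto
  moreover have "finite (E `` {u})" for u by (rule finite_subset[OF _ assms(4)]) (use assms(2) in auto)
  ultimately have "card E = (\<Sum>u\<in>A. card (E `` {u}))"
    using assms(3) card_SigmaI[of A "\<lambda>u. E `` {u}"] by simp
  also have "\<dots> = card A * k" using assms(1) by (simp add: star_forest_def)
  finally show ?thesis .
qed

text \<open>The integral over \<open>m\<close> equal stars is an \<open>m\<close>-th power, so the
  root of order \<open>m * k\<close> taken over all edges reduces to the \<open>k\<close>-th root
  for one star.\<close>

lemma power_powr_root: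
  assumes "0 \<le> r" "0 < m" "0 < k"
  shows "(r ^ m) powr (1 / real (m * k)) = r powr (1 / real k)"
proof (cases "r = 0")
  case False
  then have "r ^ m = r powr real m" using assms(1) by (intro powr_realpow[symmetric]) simp
  then have "(r ^ m) powr (1 / real (m * k)) = r powr (real m * (1 / real (m * k)))"
    by (simp only: powr_powr)
  also have "real m * (1 / real (m * k)) = 1 / real k" using assms by simp
  finally show ?thesis .
qed (use assms in simp)

lemma integral_cube_pair_one:
  assumes fin: "finite A" "finite B"
  shows "(LINT p|(cube A \<Otimes>\<^sub>M cube B). 1) = (1 :: 'k::{real_normed_field,euclidean_space})"
proof -
  interpret AB: pair_sigma_finite "cube A" "cube B" by (rule pair_sigma_finite_cube) fact+
  have one: "(LINT x|cube C. 1) = (1 :: 'k)" if "finite C" for C :: "'c set"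
    using unit_intervals.product_integral_prod[OF that, of "\<lambda>_ _. 1 :: 'k"]
      integrable_bounded_borel[OF bounded_measurable_const[of borel "1 :: 'k"]]
    by (simp add: space_unit_interval)
  have "integrable (cube A \<Otimes>\<^sub>M cube B) (\<lambda>_. 1 :: 'k)"
    by (rule integrable_bounded_measurable[OF finite_measure_cube_pair[OF fin] bounded_measurable_const])
  from AB.integral_fst'[OF this] show ?thesis
    by (simp only: one[OF fin(1)] one[OF fin(2)])
qed

lemma integrable_norm_power:
  fixes \<phi> :: "real \<Rightarrow> 'k::euclidean_space"
  assumes \<phi>: "bounded_borel \<phi>"
  shows "integrable unit_interval (\<lambda>x. norm (\<phi> x) ^ k)"
proof -
  obtain K where K: "\<forall>x. norm (\<phi> x) \<le> K" and m: "\<phi> \<in> borel_measurable borel"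
    using \<phi> unfolding bounded_measurable_def by blast
  have "norm (norm (\<phi> x) ^ k) \<le> K ^ k" for x
    using K by (simp add: power_mono)
  moreover have "(\<lambda>x. norm (\<phi> x) ^ k) \<in> borel_measurable borel" using m by measurable
  ultimately show ?thesis
    by (intro integrable_bounded_borel) (auto simp: bounded_measurable_def)
qed

text \<open>Follows from convexity of the \<open>k\<close>-th power. It is first proved with
  positive upper bounds \<open>a\<close> and \<open>b\<close> in place of the two norms, and a slack
  \<open>\<epsilon>\<close> is removed at the end; this avoids dividing by a norm that is 0.\<close>

lemma minkowski_unit_interval:
  fixes \<phi> \<psi> :: "real \<Rightarrow> 'k::{real_normed_field,euclidean_space}"
  assumes k: "0 < k" "even k" and bb: "bounded_borel \<phi>" "bounded_borel \<psi>"
  shows "(LINT x|unit_interval. norm (\<phi> x + \<psi> x) ^ k) powr (1 / real k)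
    \<le> (LINT x|unit_interval. norm (\<phi> x) ^ k) powr (1 / real k)
      + (LINT x|unit_interval. norm (\<psi> x) ^ k) powr (1 / real k)"
proof -
  define I where "I \<phi> = (LINT x|unit_interval. norm (\<phi> x) ^ k)" for \<phi> :: "real \<Rightarrow> 'k"
  have I0: "0 \<le> I \<phi>" for \<phi> unfolding I_def by simp
  note int = integrable_norm_power
  have le: "I (\<lambda>x. \<phi> x + \<psi> x) \<le> (a + b) ^ k"
    if a: "0 < a" "I \<phi> \<le> a ^ k" and b: "0 < b" "I \<psi> \<le> b ^ k" for a b
  proof -
    \<comment> \<open>The sum of the two norms is \<open>a + b\<close> times the convex combination
      of \<open>norm (\<phi> x) / a\<close> and \<open>norm (\<psi> x) / b\<close> with weights
      \<open>a / (a + b)\<close> and \<open>b / (a + b)\<close>.\<close>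
    have pt: "norm (\<phi> x + \<psi> x) ^ k
        \<le> (a + b) ^ k * (a / (a + b) / a ^ k * norm (\<phi> x) ^ k + b / (a + b) / b ^ k * norm (\<psi> x) ^ k)" for x
    proof -
      have "norm (\<phi> x + \<psi> x) \<le> norm (\<phi> x) + norm (\<psi> x)" by (rule norm_triangle_ineq)
      also have "\<dots> = (a + b) * (a / (a + b) * (norm (\<phi> x) / a) + b / (a + b) * (norm (\<psi> x) / b))"
        using a b by (simp add: distrib_left)
      finally have "norm (\<phi> x + \<psi> x) ^ k
          \<le> ((a + b) * (a / (a + b) * (norm (\<phi> x) / a) + b / (a + b) * (norm (\<psi> x) / b))) ^ k"
        by (rule power_mono) simp
      also have "\<dots> = (a + b) ^ k * (a / (a + b) * (norm (\<phi> x) / a) + b / (a + b) * (norm (\<psi> x) / b)) ^ k"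
        by (rule power_mult_distrib)
      also have "\<dots> \<le> (a + b) ^ k * (a / (a + b) * (norm (\<phi> x) / a) ^ k + b / (a + b) * (norm (\<psi> x) / b) ^ k)"
      proof (rule mult_left_mono)
        have one: "1 - b / (a + b) = a / (a + b)" using a b by (simp add: field_simps)
        have "0 \<le> b / (a + b)" "b / (a + b) \<le> 1" using a b by simp_all
        then show "(a / (a + b) * (norm (\<phi> x) / a) + b / (a + b) * (norm (\<psi> x) / b)) ^ k
          \<le> a / (a + b) * (norm (\<phi> x) / a) ^ k + b / (a + b) * (norm (\<psi> x) / b) ^ k"
          using a b convex_onD[OF convex_power_even[OF k(2)], of "b / (a + b)" "norm (\<phi> x) / a" "norm (\<psi> x) / b"]
          unfolding one by simp
      qed (use a b in simp)
      also have "\<dots> = (a + b) ^ k * (a / (a + b) / a ^ k * norm (\<phi> x) ^ k + b / (a + b) / b ^ k * norm (\<psi> x) ^ k)"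
        by (simp add: power_divide)
      finally show ?thesis .
    qed
    have "I (\<lambda>x. \<phi> x + \<psi> x) \<le> (LINT x|unit_interval.
        (a + b) ^ k * (a / (a + b) / a ^ k * norm (\<phi> x) ^ k + b / (a + b) / b ^ k * norm (\<psi> x) ^ k))"
      unfolding I_def
      by (rule integral_mono[OF int[OF bounded_measurable_add[OF bb]] _ pt])
        (rule integrable_mult_right Bochner_Integration.integrable_add int bb)+
    also have "\<dots> = (a + b) ^ k * (a / (a + b) / a ^ k * I \<phi> + b / (a + b) / b ^ k * I \<psi>)"
      unfolding I_def using int[OF bb(1)] int[OF bb(2)] by simp
    also have "\<dots> \<le> (a + b) ^ k * (a / (a + b) / a ^ k * a ^ k + b / (a + b) / b ^ k * b ^ k)"
      using a b by (intro mult_left_mono add_mono) auto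
    also have "\<dots> = (a + b) ^ k * (a / (a + b) + b / (a + b))"
      using a b by simp
    also have "a / (a + b) + b / (a + b) = 1"
      using a b by (simp add: add_divide_distrib[symmetric])
    finally show ?thesis by simp
  qed
  have root: "I \<phi> \<le> a ^ k \<longleftrightarrow> I \<phi> powr (1 / real k) \<le> a" if "0 < a" for a \<phi>
  proof
    assume "I \<phi> \<le> a ^ k"
    then have "I \<phi> powr (1 / real k) \<le> (a ^ k) powr (1 / real k)"
      using I0 by (intro powr_mono2) auto
    also have "\<dots> = a" using power_powr_root[of a k 1] that k by simp
    finally show "I \<phi> powr (1 / real k) \<le> a" .
  next
    assume "I \<phi> powr (1 / real k) \<le> a"
    then have "(I \<phi> powr (1 / real k)) ^ k \<le> a ^ k" by (intro power_mono) auto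
    moreover have "(I \<phi> powr (1 / real k)) ^ k = I \<phi>"
      using k I0[of \<phi>] by (cases "I \<phi> = 0") (auto simp: powr_power)
    ultimately show "I \<phi> \<le> a ^ k" by simp
  qed
  have "I (\<lambda>x. \<phi> x + \<psi> x) powr (1 / real k) \<le> I \<phi> powr (1 / real k) + I \<psi> powr (1 / real k) + \<epsilon>"
    if \<epsilon>: "0 < \<epsilon>" for \<epsilon>
  proof -
    define a where "a = I \<phi> powr (1 / real k) + \<epsilon> / 2"
    define b where "b = I \<psi> powr (1 / real k) + \<epsilon> / 2"
    have ab: "0 < a" "0 < b" using \<epsilon> by (auto simp: a_def b_def add_nonneg_pos)
    have "I \<phi> \<le> a ^ k" "I \<psi> \<le> b ^ k"
      using \<epsilon> by (simp_all only: root[OF ab(1)] root[OF ab(2)]) (simp_all add: a_def b_def)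
    then have "I (\<lambda>x. \<phi> x + \<psi> x) \<le> (a + b) ^ k" using le ab by blast
    then have "I (\<lambda>x. \<phi> x + \<psi> x) powr (1 / real k) \<le> a + b"
      by (subst (asm) root) (use ab in auto)
    then show ?thesis by (simp add: a_def b_def)
  qed
  then show ?thesis unfolding I_def by (rule field_le_epsilon)
qed

context modulus_conjugation
begin

text \<open>Each leaf variable occurs in one edge factor only. Integrating the leaves first replaces
  \<open>f\<close> by its average over the leaf variable, after which the centres separate
  too.\<close>

lemma twisted_integral_star_forest:
  assumes star: "star_forest k A B E" and fin: "finite A" "finite B" and E: "E \<subseteq> A \<times> B"
    and f: "bounded_borel f"
  shows "twisted_integral A B E s f
    = (\<Prod>u\<in>A. LINT x|unit_interval. (\<Prod>v\<in>E `` {u}. twist (s (u, v)) (LINT y|unit_interval. f (x, y))))"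
proof -
  obtain p where p: "\<And>v. v \<in> B \<Longrightarrow> p v \<in> A" "E = (\<lambda>v. (p v, v)) ` B"
    using star_forest_parent[OF star E] by metis
  define g where "g x = (LINT y|unit_interval. f (x, y))" for x
  have g: "bounded_borel g" unfolding g_def by (rule bounded_borel_integral[OF f])
  interpret AB: pair_sigma_finite "cube A" "cube B" by (rule pair_sigma_finite_cube) fact+
  have reindex: "(\<Prod>e\<in>E. F e) = (\<Prod>v\<in>B. F (p v, v))" for F :: "_ \<Rightarrow> 'k"
    unfolding p(2) by (subst prod.reindex) (auto simp: inj_on_def)
  have inner: "(LINT y|cube B. (\<Prod>e\<in>E. twist (s e) (f (x (fst e), y (snd e)))))
      = (\<Prod>u\<in>A. \<Prod>v\<in>E `` {u}. twist (s (u, v)) (g (x u)))" for x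
  proof -
    have "(LINT y|cube B. (\<Prod>e\<in>E. twist (s e) (f (x (fst e), y (snd e)))))
      = (\<Prod>v\<in>B. LINT t|unit_interval. twist (s (p v, v)) (f (x (p v), t)))"
      unfolding reindex fst_conv snd_conv
      by (rule unit_intervals.product_integral_prod[OF fin(2)])
        (rule integrable_bounded_borel[OF bounded_borel_section(2)[OF bounded_borel_twist[OF f]]])
    also have "\<dots> = (\<Prod>v\<in>B. twist (s (p v, v)) (g (x (p v))))"
      unfolding g_def
      by (intro prod.cong refl integral_bounded_linear[OF bounded_linear_twist]
          integrable_bounded_borel bounded_borel_section(2)[OF f])
    also have "\<dots> = (\<Prod>e\<in>E. twist (s e) (g (x (fst e))))" by (simp add: reindex)
    also have "\<dots> = (\<Prod>(u, v)\<in>(SIGMA u:A. E `` {u}). twist (s (u, v)) (g (x u)))"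
    proof -
      have "E = (SIGMA u:A. E `` {u})" using E by auto
      then show ?thesis by (simp add: split_beta)
    qed
    also have "\<dots> = (\<Prod>u\<in>A. \<Prod>v\<in>E `` {u}. twist (s (u, v)) (g (x u)))"
      using fin E by (subst prod.Sigma) (auto intro: finite_subset[of _ B])
    finally show ?thesis .
  qed
  have "twisted_integral A B E s f
      = (LINT x|cube A. (LINT y|cube B. (\<Prod>e\<in>E. twist (s e) (f (x (fst e), y (snd e))))))"
    unfolding twisted_integral_def edge_integral_def
    using AB.integral_fst'[OF edge_product_integrable[where \<Phi> = "\<lambda>e z. twist (s e) (f z)",
          OF fin E bounded_borel_twist[OF f]]]
    by simp
  also have "\<dots> = (\<Prod>u\<in>A. LINT x|unit_interval. (\<Prod>v\<in>E `` {u}. twist (s (u, v)) (g x)))"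
    unfolding inner
    by (rule unit_intervals.product_integral_prod[OF fin(1)])
      (intro integrable_bounded_borel bounded_measurable_prod bounded_measurable_linear[OF bounded_linear_twist] g)
  finally show ?thesis by (simp add: g_def)
qed

lemma star_forest_functional_triangle:
  assumes star: "star_forest k A B E" and fin: "finite A" "finite B" and E: "E \<subseteq> A \<times> B"
    and A: "A \<noteq> {}" and k: "0 < k" "k = 1 \<or> even k"
  shows "\<exists>s. \<forall>f g. bounded_borel f \<longrightarrow> bounded_borel g \<longrightarrow>
    graph_functional A B E s (\<lambda>z. f z + g z) \<le> graph_functional A B E s f + graph_functional A B E s g"
proof -
  define av where "av f x = (LINT y|unit_interval. f (x, y))" for f :: "real \<times> real \<Rightarrow> 'k" and x
  have av: "bounded_borel (av f)" if "bounded_borel f" for f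
    unfolding av_def[abs_def] by (rule bounded_borel_integral[OF that])
  have av_add: "av (\<lambda>z. f z + g z) x = av f x + av g x" if "bounded_borel f" "bounded_borel g" for f g x
    unfolding av_def
    by (intro Bochner_Integration.integral_add integrable_bounded_borel bounded_borel_section(2) that)
  have cardA: "0 < card A" using A fin by (simp add: card_gt_0_iff)
  have cardE: "card E = card A * k" by (rule star_forest_card[OF star E fin])
  have root: "(r ^ card A) powr (1 / real (card E)) = r powr (1 / real k)" if "0 \<le> r" for r
    unfolding cardE by (rule power_powr_root[OF that cardA k(1)])
  show ?thesis
    using k(2)
  proof
    assume k1: "k = 1"
    \<comment> \<open>With one leaf per star nothing has to be balanced: the functional is the
      modulus of a linear expression.\<close>
    define s :: "'a \<times> 'b \<Rightarrow> bool" where "s = (\<lambda>_. True)"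
    have val: "graph_functional A B E s f = norm (LINT x|unit_interval. av f x)" if f: "bounded_borel f" for f
    proof -
      have "twisted_integral A B E s f = (\<Prod>u\<in>A. LINT x|unit_interval. av f x)"
        unfolding twisted_integral_star_forest[OF star fin E f]
        using star k1 by (intro prod.cong refl) (simp add: twist_def s_def star_forest_def av_def)
      then show ?thesis using root k1 by (simp add: graph_functional_def norm_power)
    qed
    have "graph_functional A B E s (\<lambda>z. f z + g z) \<le> graph_functional A B E s f + graph_functional A B E s g"
      if f: "bounded_borel f" and g: "bounded_borel g" for f g
      unfolding val[OF f] val[OF g] val[OF bounded_measurable_add[OF f g]] av_add[OF f g]
      using integrable_bounded_borel[OF av[OF f]] integrable_bounded_borel[OF av[OF g]]
      by (simp add: norm_triangle_ineq)
    then show ?thesis by blast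
  next
    assume "even k"
    then obtain d where d: "k = 2 * d" by auto
    \<comment> \<open>Half of the leaves of each star stay unconjugated and half are conjugated, so
      an average \<open>z\<close> contributes \<open>(z * c z) ^ d\<close>, which is
      \<open>norm z ^ k\<close>.\<close>
    have "\<exists>T. T \<subseteq> E `` {u} \<and> card T = d" if "u \<in> A" for u
    proof -
      have "d \<le> card (E `` {u})" using that star d by (simp add: star_forest_def)
      then show ?thesis by (meson obtain_subset_with_card_n)
    qed
    then obtain T where T: "\<And>u. u \<in> A \<Longrightarrow> T u \<subseteq> E `` {u}" "\<And>u. u \<in> A \<Longrightarrow> card (T u) = d" by metis
    define s where "s e \<longleftrightarrow> snd e \<in> T (fst e)" for e
    have pr: "(\<Prod>v\<in>E `` {u}. twist (s (u, v)) z) = of_real (norm z ^ k)" if u: "u \<in> A" for u z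
    proof -
      have fE: "finite (E `` {u})" using fin E by (auto intro: finite_subset[of _ B])
      have "(\<Prod>v\<in>E `` {u}. twist (s (u, v)) z)
          = (\<Prod>v\<in>E `` {u} - T u. twist (s (u, v)) z) * (\<Prod>v\<in>T u. twist (s (u, v)) z)"
        using fE T(1)[OF u] by (rule prod.subset_diff[rotated])
      also have "(\<Prod>v\<in>E `` {u} - T u. twist (s (u, v)) z) = c z ^ card (E `` {u} - T u)"
        by (simp add: s_def twist_def)
      also have "(\<Prod>v\<in>T u. twist (s (u, v)) z) = z ^ d"
        using T(2)[OF u] by (simp add: s_def twist_def)
      also have "card (E `` {u} - T u) = d"
        using fE T[OF u] star u d by (simp add: card_Diff_subset finite_subset star_forest_def)
      also have "c z ^ d * z ^ d = (z * c z) ^ d" by (simp only: power_mult_distrib mult.commute)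
      finally show ?thesis by (simp add: c_norm_square d power_mult)
    qed
    have val: "graph_functional A B E s f = (LINT x|unit_interval. norm (av f x) ^ k) powr (1 / real k)"
      if f: "bounded_borel f" for f
    proof -
      have int: "integrable unit_interval (\<lambda>x. norm (av f x) ^ k)"
        by (rule integrable_norm_power[OF av[OF f]])
      have "twisted_integral A B E s f = (\<Prod>u\<in>A. LINT x|unit_interval. of_real (norm (av f x) ^ k))"
        unfolding twisted_integral_star_forest[OF star fin E f] av_def[symmetric] by (intro prod.cong refl) (simp only: pr)
      also have "\<dots> = of_real (LINT x|unit_interval. norm (av f x) ^ k) ^ card A"
        by (subst integral_bounded_linear[OF bounded_linear_of_real int]) simp
      finally have "norm (twisted_integral A B E s f) = (LINT x|unit_interval. norm (av f x) ^ k) ^ card A"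
        by (simp add: norm_power)
      then show ?thesis using root[of "LINT x|unit_interval. norm (av f x) ^ k"]
        by (simp add: graph_functional_def)
    qed
    have "graph_functional A B E s (\<lambda>z. f z + g z) \<le> graph_functional A B E s f + graph_functional A B E s g"
      if f: "bounded_borel f" and g: "bounded_borel g" for f g
      unfolding val[OF f] val[OF g] val[OF bounded_measurable_add[OF f g]] av_add[OF f g]
      by (rule minkowski_unit_interval[OF k(1) \<open>even k\<close> av[OF f] av[OF g]])
    then show ?thesis by blast
  qed
qed

text \<open>A sign that depends only on the leaf variable has average 0 over that variable. This
  kills the integral for every \<open>s\<close> at once, although the function has no zeros.\<close>

lemma star_forest_null_function:
  assumes star: "star_forest k A B E" and fin: "finite A" "finite B" and E: "E \<subseteq> A \<times> B"
    and A: "A \<noteq> {}" and k: "0 < k"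
  shows "\<exists>f. bounded_borel f \<and> (\<forall>z. f z \<noteq> 0) \<and> (\<forall>s. twisted_integral A B E s f = 0)"
proof (intro exI conjI allI)
  define f :: "real \<times> real \<Rightarrow> 'k" where
    "f = (\<lambda>z. of_bool (cell 2 (snd z) = 0) + (- 1) * of_bool (cell 2 (snd z) = 1))"
  show f: "bounded_borel f"
    unfolding f_def
    by (intro bounded_measurable_add bounded_measurable_mult bounded_measurable_const
        bounded_measurable_compose[OF bounded_borel_cell] borel_measurable_continuous_onI continuous_intros)
  show "f z \<noteq> 0" for z
    using cell_less[of 2 "snd z"] by (auto simp: f_def less_2_cases_iff)
  have av: "(LINT y|unit_interval. f (x, y)) = 0" for x
  proof -
    have "integrable unit_interval (\<lambda>y. of_bool (cell 2 y = i) :: 'k)" for i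
      by (rule integrable_bounded_borel[OF bounded_borel_cell])
    then show ?thesis by (simp add: f_def integral_cell)
  qed
  show "twisted_integral A B E s f = 0" for s
  proof -
    obtain u where u: "u \<in> A" using A by auto
    have "E `` {u} \<noteq> {}" "finite (E `` {u})"
      using star u k fin E by (auto simp: star_forest_def intro: finite_subset[of _ B])
    then have "(\<Prod>v\<in>E `` {u}. twist (s (u, v)) 0) = 0" by (auto intro: prod_zero)
    then show ?thesis
      unfolding twisted_integral_star_forest[OF star fin E f] av using u fin by (intro prod_zero) auto
  qed
qed

lemma twisted_integral_converse:
  assumes "finite A" "finite B" "E \<subseteq> A \<times> B" "bounded_borel f"
  shows "twisted_integral B A (E\<inverse>) (s \<circ> prod.swap) (f \<circ> prod.swap) = twisted_integral A B E s f"
  unfolding twisted_integral_def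
  using edge_integral_converse[of A B E "\<lambda>e z. twist (s e) (f z)"] assms(1-3) bounded_borel_twist[OF assms(4)]
  by simp

lemma bounded_borel_swap: "bounded_borel f \<Longrightarrow> bounded_borel (f \<circ> prod.swap :: real \<times> real \<Rightarrow> 'k)"
  unfolding comp_def prod.swap_def
  by (erule bounded_measurable_compose) (intro borel_measurable_continuous_onI continuous_intros)

end

section \<open>Star forests as copies of complete bipartite graphs\<close>

definition converse_graph :: "('a, 'b) bigraph \<Rightarrow> ('b, 'a) bigraph" where
  "converse_graph H = \<lparr>lverts = rverts H, rverts = lverts H, edges = (edges H)\<inverse>\<rparr>"

lemma converse_graph_simps [simp]:
  "lverts (converse_graph H) = rverts H" "rverts (converse_graph H) = lverts H"
  "edges (converse_graph H) = (edges H)\<inverse>" "converse_graph (converse_graph H) = H"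
  by (simp_all add: converse_graph_def)

lemma bipartite_converse_graph: "bipartite_graph H \<Longrightarrow> bipartite_graph (converse_graph H)"
  by (auto simp: bipartite_graph_def)

lemma isomorphic_converse_graph: "isomorphic G H \<Longrightarrow> isomorphic (converse_graph G) (converse_graph H)"
  unfolding isomorphic_def by (simp, blast)

lemma converse_copies_complete_bipartite:
  "converse_graph (copies m (complete_bipartite a b)) = copies m (complete_bipartite b a)"
  by (auto simp: converse_graph_def copies_def complete_bipartite_def)

lemma isomorphic_copies_converse:
  "isomorphic H (copies m (complete_bipartite a b))
   \<longleftrightarrow> isomorphic (converse_graph H) (copies m (complete_bipartite b a))"
  using isomorphic_converse_graph[of H "copies m (complete_bipartite a b)"]
    isomorphic_converse_graph[of "converse_graph H" "copies m (complete_bipartite b a)"]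
  by (auto simp: converse_copies_complete_bipartite)

lemma edges_copies_star:
  "((i, u), (j, v)) \<in> edges (copies m (complete_bipartite 1 k)) \<longleftrightarrow> i = j \<and> i < m \<and> u = 0 \<and> v < k"
  by (auto simp: copies_def complete_bipartite_def)

text \<open>\<open>h\<close> numbers the centres and \<open>\<beta> u\<close> the leaves at
  \<open>u\<close>; a leaf is sent to the number of its centre paired with its own number
  there.\<close>

lemma star_forest_isomorphic:
  assumes H: "bipartite_graph H" and star: "star_forest k (lverts H) (rverts H) (edges H)"
  shows "isomorphic H (copies (card (lverts H)) (complete_bipartite 1 k))"
proof -
  let ?A = "lverts H" and ?B = "rverts H" and ?E = "edges H"
  have fin: "finite ?A" "finite ?B" and E: "?E \<subseteq> ?A \<times> ?B"
    using H by (auto simp: bipartite_graph_def)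
  obtain p where p: "\<And>v. v \<in> ?B \<Longrightarrow> p v \<in> ?A" "?E = (\<lambda>v. (p v, v)) ` ?B"
    using star_forest_parent[OF star E] by metis
  obtain h where h: "bij_betw h ?A {..<card ?A}"
    using ex_bij_betw_finite_nat[OF fin(1)] by (auto simp: atLeast0LessThan)
  have "\<exists>\<beta>. bij_betw \<beta> (?E `` {u}) {..<k}" if "u \<in> ?A" for u
  proof -
    have "finite (?E `` {u})" by (rule finite_subset[OF _ fin(2)]) (use E in auto)
    moreover have "card (?E `` {u}) = k" using star that by (simp add: star_forest_def)
    ultimately show ?thesis using ex_bij_betw_finite_nat by (metis atLeast0LessThan)
  qed
  then obtain \<beta> where \<beta>: "\<And>u. u \<in> ?A \<Longrightarrow> bij_betw (\<beta> u) (?E `` {u}) {..<k}" by metis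
  have hp: "h u = h (p v) \<longleftrightarrow> u = p v" if "u \<in> ?A" "v \<in> ?B" for u v
    using bij_betw_imp_inj_on[OF h] that p(1) by (auto simp: inj_on_def)
  have nb: "v \<in> ?E `` {p v}" if "v \<in> ?B" for v using that p(2) by auto
  have h_lt: "h u < card ?A" if "u \<in> ?A" for u using bij_betwE[OF h] that by auto
  have \<beta>_lt: "\<beta> (p v) v < k" if "v \<in> ?B" for v using bij_betwE[OF \<beta>[OF p(1)[OF that]]] nb[OF that] by auto
  show ?thesis
    unfolding isomorphic_def
  proof (intro exI conjI ballI)
    show "bij_betw (\<lambda>u. (h u, 0 :: nat)) ?A (lverts (copies (card ?A) (complete_bipartite 1 k)))"
      using h by (auto simp: bij_betw_def inj_on_def copies_def complete_bipartite_def)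
    show "bij_betw (\<lambda>v. (h (p v), \<beta> (p v) v)) ?B (rverts (copies (card ?A) (complete_bipartite 1 k)))"
      unfolding bij_betw_def
    proof (intro conjI inj_onI equalityI subsetI)
      fix v w assume vw: "v \<in> ?B" "w \<in> ?B" and eq: "(h (p v), \<beta> (p v) v) = (h (p w), \<beta> (p w) w)"
      then have "p v = p w" using hp[OF p(1)[OF vw(1)] vw(2)] by simp
      then show "v = w"
        using eq nb vw bij_betw_imp_inj_on[OF \<beta>[OF p(1)[OF vw(1)]]] by (metis inj_onD snd_conv)
    next
      fix q assume "q \<in> (\<lambda>v. (h (p v), \<beta> (p v) v)) ` ?B"
      then show "q \<in> rverts (copies (card ?A) (complete_bipartite 1 k))"
        using h_lt \<beta>_lt p(1) by (auto simp: copies_def complete_bipartite_def)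
    next
      fix q assume "q \<in> rverts (copies (card ?A) (complete_bipartite 1 k))"
      then obtain i j where q: "q = (i, j)" "i < card ?A" "j < k"
        by (auto simp: copies_def complete_bipartite_def)
      obtain u where u: "u \<in> ?A" "h u = i" using h q(2) by (metis bij_betw_iff_bijections lessThan_iff)
      obtain v where v: "v \<in> ?E `` {u}" "\<beta> u v = j" using \<beta>[OF u(1)] q(3) by (metis bij_betw_iff_bijections lessThan_iff)
      have "p v = u" "v \<in> ?B" using v(1) p(2) by auto
      then show "q \<in> (\<lambda>v. (h (p v), \<beta> (p v) v)) ` ?B" using q u v by auto
    qed
    fix u v assume u: "u \<in> ?A" and v: "v \<in> ?B"
    show "(u, v) \<in> ?E \<longleftrightarrow> ((h u, 0), (h (p v), \<beta> (p v) v)) \<in> edges (copies (card ?A) (complete_bipartite 1 k))"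
      unfolding edges_copies_star using hp[OF u v] h_lt[OF u] \<beta>_lt[OF v] v p(2) by auto
  qed
qed

lemma isomorphic_star_forest:
  assumes H: "bipartite_graph H" and iso: "isomorphic H (copies m (complete_bipartite 1 k))"
  shows "star_forest k (lverts H) (rverts H) (edges H) \<and> card (lverts H) = m"
proof -
  let ?A = "lverts H" and ?B = "rverts H" and ?E = "edges H"
  have E: "?E \<subseteq> ?A \<times> ?B" using H by (auto simp: bipartite_graph_def)
  obtain \<phi> \<psi> where raw: "bij_betw \<phi> ?A (lverts (copies m (complete_bipartite 1 k)))"
      "bij_betw \<psi> ?B (rverts (copies m (complete_bipartite 1 k)))"
      "\<And>u v. u \<in> ?A \<Longrightarrow> v \<in> ?B \<Longrightarrow> (u, v) \<in> ?E \<longleftrightarrow> (\<phi> u, \<psi> v) \<in> edges (copies m (complete_bipartite 1 k))"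
    using iso unfolding isomorphic_def by blast
  have \<phi>: "bij_betw \<phi> ?A ({..<m} \<times> {..<1::nat})" and \<psi>: "bij_betw \<psi> ?B ({..<m} \<times> {..<k})"
    using raw(1,2) by (simp_all only: copies_def complete_bipartite_def bigraph.simps)
  have \<phi>_mem: "fst (\<phi> u) < m \<and> snd (\<phi> u) = 0" if "u \<in> ?A" for u
    using bij_betwE[OF \<phi>] that by (auto simp: mem_Times_iff)
  have \<psi>_mem: "fst (\<psi> v) < m \<and> snd (\<psi> v) < k" if "v \<in> ?B" for v
    using bij_betwE[OF \<psi>] that by (auto simp: mem_Times_iff)
  \<comment> \<open>Within a copy the only centre is joined to all leaves, so adjacency means equal
    copy numbers.\<close>
  have e': "(u, v) \<in> ?E \<longleftrightarrow> fst (\<phi> u) = fst (\<psi> v)" if uv: "u \<in> ?A" "v \<in> ?B" for u v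
  proof -
    obtain i where i: "\<phi> u = (i, 0)" "i < m" using \<phi>_mem[OF uv(1)] by (metis prod.collapse)
    obtain j l where j: "\<psi> v = (j, l)" "l < k" using \<psi>_mem[OF uv(2)] by (metis prod.collapse)
    show ?thesis unfolding raw(3)[OF uv] i(1) j(1) edges_copies_star using i(2) j(2) by auto
  qed
  have "card (?E `` {u}) = k" if u: "u \<in> ?A" for u
  proof -
    have "\<psi> ` (?E `` {u}) = {fst (\<phi> u)} \<times> {..<k}"
    proof (intro equalityI subsetI)
      fix q assume "q \<in> \<psi> ` (?E `` {u})"
      then obtain v where v: "(u, v) \<in> ?E" "q = \<psi> v" by auto
      then have "v \<in> ?B" using E by auto
      then show "q \<in> {fst (\<phi> u)} \<times> {..<k}"
        using e'[OF u, of v] \<psi>_mem[of v] v by (simp add: mem_Times_iff)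
    next
      fix q assume q: "q \<in> {fst (\<phi> u)} \<times> {..<k}"
      then have "q \<in> {..<m} \<times> {..<k}" using \<phi>_mem[OF u] by (auto simp: mem_Times_iff)
      then obtain v where "v \<in> ?B" "\<psi> v = q" using \<psi> by (metis bij_betw_iff_bijections)
      then show "q \<in> \<psi> ` (?E `` {u})" using e'[OF u] q by (auto simp: mem_Times_iff)
    qed
    moreover have "inj_on \<psi> (?E `` {u})"
      by (rule inj_on_subset[OF bij_betw_imp_inj_on[OF \<psi>]]) (use E in auto)
    ultimately have "card (?E `` {u}) = card ({fst (\<phi> u)} \<times> {..<k})" by (metis card_image)
    then show ?thesis by simp
  qed
  moreover have "card (?E\<inverse> `` {v}) = 1" if v: "v \<in> ?B" for v
  proof -
    have "(fst (\<psi> v), 0) \<in> {..<m} \<times> {..<1::nat}" using \<psi>_mem[OF v] by auto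
    then obtain u where u: "u \<in> ?A" "\<phi> u = (fst (\<psi> v), 0)" using \<phi> by (metis bij_betw_iff_bijections)
    have "w = u" if "w \<in> ?A" "fst (\<phi> w) = fst (\<psi> v)" for w
    proof -
      have "\<phi> w = \<phi> u" using that u \<phi>_mem by (simp add: prod_eq_iff)
      then show ?thesis using bij_betw_imp_inj_on[OF \<phi>] that(1) u(1) by (auto simp: inj_on_def)
    qed
    then have "w \<in> ?E\<inverse> `` {v} \<longleftrightarrow> w = u" for w
      using u e'[OF _ v] E by (metis Image_singleton_iff SigmaD1 converse_iff fst_conv subsetD)
    then have "?E\<inverse> `` {v} = {u}" by blast
    then show ?thesis by simp
  qed
  moreover have "card ?A = m" using bij_betw_same_card[OF \<phi>] by simp
  ultimately show ?thesis by (simp add: star_forest_def)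
qed

text \<open>The edge set is required to be nonempty because the empty graph satisfies
  \<open>star_forest\<close> for every \<open>k\<close>; it would correspond to
  \<open>m = 0\<close>.\<close>

definition one_or_even_star_forest :: "('a, 'b) bigraph \<Rightarrow> bool" where
  "one_or_even_star_forest H \<longleftrightarrow> edges H \<noteq> {} \<and> (\<exists>k. (k = 1 \<or> even k) \<and> 0 < k \<and>
     (star_forest k (lverts H) (rverts H) (edges H) \<or> star_forest k (rverts H) (lverts H) ((edges H)\<inverse>)))"

lemma one_or_even_star_forestE:
  assumes "one_or_even_star_forest H"
  obtains k where "edges H \<noteq> {}" "k = 1 \<or> even k" "0 < k"
    "star_forest k (lverts H) (rverts H) (edges H) \<or> star_forest k (rverts H) (lverts H) ((edges H)\<inverse>)"
  using assms unfolding one_or_even_star_forest_def by (elim exE conjE)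

lemma one_or_even_star_forestI:
  assumes "edges H \<noteq> {}" "k = 1 \<or> even k" "0 < k"
    "star_forest k (lverts H) (rverts H) (edges H) \<or> star_forest k (rverts H) (lverts H) ((edges H)\<inverse>)"
  shows "one_or_even_star_forest H"
  unfolding one_or_even_star_forest_def by (intro conjI exI[of _ k]) fact+

lemma one_or_even_star_forest_isomorphic:
  assumes H: "bipartite_graph H" and forest: "one_or_even_star_forest H"
  obtains m k where "0 < m" "0 < k" "k = 1 \<or> even k"
    "isomorphic H (copies m (complete_bipartite 1 k)) \<or> isomorphic H (copies m (complete_bipartite k 1))"
proof -
  have Hc: "bipartite_graph (converse_graph H)" using H by (rule bipartite_converse_graph)
  have fin: "finite (lverts H)" "finite (rverts H)" and E: "edges H \<subseteq> lverts H \<times> rverts H"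
    using H by (auto simp: bipartite_graph_def)
  obtain k where ne: "edges H \<noteq> {}" and k: "k = 1 \<or> even k" "0 < k"
    and star: "star_forest k (lverts H) (rverts H) (edges H) \<or> star_forest k (rverts H) (lverts H) ((edges H)\<inverse>)"
    using forest by (rule one_or_even_star_forestE)
  have m: "0 < card (lverts H)" "0 < card (rverts H)" 
  proof -
    obtain u v where "(u, v) \<in> edges H" using ne by (metis ex_in_conv surj_pair)
    then have "u \<in> lverts H" "v \<in> rverts H" using E by auto
    then show "0 < card (lverts H)" "0 < card (rverts H)"
      using fin by (metis card_gt_0_iff empty_iff)+
  qed
  from star show thesis
  proof
    assume "star_forest k (lverts H) (rverts H) (edges H)"
    from that[OF m(1) k(2,1) disjI1, OF star_forest_isomorphic[OF H this]] show thesis .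
  next
    assume "star_forest k (rverts H) (lverts H) ((edges H)\<inverse>)"
    then have "isomorphic (converse_graph H) (copies (card (rverts H)) (complete_bipartite 1 k))"
      using star_forest_isomorphic[OF Hc, of k] unfolding converse_graph_simps by blast
    from that[OF m(2) k(2,1) disjI2, OF isomorphic_copies_converse[THEN iffD2, OF this]] show thesis .
  qed
qed

lemma isomorphic_one_or_even_star_forest:
  assumes H: "bipartite_graph H" and m: "0 < m" and k: "0 < k" "k = 1 \<or> even k"
    and iso: "isomorphic H (copies m (complete_bipartite 1 k)) \<or> isomorphic H (copies m (complete_bipartite k 1))"
  shows "one_or_even_star_forest H"
proof -
  have Hc: "bipartite_graph (converse_graph H)" using H by (rule bipartite_converse_graph)
  have fin: "finite (lverts H)" "finite (rverts H)" and E: "edges H \<subseteq> lverts H \<times> rverts H"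
    and Ec: "(edges H)\<inverse> \<subseteq> rverts H \<times> lverts H"
    using H by (auto simp: bipartite_graph_def)
  have mk: "m * k \<noteq> 0" using m k(1) by simp
  from iso show ?thesis
  proof
    assume "isomorphic H (copies m (complete_bipartite 1 k))"
    from isomorphic_star_forest[OF H this]
    have star: "star_forest k (lverts H) (rverts H) (edges H)" "card (lverts H) = m" by blast+
    then have "edges H \<noteq> {}" using mk star_forest_card[OF star(1) E fin] by (metis card.empty)
    then show ?thesis using k(2,1) by (rule one_or_even_star_forestI) (rule disjI1[OF star(1)])
  next
    assume "isomorphic H (copies m (complete_bipartite k 1))"
    then have "isomorphic (converse_graph H) (copies m (complete_bipartite 1 k))"
      by (rule isomorphic_copies_converse[THEN iffD1])
    from isomorphic_star_forest[OF Hc this]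
    have star: "star_forest k (rverts H) (lverts H) ((edges H)\<inverse>)" "card (rverts H) = m"
      by (simp_all only: converse_graph_simps)
    then have "(edges H)\<inverse> \<noteq> {}" using mk star_forest_card[OF star(1) Ec fin(2,1)] by (metis card.empty)
    then have "edges H \<noteq> {}" by blast
    then show ?thesis using k(2,1) by (rule one_or_even_star_forestI) (rule disjI2[OF star(1)])
  qed
qed

lemma one_or_even_star_forest_iff:
  assumes H: "bipartite_graph H"
  shows "one_or_even_star_forest H \<longleftrightarrow> (\<exists>m d :: nat. 0 < m \<and> 0 < d \<and>
                  (isomorphic H (copies m (complete_bipartite 1 1)) \<or>
                   isomorphic H (copies m (complete_bipartite 1 (2 * d))) \<or>
                   isomorphic H (copies m (complete_bipartite (2 * d) 1))))" (is "_ \<longleftrightarrow> ?R")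
proof
  assume "one_or_even_star_forest H"
  then obtain m k where m: "0 < m" and k: "0 < k" "k = 1 \<or> even k"
    and iso: "isomorphic H (copies m (complete_bipartite 1 k)) \<or> isomorphic H (copies m (complete_bipartite k 1))"
    by (rule one_or_even_star_forest_isomorphic[OF H])
  from k(2) show ?R
  proof
    assume "k = 1"
    then have "isomorphic H (copies m (complete_bipartite 1 1))" using iso by blast
    \<comment> \<open>The case of single edges puts no condition on \<open>d\<close>, and 1 is
      supplied.\<close>
    then show ?R using m zero_less_one by blast
  next
    assume "even k"
    then obtain d where d: "k = 2 * d" by (rule evenE)
    then have "0 < d" using k(1) by simp
    then show ?R using m iso unfolding d by blast
  qed
next
  assume ?R
  then obtain m d where m: "0 < m" and d: "0 < d" and "isomorphic H (copies m (complete_bipartite 1 1)) \<or>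
      isomorphic H (copies m (complete_bipartite 1 (2 * d))) \<or>
      isomorphic H (copies m (complete_bipartite (2 * d) 1))" by blast
  moreover have "one_or_even_star_forest H" if "isomorphic H (copies m (complete_bipartite 1 1))"
    by (rule isomorphic_one_or_even_star_forest[OF H m, of 1]) (use that in simp_all)
  moreover have "one_or_even_star_forest H" if "isomorphic H (copies m (complete_bipartite 1 (2 * d)))
      \<or> isomorphic H (copies m (complete_bipartite (2 * d) 1))"
    by (rule isomorphic_one_or_even_star_forest[OF H m _ _ that]) (use d in simp_all)
  ultimately show "one_or_even_star_forest H" by argo
qed

section \<open>Functionals on bounded measurable functions\<close>

context modulus_conjugation
begin

text \<open>The common form of \<open>t_real\<close> and \<open>t_complex\<close> over the completed
  cube; \<open>twisted_integral\<close> is its counterpart for Borel functions on the uncompleted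
  product.\<close>

definition graph_integral :: "('a, 'b) bigraph \<Rightarrow> ('a \<times> 'b \<Rightarrow> bool) \<Rightarrow> (real \<times> real \<Rightarrow> 'k) \<Rightarrow> 'k" where
  "graph_integral H s f =
     (LINT p|cube_measure H. (\<Prod>e\<in>edges H. twist (s e) (f (fst p (fst e), snd p (snd e)))))"

definition graph_root :: "('a, 'b) bigraph \<Rightarrow> ('a \<times> 'b \<Rightarrow> bool) \<Rightarrow> (real \<times> real \<Rightarrow> 'k) \<Rightarrow> real" where
  "graph_root H s f = norm (graph_integral H s f) powr (1 / real (card (edges H)))"

lemma graph_root_borel_version:
  assumes H: "bipartite_graph H" and f: "bounded_borel f'" "AE z in lebesgue_on unit_square. f z = f' z"
  shows "graph_root H s f = graph_functional (lverts H) (rverts H) (edges H) s f'"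
proof -
  have "graph_integral H s f = twisted_integral (lverts H) (rverts H) (edges H) s f'"
    unfolding graph_integral_def twisted_integral_def
    by (rule cube_measure_integral[where \<Phi> = "\<lambda>e z. twist (s e) (f z)", OF H _ bounded_borel_twist[OF f(1)]])
      (rule eventually_mono[OF f(2)], simp)
  then show ?thesis by (simp add: graph_root_def graph_functional_def)
qed

lemma graph_root_borel:
  assumes "bipartite_graph H" "bounded_borel f"
  shows "graph_root H s f = graph_functional (lverts H) (rverts H) (edges H) s f"
  by (rule graph_root_borel_version[OF assms]) simp

text \<open>With at least one edge, homogeneity is automatic and Borel versions carry the triangle
  inequality to all of \<open>bdd_meas\<close>. Without edges the functional takes the value 1 at
  the zero function, against homogeneity.\<close>

lemma seminorm_graph_root_iff:
  assumes H: "bipartite_graph H"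
  shows "seminorm_on bdd_meas (graph_root H s) \<longleftrightarrow> edges H \<noteq> {} \<and>
    (\<forall>f g. bounded_borel f \<longrightarrow> bounded_borel g \<longrightarrow>
      graph_functional (lverts H) (rverts H) (edges H) s (\<lambda>z. f z + g z)
      \<le> graph_functional (lverts H) (rverts H) (edges H) s f + graph_functional (lverts H) (rverts H) (edges H) s g)"
  (is "?L \<longleftrightarrow> ?ne \<and> ?tri")
proof (intro iffI conjI)
  assume L: ?L
  show ?ne
  proof
    assume E: "edges H = {}"
    have "bounded_borel (\<lambda>_. 0 :: 'k)" by (rule bounded_measurable_const)
    then have mem: "(\<lambda>_. 0 :: 'k) \<in> bdd_meas" by (rule bounded_borel_bdd_meas)
    have "\<forall>c. \<forall>f\<in>bdd_meas. graph_root H s (\<lambda>z. c * f z) = norm c * graph_root H s f"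
      using L unfolding seminorm_on_def by (elim conjE)
    from this[THEN spec, THEN bspec, OF mem, of 0]
    have "graph_root H s (\<lambda>z. 0) = 0" by simp
    \<comment> \<open>The empty product integrates to 1, and the exponent \<open>1 / 0\<close> is 0,
      so the value is \<open>1 powr 0\<close>.\<close>
    moreover have "graph_root H s (\<lambda>_. 0) = 1"
      using H integral_cube_pair_one[where 'k = 'k, of "lverts H" "rverts H"]
      by (simp add: graph_root_borel[OF H bounded_measurable_const] graph_functional_def
          twisted_integral_def edge_integral_def E bipartite_graph_def)
    ultimately show False by simp
  qed
  show ?tri
  proof (intro allI impI)
    fix f g :: "real \<times> real \<Rightarrow> 'k" assume fg: "bounded_borel f" "bounded_borel g"
    have "\<forall>f\<in>bdd_meas. \<forall>g\<in>bdd_meas. graph_root H s (\<lambda>z. f z + g z) \<le> graph_root H s f + graph_root H s g"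
      using L unfolding seminorm_on_def by (elim conjE)
    from this[rule_format, OF fg[THEN bounded_borel_bdd_meas]]
    show "graph_functional (lverts H) (rverts H) (edges H) s (\<lambda>z. f z + g z)
      \<le> graph_functional (lverts H) (rverts H) (edges H) s f + graph_functional (lverts H) (rverts H) (edges H) s g"
      unfolding graph_root_borel[OF H fg(1)] graph_root_borel[OF H fg(2)]
        graph_root_borel[OF H bounded_measurable_add[OF fg]] .
  qed
next
  assume R: "?ne \<and> ?tri"
  have "finite (edges H)"
    using H finite_subset unfolding bipartite_graph_def by (metis finite_SigmaI)
  then have cE: "0 < card (edges H)" using R by (simp add: card_gt_0_iff)
  show ?L
    unfolding seminorm_on_def
  proof (intro conjI ballI allI)
    show "0 \<le> graph_root H s f" for f by (simp add: graph_root_def)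
    show "graph_root H s (\<lambda>z. a * f z) = norm a * graph_root H s f" for a f
    proof -
      have "graph_integral H s (\<lambda>z. a * f z) = (\<Prod>e\<in>edges H. twist (s e) a) * graph_integral H s f"
        unfolding graph_integral_def twist_mult prod.distrib by simp
      then have "norm (graph_integral H s (\<lambda>z. a * f z)) = norm a ^ card (edges H) * norm (graph_integral H s f)"
        by (simp add: norm_mult prod_norm[symmetric])
      then show ?thesis
        unfolding graph_root_def using cE
        using power_powr_root[of "norm a" "card (edges H)" 1] by (simp add: powr_mult)
    qed
    fix f g :: "real \<times> real \<Rightarrow> 'k" assume f: "f \<in> bdd_meas" and g: "g \<in> bdd_meas"
    obtain f' where f': "bounded_borel f'" "AE z in lebesgue_on unit_square. f z = f' z"
      by (rule bdd_meas_borel_version[OF f])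
    obtain g' where g': "bounded_borel g'" "AE z in lebesgue_on unit_square. g z = g' z"
      by (rule bdd_meas_borel_version[OF g])
    have fg: "AE z in lebesgue_on unit_square. f z + g z = f' z + g' z"
      using f'(2) g'(2) by eventually_elim simp
    show "graph_root H s (\<lambda>z. f z + g z) \<le> graph_root H s f + graph_root H s g"
      unfolding graph_root_borel_version[OF H f'] graph_root_borel_version[OF H g']
        graph_root_borel_version[OF H bounded_measurable_add[OF f'(1) g'(1)] fg]
      by (rule R[THEN conjunct2, rule_format, OF f'(1) g'(1)])
  qed
qed

theorem star_forest_if_seminorm_not_norm:
  assumes H: "bipartite_graph H" "no_isolated_vertices H"
    and semi: "seminorm_on bdd_meas (graph_root H s)" and not_norm: "\<not> norm_mod_ae (graph_root H s)"
  shows "one_or_even_star_forest H"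
proof -
  note semi_iff = seminorm_graph_root_iff[OF H(1), THEN iffD1, OF semi]
  have ne: "edges H \<noteq> {}" using semi_iff by (rule conjunct1)
  interpret graph_seminorm c "lverts H" "rverts H" "edges H" s
  proof
    show "finite (lverts H)" "finite (rverts H)" "edges H \<subseteq> lverts H \<times> rverts H"
      using H(1) by (simp_all add: bipartite_graph_def)
    show "edges H `` {u} \<noteq> {}" if "u \<in> lverts H" for u
      using H(2) that unfolding no_isolated_vertices_def by auto
    show "(edges H)\<inverse> `` {v} \<noteq> {}" if "v \<in> rverts H" for v
      using H(2) that unfolding no_isolated_vertices_def by auto
  qed (rule ne, rule semi_iff[THEN conjunct2, rule_format])
  have "\<exists>f\<in>bdd_meas. graph_root H s f = 0 \<and> \<not> ae_zero f"
    using semi not_norm unfolding norm_mod_ae_def by simp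
  then obtain f where f: "f \<in> bdd_meas" "graph_root H s f = 0" "\<not> ae_zero f"
    by (elim bexE conjE)
  obtain f' where f': "bounded_borel f'" "AE z in lebesgue_on unit_square. f z = f' z"
    by (rule bdd_meas_borel_version[OF f(1)])
  have "twisted_integral (lverts H) (rverts H) (edges H) s f' = 0"
    using f(2) graph_root_borel_version[OF H(1) f'] by (simp add: graph_functional_def)
  moreover have "\<not> (AE z in lebesgue_on unit_square. f' z = 0)"
  proof
    assume "AE z in lebesgue_on unit_square. f' z = 0"
    with f'(2) have "AE z in lebesgue_on unit_square. f z = 0" by eventually_elim simp
    then show False using f(3) by (simp add: ae_zero_def)
  qed
  ultimately show ?thesis
    using star_forest_if_not_norm[OF f'(1)] ne unfolding one_or_even_star_forest_def by (intro conjI)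
qed

text \<open>Failure to be a norm is shown for every \<open>s\<close>, since norming could be
  witnessed by another \<open>s\<close> than the one that gives a seminorm.\<close>

theorem star_forest_seminorm_not_norm:
  assumes H: "bipartite_graph H" and star: "one_or_even_star_forest H"
  shows "(\<exists>s. seminorm_on bdd_meas (graph_root H s)) \<and> (\<forall>s. \<not> norm_mod_ae (graph_root H s))"
proof -
  let ?A = "lverts H" and ?B = "rverts H" and ?E = "edges H"
  have fin: "finite ?A" "finite ?B" and E: "?E \<subseteq> ?A \<times> ?B" and Ec: "?E\<inverse> \<subseteq> ?B \<times> ?A"
    using H by (auto simp: bipartite_graph_def)
  obtain k where ne: "?E \<noteq> {}" and k: "0 < k" "k = 1 \<or> even k"
    and star: "star_forest k ?A ?B ?E \<or> star_forest k ?B ?A (?E\<inverse>)"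
    using star by (rule one_or_even_star_forestE)
  have AB: "?A \<noteq> {}" "?B \<noteq> {}" using ne E by auto
  have conv: "graph_functional ?B ?A (?E\<inverse>) (s \<circ> prod.swap) (f \<circ> prod.swap) = graph_functional ?A ?B ?E s f"
    if "bounded_borel f" for s f
    using twisted_integral_converse[OF fin E that] by (simp add: graph_functional_def)
  have "\<exists>s. \<forall>f g. bounded_borel f \<longrightarrow> bounded_borel g \<longrightarrow>
      graph_functional ?A ?B ?E s (\<lambda>z. f z + g z) \<le> graph_functional ?A ?B ?E s f + graph_functional ?A ?B ?E s g"
    using star
  proof
    assume "star_forest k ?A ?B ?E"
    from star_forest_functional_triangle[OF this fin E AB(1) k] show ?thesis .
  next
    assume "star_forest k ?B ?A (?E\<inverse>)"
    from star_forest_functional_triangle[OF this fin(2,1) Ec AB(2) k]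
    obtain s where s: "\<And>f g. bounded_borel f \<Longrightarrow> bounded_borel g \<Longrightarrow>
      graph_functional ?B ?A (?E\<inverse>) s (\<lambda>z. f z + g z)
      \<le> graph_functional ?B ?A (?E\<inverse>) s f + graph_functional ?B ?A (?E\<inverse>) s g" by blast
    have swap: "(s \<circ> prod.swap) \<circ> prod.swap = s" by (simp add: fun_eq_iff)
    have "graph_functional ?A ?B ?E (s \<circ> prod.swap) (\<lambda>z. f z + g z)
      \<le> graph_functional ?A ?B ?E (s \<circ> prod.swap) f + graph_functional ?A ?B ?E (s \<circ> prod.swap) g"
      if f: "bounded_borel f" and g: "bounded_borel g" for f g
    proof -
      have "(\<lambda>z. f z + g z) \<circ> prod.swap = (\<lambda>z. (f \<circ> prod.swap) z + (g \<circ> prod.swap) z)" by auto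
      then show ?thesis
        using s[OF bounded_borel_swap[OF f] bounded_borel_swap[OF g]]
          conv[OF f, of "s \<circ> prod.swap"] conv[OF g, of "s \<circ> prod.swap"]
          conv[OF bounded_measurable_add[OF f g], of "s \<circ> prod.swap"]
        unfolding swap by simp
    qed
    then show ?thesis by blast
  qed
  moreover have "\<exists>f. bounded_borel f \<and> (\<forall>z. f z \<noteq> 0) \<and> (\<forall>s. twisted_integral ?A ?B ?E s f = 0)"
    using star
  proof
    assume "star_forest k ?A ?B ?E"
    from star_forest_null_function[OF this fin E AB(1) k(1)] show ?thesis .
  next
    assume "star_forest k ?B ?A (?E\<inverse>)"
    from star_forest_null_function[OF this fin(2,1) Ec AB(2) k(1)]
    obtain f where f: "bounded_borel f" "\<And>z. f z \<noteq> 0" "\<And>s. twisted_integral ?B ?A (?E\<inverse>) s f = 0" by blast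
    have "twisted_integral ?A ?B ?E s (f \<circ> prod.swap) = 0" for s
      using twisted_integral_converse[OF fin E bounded_borel_swap[OF f(1)], of s] f(3)[of "s \<circ> prod.swap"]
      by (simp add: comp_assoc)
    then show ?thesis using bounded_borel_swap[OF f(1)] f(2) by (intro exI[of _ "f \<circ> prod.swap"]) auto
  qed
  then obtain f where f: "bounded_borel f" "\<And>z. f z \<noteq> 0" "\<And>s. twisted_integral ?A ?B ?E s f = 0" by blast
  have "\<not> norm_mod_ae (graph_root H s)" for s
  proof
    assume "norm_mod_ae (graph_root H s)"
    moreover have "graph_root H s f = 0"
      using f(3) by (simp add: graph_root_borel[OF H f(1)] graph_functional_def)
    ultimately have "AE z in lebesgue_on unit_square. f z = 0"
      using bounded_borel_bdd_meas[OF f(1)] unfolding norm_mod_ae_def ae_zero_def by blast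
    \<comment> \<open>\<open>f\<close> has no zeros, so its vanishing almost everywhere would make
      the square a null set.\<close>
    then have "AE z in lebesgue_on unit_square. False" using f(2) by simp
    then have "AE z in lborel. z \<notin> unit_square"
      using unit_square_measurable by (simp add: AE_restrict_space_iff AE_completion_iff)
    then have "emeasure lborel unit_square = 0"
      using AE_iff_measurable[of unit_square lborel "\<lambda>z. z \<notin> unit_square"] unit_square_measurable by simp
    then show False
      unfolding unit_square_def
      by (simp add: lborel_prod[symmetric] lborel.emeasure_pair_measure_Times)
  qed
  ultimately show ?thesis using seminorm_graph_root_iff[OF H] ne by blast
qed

theorem seminorm_not_norm_iff:
  assumes "bipartite_graph H" "no_isolated_vertices H"
  shows "(\<exists>s. seminorm_on bdd_meas (graph_root H s)) \<and> \<not> (\<exists>s. norm_mod_ae (graph_root H s))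
    \<longleftrightarrow> one_or_even_star_forest H"
proof
  assume L: "(\<exists>s. seminorm_on bdd_meas (graph_root H s)) \<and> \<not> (\<exists>s. norm_mod_ae (graph_root H s))"
  then obtain s where "seminorm_on bdd_meas (graph_root H s)" by (elim conjE exE)
  moreover have "\<not> norm_mod_ae (graph_root H s)" using L by simp
  ultimately show "one_or_even_star_forest H" by (rule star_forest_if_seminorm_not_norm[OF assms])
next
  assume "one_or_even_star_forest H"
  from star_forest_seminorm_not_norm[OF assms(1) this]
  show "(\<exists>s. seminorm_on bdd_meas (graph_root H s)) \<and> \<not> (\<exists>s. norm_mod_ae (graph_root H s))"
    by simp
qed

end

section \<open>The real and the complex case\<close>

interpretation real_identity: modulus_conjugation "\<lambda>x :: real. x"
  by unfold_locales (simp_all add: power2_eq_square)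

interpretation complex_conjugation: modulus_conjugation cnj
  by unfold_locales (simp_all only: complex_norm_square complex_cnj_add complex_cnj_mult)

lemma real_graph_root: "real_identity.graph_root H s = (\<lambda>f. \<bar>t_real H f\<bar> powr (1 / real (card (edges H))))"
proof
  fix f :: "real \<times> real \<Rightarrow> real"
  have twist: "real_identity.twist b z = z" for b and z :: real
    by (simp add: real_identity.twist_def)
  have "real_identity.graph_integral H s f = t_real H f"
    unfolding real_identity.graph_integral_def t_real_def case_prod_unfold twist ..
  then show "real_identity.graph_root H s f = \<bar>t_real H f\<bar> powr (1 / real (card (edges H)))"
    by (simp only: real_identity.graph_root_def real_norm_def)
qed

lemma complex_graph_root:
  assumes "\<And>e. e \<in> edges H \<Longrightarrow> \<alpha> e \<in> {0, 1} \<and> (s e \<longleftrightarrow> \<alpha> e = 1)"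
  shows "complex_conjugation.graph_root H s
    = (\<lambda>f. norm (t_complex H \<alpha> f) powr (1 / real (card (edges H))))"
proof
  fix f :: "real \<times> real \<Rightarrow> complex"
  have twist: "complex_conjugation.twist (s e) z = z ^ \<alpha> e * cnj z ^ (1 - \<alpha> e)" if "e \<in> edges H" for e z
    using assms[OF that] by (auto simp: complex_conjugation.twist_def)
  have "(\<Prod>e\<in>edges H. complex_conjugation.twist (s e) (f (fst p (fst e), snd p (snd e))))
    = (\<Prod>e\<in>edges H. f (fst p (fst e), snd p (snd e)) ^ \<alpha> (fst e, snd e)
        * cnj (f (fst p (fst e), snd p (snd e))) ^ (1 - \<alpha> (fst e, snd e)))" for p
    unfolding prod.collapse by (rule prod.cong[OF refl twist])
  then have "complex_conjugation.graph_integral H s f = t_complex H \<alpha> f"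
    unfolding complex_conjugation.graph_integral_def t_complex_def case_prod_unfold by (simp only:)
  then show "complex_conjugation.graph_root H s f = norm (t_complex H \<alpha> f) powr (1 / real (card (edges H)))"
    by (simp only: complex_conjugation.graph_root_def)
qed

lemma real_seminorming_not_norming_iff:
  assumes "bipartite_graph H" "no_isolated_vertices H"
  shows "real_seminorming H \<and> \<not> real_norming H \<longleftrightarrow> one_or_even_star_forest H"
  using real_identity.seminorm_not_norm_iff[OF assms]
  \<comment> \<open>Over the reals the rewritten functional is the same for all \<open>s\<close>,
    and \<open>simp_thms\<close> removes the quantifiers over \<open>s\<close>.\<close>
  unfolding real_graph_root real_seminorming_def real_norming_def simp_thms .

lemma complex_seminorming_not_norming_iff:
  assumes "bipartite_graph H" "no_isolated_vertices H"
  shows "complex_seminorming H \<and> \<not> complex_norming H \<longleftrightarrow> one_or_even_star_forest H"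
proof -
  \<comment> \<open>\<open>Q\<close> stands for either property, so one translation between
    \<open>\<alpha>\<close> and \<open>s\<close> serves both seminorming and norming.\<close>
  have ex: "(\<exists>\<alpha>\<in>edges H \<rightarrow> {0, 1}. Q (\<lambda>f. norm (t_complex H \<alpha> f) powr (1 / real (card (edges H)))))
      \<longleftrightarrow> (\<exists>s. Q (complex_conjugation.graph_root H s))" for Q
  proof
    assume "\<exists>\<alpha>\<in>edges H \<rightarrow> {0, 1}. Q (\<lambda>f. norm (t_complex H \<alpha> f) powr (1 / real (card (edges H))))"
    then obtain \<alpha> where \<alpha>: "\<alpha> \<in> edges H \<rightarrow> {0, 1}"
      "Q (\<lambda>f. norm (t_complex H \<alpha> f) powr (1 / real (card (edges H))))" by (elim bexE)
    have "\<alpha> e \<in> {0, 1}" if "e \<in> edges H" for e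
      by (rule funcset_mem[OF \<alpha>(1) that])
    then have eq: "complex_conjugation.graph_root H (\<lambda>e. \<alpha> e = 1)
        = (\<lambda>f. norm (t_complex H \<alpha> f) powr (1 / real (card (edges H))))"
      by (intro complex_graph_root conjI refl)
    show "\<exists>s. Q (complex_conjugation.graph_root H s)"
      by (rule exI[of _ "\<lambda>e. \<alpha> e = 1"]) (rule \<alpha>(2)[folded eq])
  next
    assume "\<exists>s. Q (complex_conjugation.graph_root H s)"
    then obtain s where s: "Q (complex_conjugation.graph_root H s)" by (elim exE)
    have eq: "complex_conjugation.graph_root H s
        = (\<lambda>f. norm (t_complex H (\<lambda>e. of_bool (s e)) f) powr (1 / real (card (edges H))))"
      by (rule complex_graph_root) simp
    have "(\<lambda>e. of_bool (s e)) \<in> edges H \<rightarrow> {0, 1 :: nat}"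
      by (rule funcsetI) simp
    then show "\<exists>\<alpha>\<in>edges H \<rightarrow> {0, 1}. Q (\<lambda>f. norm (t_complex H \<alpha> f) powr (1 / real (card (edges H))))"
      by (rule bexI[rotated]) (rule s[unfolded eq])
  qed
  show ?thesis
    unfolding complex_seminorming_def complex_norming_def ex[of "seminorm_on bdd_meas"] ex[of norm_mod_ae]
    by (rule complex_conjugation.seminorm_not_norm_iff[OF assms])
qed

theorem theorem4p1:
  fixes H :: "('a, 'b) bigraph"
  assumes "bipartite_graph H"
    and "no_isolated_vertices H"
  shows "(complex_seminorming H \<and> \<not> complex_norming H
            \<longleftrightarrow> real_seminorming H \<and> \<not> real_norming H) \<and>
         (real_seminorming H \<and> \<not> real_norming H
            \<longleftrightarrow> (\<exists>m d :: nat. 0 < m \<and> 0 < d \<and>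
                  (isomorphic H (copies m (complete_bipartite 1 1)) \<or>
                   isomorphic H (copies m (complete_bipartite 1 (2 * d))) \<or>
                   isomorphic H (copies m (complete_bipartite (2 * d) 1)))))"
  unfolding complex_seminorming_not_norming_iff[OF assms] real_seminorming_not_norming_iff[OF assms]
  by (intro conjI refl one_or_even_star_forest_iff[OF assms(1)])

end
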